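(* Let $\mathbb K$ be a field, let $M$ be a finitely generated, reduced, torsion-free and cancellative binoid and let $\mathbb K[M]$ be its binoid algebra. Then \[ (\mathcal O_{\mathbb K[M]}^* )^{\mathrm{comb}}\cong(\mathbb K^* )^{\mathrm{comb}}\oplus(i_*\mathcal O^*_M)^{\mathrm{comb}}, \] where $\mathbb K^*$ is the constant sheaf.
   Context: A (commutative) binoid is a commutative monoid $(M,+,0)$ with an absorbing element $\infty$; $M^\bullet=M\smallsetminus\{\infty\}$. $M$ is cancellative if $a+b=a+c\neq\infty$ implies $b=c$; torsion-free if $na=nb$ with $n\geq1$ implies $a=b$; reduced if $nf=\infty$ for some $n\geq1$ implies $f=\infty$. An ideal of $M$ is a subset $I\ni\infty$ with $I+M\subseteq I$; it is prime if $M\smallsetminus I$ is a submonoid. $\operatorname{Spec}M$ is the set of prime ideals with basis of open sets $D(f)=\{\mathfrak p\mid f\notin\mathfrak p\}$. The structure sheaf $\mathcal O_M$ is the sheaf of binoids with $\mathcal O_M(D(f))=M_f$; $\mathcal O_M^*$ is its sheaf of units. The binoid algebra $\mathbb K[M]$ is the $\mathbb K$-algebra with $\mathbb K$-basis $\{T^a\mid a\in M^\bullet\}$ and multiplication $T^aT^b=T^{a+b}$, where $T^\infty=0$. For an ideal $I$ of $M$, $\mathbb K[I]$ is the ideal of $\mathbb K[M]$ spanned by the $T^a$, $a\in I$. Ideals of the form $\mathbb K[I]$ are called combinatorial. The map $i:\operatorname{Spec}M\to\operatorname{Spec}\mathbb K[M]$, $\mathfrak p\mapsto\mathbb K[\mathfrak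 p]$, is well defined and continuous for the Zariski topologies. $\mathcal O_{\mathbb K[M]}^*$ is the sheaf of units of the structure sheaf of $\operatorname{Spec}\mathbb K[M]$. The combinatorial topology on $\operatorname{Spec}\mathbb K[M]$ has as open sets the sets $D(\mathfrak A)$ with $\mathfrak A$ a combinatorial ideal (a basis is given by the $D(P)$ with $P$ a monomial). For a Zariski sheaf $\mathscr F$ on $\operatorname{Spec}\mathbb K[M]$, $\mathscr F^{\mathrm{comb}}$ denotes its restriction to the combinatorial open sets, which is a sheaf for the combinatorial topology. The isomorphism is one of sheaves of abelian groups for the combinatorial topology. *)

theory Defs
  imports "HOL-Algebra.Ideal" "HOL-Analysis.Abstract_Topology"
begin

section \<open>Binoids\<close>

text \<open>The binary operation of a binoid is written multiplicatively, so that the notions for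
  monoids of HOL-Algebra apply: \<open>a + b\<close>, \<open>0\<close> and \<open>n a\<close> become \<open>a \<otimes> b\<close>, \<open>\<one>\<close> and \<open>a [^] n\<close>.
  The case \<open>\<one> = infty\<close> (the zero binoid) is allowed.\<close>

record 'a binoid = "'a monoid" +
  infty :: 'a

locale binoid = comm_monoid M for M (structure) +
  assumes infty_closed [simp, intro]: "infty M \<in> carrier M"
    and infty_absorb [simp]: "a \<in> carrier M \<Longrightarrow> infty M \<otimes> a = infty M"

definition finite_part :: "('a, 'b) binoid_scheme \<Rightarrow> 'a set"
  where "finite_part M = carrier M - {infty M}"

definition binoid_cancellative :: "('a, 'b) binoid_scheme \<Rightarrow> bool"
  where "binoid_cancellative M \<longleftrightarrow>
    (\<forall>a\<in>carrier M. \<forall>b\<in>carrier M. \<forall>c\<in>carrier M.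
      a \<otimes>\<^bsub>M\<^esub> b = a \<otimes>\<^bsub>M\<^esub> c \<and> a \<otimes>\<^bsub>M\<^esub> b \<noteq> infty M \<longrightarrow> b = c)"

definition binoid_torsion_free :: "('a, 'b) binoid_scheme \<Rightarrow> bool"
  where "binoid_torsion_free M \<longleftrightarrow>
    (\<forall>a\<in>carrier M. \<forall>b\<in>carrier M. \<forall>n::nat.
      n \<ge> 1 \<and> a [^]\<^bsub>M\<^esub> n = b [^]\<^bsub>M\<^esub> n \<longrightarrow> a = b)"

definition binoid_reduced :: "('a, 'b) binoid_scheme \<Rightarrow> bool"
  where "binoid_reduced M \<longleftrightarrow>
    (\<forall>f\<in>carrier M. \<forall>n::nat. n \<ge> 1 \<and> f [^]\<^bsub>M\<^esub> n = infty M \<longrightarrow> f = infty M)"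

definition binoid_finitely_generated :: "('a, 'b) binoid_scheme \<Rightarrow> bool"
  where "binoid_finitely_generated M \<longleftrightarrow>
    (\<exists>A. finite A \<and> A \<subseteq> carrier M \<and>
      (\<forall>N. submonoid N M \<and> insert (infty M) A \<subseteq> N \<longrightarrow> N = carrier M))"

definition binoid_ideal :: "('a, 'b) binoid_scheme \<Rightarrow> 'a set \<Rightarrow> bool"
  where "binoid_ideal M I \<longleftrightarrow>
    I \<subseteq> carrier M \<and> infty M \<in> I \<and> (\<forall>a\<in>I. \<forall>b\<in>carrier M. a \<otimes>\<^bsub>M\<^esub> b \<in> I)"

definition binoid_prime :: "('a, 'b) binoid_scheme \<Rightarrow> 'a set \<Rightarrow> bool"
  where "binoid_prime M I \<longleftrightarrow> binoid_ideal M I \<and> submonoid (carrier M - I) M"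

definition binoid_basic_open :: "('a, 'b) binoid_scheme \<Rightarrow> 'a \<Rightarrow> 'a set set"
  where "binoid_basic_open M f = {p. binoid_prime M p \<and> f \<notin> p}"

definition binoid_Spec :: "('a, 'b) binoid_scheme \<Rightarrow> 'a set topology"
  where "binoid_Spec M = topology_generated_by {binoid_basic_open M f |f. f \<in> carrier M}"


section \<open>Localization\<close>

text \<open>For a submonoid \<open>S\<close> of a commutative monoid \<open>R\<close>, the localization is the set of classes of
  pairs \<open>(a, s)\<close>, where \<open>(a, s) \<sim> (b, t)\<close> iff \<open>u t a = u s b\<close> for some \<open>u\<close> in \<open>S\<close>. It is used both
  for binoids and for commutative rings, with the additional operations of each.\<close>

definition loc_rel :: "('a, 'b) monoid_scheme \<Rightarrow> 'a set \<Rightarrow> (('a \<times> 'a) \<times> ('a \<times> 'a)) set"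
  where "loc_rel R S =
    {((a, s), (b, t)). a \<in> carrier R \<and> s \<in> S \<and> b \<in> carrier R \<and> t \<in> S \<and>
      (\<exists>u\<in>S. u \<otimes>\<^bsub>R\<^esub> (t \<otimes>\<^bsub>R\<^esub> a) = u \<otimes>\<^bsub>R\<^esub> (s \<otimes>\<^bsub>R\<^esub> b))}"

definition loc_frac :: "('a, 'b) monoid_scheme \<Rightarrow> 'a set \<Rightarrow> 'a \<Rightarrow> 'a \<Rightarrow> ('a \<times> 'a) set"
  where "loc_frac R S a s = loc_rel R S `` {(a, s)}"

definition loc_carrier :: "('a, 'b) monoid_scheme \<Rightarrow> 'a set \<Rightarrow> ('a \<times> 'a) set set"
  where "loc_carrier R S = (carrier R \<times> S) // loc_rel R S"

definition loc_mult ::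
  "('a, 'b) monoid_scheme \<Rightarrow> 'a set \<Rightarrow> ('a \<times> 'a) set \<Rightarrow> ('a \<times> 'a) set \<Rightarrow> ('a \<times> 'a) set"
  where "loc_mult R S X Y =
    (\<Union>(a, s)\<in>X. \<Union>(b, t)\<in>Y. loc_frac R S (a \<otimes>\<^bsub>R\<^esub> b) (s \<otimes>\<^bsub>R\<^esub> t))"

definition loc_add ::
  "('a, 'b) ring_scheme \<Rightarrow> 'a set \<Rightarrow> ('a \<times> 'a) set \<Rightarrow> ('a \<times> 'a) set \<Rightarrow> ('a \<times> 'a) set"
  where "loc_add R S X Y =
    (\<Union>(a, s)\<in>X. \<Union>(b, t)\<in>Y.
      loc_frac R S ((t \<otimes>\<^bsub>R\<^esub> a) \<oplus>\<^bsub>R\<^esub> (s \<otimes>\<^bsub>R\<^esub> b)) (s \<otimes>\<^bsub>R\<^esub> t))"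

definition binoid_localization :: "('a, 'b) binoid_scheme \<Rightarrow> 'a set \<Rightarrow> ('a \<times> 'a) set binoid"
  where "binoid_localization M S =
    \<lparr>carrier = loc_carrier M S, mult = loc_mult M S, one = loc_frac M S \<one>\<^bsub>M\<^esub> \<one>\<^bsub>M\<^esub>,
     infty = loc_frac M S (infty M) \<one>\<^bsub>M\<^esub>\<rparr>"

definition ring_localization :: "('a, 'b) ring_scheme \<Rightarrow> 'a set \<Rightarrow> ('a \<times> 'a) set ring"
  where "ring_localization R S =
    \<lparr>carrier = loc_carrier R S, mult = loc_mult R S, one = loc_frac R S \<one>\<^bsub>R\<^esub> \<one>\<^bsub>R\<^esub>,
     zero = loc_frac R S \<zero>\<^bsub>R\<^esub> \<one>\<^bsub>R\<^esub>, add = loc_add R S\<rparr>"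


section \<open>Sheaves\<close>

text \<open>A presheaf on the space \<open>base_space F\<close>; only the values at open sets are meaningful. The type
  \<open>'s\<close> is the type of the algebraic structures of sections, \<open>'g\<close> that of single sections.\<close>

record ('p, 's, 'g) presheaf =
  base_space :: "'p topology"
  sections :: "'p set \<Rightarrow> 's"
  restr :: "'p set \<Rightarrow> 'p set \<Rightarrow> 'g \<Rightarrow> 'g"

text \<open>An isomorphism of sheaves of groups is an isomorphism of the underlying presheaves.\<close>

definition sheaf_isomorphic ::
  "('p, 'g monoid, 'g) presheaf \<Rightarrow> ('p, 'h monoid, 'h) presheaf \<Rightarrow> bool"
  where "sheaf_isomorphic F G \<longleftrightarrow> base_space F = base_space G \<and>
    (\<exists>\<phi>. (\<forall>U. openin (base_space F) U \<longrightarrow> \<phi> U \<in> iso (sections F U) (sections G U)) \<and>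
         (\<forall>U V. openin (base_space F) U \<and> openin (base_space F) V \<and> V \<subseteq> U \<longrightarrow>
            (\<forall>s\<in>carrier (sections F U). \<phi> V (restr F U V s) = restr G U V (\<phi> U s))))"

definition sheaf_direct_sum ::
  "('p, 'g monoid, 'g) presheaf \<Rightarrow> ('p, 'h monoid, 'h) presheaf
    \<Rightarrow> ('p, ('g \<times> 'h) monoid, 'g \<times> 'h) presheaf"
  where "sheaf_direct_sum F G =
    \<lparr>base_space = base_space F, sections = (\<lambda>U. sections F U \<times>\<times> sections G U),
     restr = (\<lambda>U V. map_prod (restr F U V) (restr G U V))\<rparr>"

definition pushforward ::
  "'q topology \<Rightarrow> ('p \<Rightarrow> 'q) \<Rightarrow> ('p, 's, 'g) presheaf \<Rightarrow> ('q, 's, 'g) presheaf"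
  where "pushforward Y i F =
    (let pre = (\<lambda>U. {p \<in> topspace (base_space F). i p \<in> U})
     in \<lparr>base_space = Y, sections = (\<lambda>U. sections F (pre U)),
         restr = (\<lambda>U V. restr F (pre U) (pre V))\<rparr>)"

definition units_sheaf ::
  "('p, ('g, 'z) monoid_scheme, 'g) presheaf \<Rightarrow> ('p, 'g monoid, 'g) presheaf"
  where "units_sheaf F =
    \<lparr>base_space = base_space F, sections = (\<lambda>U. units_of (sections F U)), restr = restr F\<rparr>"

text \<open>The sections of the constant sheaf are the locally constant functions.\<close>

definition constant_sheaf ::
  "'p topology \<Rightarrow> ('g, 'z) monoid_scheme \<Rightarrow> ('p, ('p \<Rightarrow> 'g) monoid, 'p \<Rightarrow> 'g) presheaf"
  where "constant_sheaf X G =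
    \<lparr>base_space = X,
     sections = (\<lambda>U.
       \<lparr>carrier = {s \<in> U \<rightarrow>\<^sub>E carrier G.
          \<forall>p\<in>U. \<exists>V. openin X V \<and> p \<in> V \<and> V \<subseteq> U \<and> (\<forall>q\<in>V. s q = s p)},
        mult = (\<lambda>s t. \<lambda>p\<in>U. s p \<otimes>\<^bsub>G\<^esub> t p), one = (\<lambda>p\<in>U. \<one>\<^bsub>G\<^esub>)\<rparr>),
     restr = (\<lambda>U V s. restrict s V)\<rparr>"

text \<open>The functions on \<open>U\<close> with values in the localizations \<open>R\<^sub>p\<close> that are locally given by one
  fraction; here the points of the space \<open>X\<close> are prime ideals of \<open>R\<close>.\<close>

definition fraction_sections ::
  "('a, 'b) monoid_scheme \<Rightarrow> 'a set topology \<Rightarrow> 'a set set \<Rightarrow> ('a set \<Rightarrow> ('a \<times> 'a) set) set"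
  where "fraction_sections R X U =
    {s \<in> (\<Pi>\<^sub>E p\<in>U. loc_carrier R (carrier R - p)).
      \<forall>p\<in>U. \<exists>V. openin X V \<and> p \<in> V \<and> V \<subseteq> U \<and>
        (\<exists>a\<in>carrier R. \<exists>f\<in>carrier R. \<forall>q\<in>V. f \<notin> q \<and> s q = loc_frac R (carrier R - q) a f)}"

text \<open>The sheaf of binoids with value \<open>M\<^sub>f\<close> at \<open>D(f)\<close>; for this value see the lemma
  \<open>sections_basic_open\<close> below.\<close>

definition binoid_structure_sheaf :: "('a, 'b) binoid_scheme \<Rightarrow>
    ('a set, ('a set \<Rightarrow> ('a \<times> 'a) set) binoid, 'a set \<Rightarrow> ('a \<times> 'a) set) presheaf"
  where "binoid_structure_sheaf M =
    (let L = (\<lambda>p. binoid_localization M (carrier M - p))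
     in \<lparr>base_space = binoid_Spec M,
         sections = (\<lambda>U. \<lparr>carrier = fraction_sections M (binoid_Spec M) U,
           mult = (\<lambda>s t. \<lambda>p\<in>U. s p \<otimes>\<^bsub>L p\<^esub> t p), one = (\<lambda>p\<in>U. \<one>\<^bsub>L p\<^esub>),
           infty = (\<lambda>p\<in>U. infty (L p))\<rparr>),
         restr = (\<lambda>U V s. restrict s V)\<rparr>)"

definition ring_open :: "('a, 'b) ring_scheme \<Rightarrow> 'a set \<Rightarrow> 'a set set"
  where "ring_open R A = {P. primeideal P R \<and> \<not> A \<subseteq> P}"

definition ring_Spec :: "('a, 'b) ring_scheme \<Rightarrow> 'a set topology"
  where "ring_Spec R = topology_generated_by {ring_open R {f} |f. f \<in> carrier R}"

definition ring_structure_sheaf :: "('a, 'b) ring_scheme \<Rightarrow>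
    ('a set, ('a set \<Rightarrow> ('a \<times> 'a) set) ring, 'a set \<Rightarrow> ('a \<times> 'a) set) presheaf"
  where "ring_structure_sheaf R =
    (let L = (\<lambda>p. ring_localization R (carrier R - p))
     in \<lparr>base_space = ring_Spec R,
         sections = (\<lambda>U. \<lparr>carrier = fraction_sections R (ring_Spec R) U,
           mult = (\<lambda>s t. \<lambda>p\<in>U. s p \<otimes>\<^bsub>L p\<^esub> t p), one = (\<lambda>p\<in>U. \<one>\<^bsub>L p\<^esub>),
           zero = (\<lambda>p\<in>U. \<zero>\<^bsub>L p\<^esub>), add = (\<lambda>s t. \<lambda>p\<in>U. s p \<oplus>\<^bsub>L p\<^esub> t p)\<rparr>),
         restr = (\<lambda>U V s. restrict s V)\<rparr>)"


section \<open>Binoid algebras\<close>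

text \<open>Elements are the coefficient functions of the finite sums of \<open>c T\<^sup>a\<close> with \<open>a \<noteq> infty\<close>.
  Products \<open>T\<^sup>a T\<^sup>b\<close> with \<open>a \<otimes> b = infty\<close> contribute to no coefficient. Note that
  \<open>monomial K M (infty M)\<close> is zero.\<close>

definition supp :: "('k, 'c) ring_scheme \<Rightarrow> ('m, 'b) binoid_scheme \<Rightarrow> ('m \<Rightarrow> 'k) \<Rightarrow> 'm set"
  where "supp K M f = {a \<in> finite_part M. f a \<noteq> \<zero>\<^bsub>K\<^esub>}"

definition monomial :: "('k, 'c) ring_scheme \<Rightarrow> ('m, 'b) binoid_scheme \<Rightarrow> 'm \<Rightarrow> 'm \<Rightarrow> 'k"
  where "monomial K M a = (\<lambda>b\<in>finite_part M. if b = a then \<one>\<^bsub>K\<^esub> else \<zero>\<^bsub>K\<^esub>)"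

definition binoid_algebra ::
  "('k, 'c) ring_scheme \<Rightarrow> ('m, 'b) binoid_scheme \<Rightarrow> ('m \<Rightarrow> 'k) ring"
  where "binoid_algebra K M =
    \<lparr>carrier = {f \<in> finite_part M \<rightarrow>\<^sub>E carrier K. finite (supp K M f)},
     mult = (\<lambda>f g. \<lambda>c\<in>finite_part M.
       \<Oplus>\<^bsub>K\<^esub>a\<in>supp K M f. \<Oplus>\<^bsub>K\<^esub>b\<in>supp K M g.
         if a \<otimes>\<^bsub>M\<^esub> b = c then f a \<otimes>\<^bsub>K\<^esub> g b else \<zero>\<^bsub>K\<^esub>),
     one = monomial K M \<one>\<^bsub>M\<^esub>,
     zero = (\<lambda>a\<in>finite_part M. \<zero>\<^bsub>K\<^esub>),
     add = (\<lambda>f g. \<lambda>a\<in>finite_part M. f a \<oplus>\<^bsub>K\<^esub> g a)\<rparr>"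

text \<open>The ideal \<open>K[I]\<close>. As a function on the prime ideals of \<open>M\<close> this is the map from the
  spectrum of \<open>M\<close> to the spectrum of the binoid algebra.\<close>

definition combinatorial_ideal ::
  "('k, 'c) ring_scheme \<Rightarrow> ('m, 'b) binoid_scheme \<Rightarrow> 'm set \<Rightarrow> ('m \<Rightarrow> 'k) set"
  where "combinatorial_ideal K M I = Idl\<^bsub>binoid_algebra K M\<^esub> (monomial K M ` I)"

text \<open>The open sets of this topology are exactly the \<open>D(\<AA>)\<close> with \<open>\<AA>\<close> combinatorial; see the
  lemma \<open>openin_combinatorial_topology_iff\<close> below.\<close>

definition combinatorial_topology ::
  "('k, 'c) ring_scheme \<Rightarrow> ('m, 'b) binoid_scheme \<Rightarrow> ('m \<Rightarrow> 'k) set topology"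
  where "combinatorial_topology K M =
    topology_generated_by
      {ring_open (binoid_algebra K M) (combinatorial_ideal K M I) |I. binoid_ideal M I}"

definition comb :: "('k, 'c) ring_scheme \<Rightarrow> ('m, 'b) binoid_scheme \<Rightarrow>
    (('m \<Rightarrow> 'k) set, 's, 'g) presheaf \<Rightarrow> (('m \<Rightarrow> 'k) set, 's, 'g) presheaf"
  where "comb K M F = F\<lparr>base_space := combinatorial_topology K M\<rparr>"


section \<open>Consistency checks\<close>

subsection \<open>The binoid algebra is a commutative ring\<close>

locale binoid_over_cring = K?: cring K + M?: binoid M
  for K :: "('k, 'c) ring_scheme" (structure) and M :: "('m, 'b) binoid_scheme" (structure)
begin

abbreviation (input) KM where "KM \<equiv> binoid_algebra K M"

lemma finite_part_closed [simp]: "a \<in> finite_part M \<Longrightarrow> a \<in> carrier M"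
  by (simp add: finite_part_def)

lemma finite_part_factor:
  assumes "a \<in> carrier M" "b \<in> carrier M" "a \<otimes>\<^bsub>M\<^esub> b \<in> finite_part M"
  shows "a \<in> finite_part M" "b \<in> finite_part M"
proof -
  have "b \<otimes>\<^bsub>M\<^esub> a = a \<otimes>\<^bsub>M\<^esub> b" using assms by (simp add: M.m_comm)
  then show "a \<in> finite_part M" "b \<in> finite_part M"
    using assms M.infty_absorb[of a] M.infty_absorb[of b] by (auto simp: finite_part_def)
qed

lemma algebra_carrier_iff:
  "f \<in> carrier KM \<longleftrightarrow> f \<in> finite_part M \<rightarrow>\<^sub>E carrier K \<and> finite (supp K M f)"
  by (simp add: binoid_algebra_def)

lemma algebra_ops:
  "\<one>\<^bsub>KM\<^esub> = monomial K M \<one>\<^bsub>M\<^esub>"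
  "\<zero>\<^bsub>KM\<^esub> = (\<lambda>a\<in>finite_part M. \<zero>\<^bsub>K\<^esub>)"
  "f \<oplus>\<^bsub>KM\<^esub> g = (\<lambda>a\<in>finite_part M. f a \<oplus>\<^bsub>K\<^esub> g a)"
  by (simp_all only: binoid_algebra_def monoid.simps ring.simps)

lemma algebra_mult:
  "f \<otimes>\<^bsub>KM\<^esub> g = (\<lambda>c\<in>finite_part M.
    \<Oplus>\<^bsub>K\<^esub>a\<in>supp K M f. \<Oplus>\<^bsub>K\<^esub>b\<in>supp K M g.
      if a \<otimes>\<^bsub>M\<^esub> b = c then f a \<otimes>\<^bsub>K\<^esub> g b else \<zero>\<^bsub>K\<^esub>)"
  by (simp only: binoid_algebra_def monoid.simps)

lemma coeff_closed: "f \<in> carrier KM \<Longrightarrow> a \<in> finite_part M \<Longrightarrow> f a \<in> carrier K"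
  by (auto simp: algebra_carrier_iff)

lemma supp_subset: "supp K M f \<subseteq> finite_part M"
  by (auto simp: supp_def)

lemma coeff_supp_closed: "f \<in> carrier KM \<Longrightarrow> a \<in> supp K M f \<Longrightarrow> f a \<in> carrier K"
  using supp_subset coeff_closed by blast

lemma algebra_eqI:
  assumes "f \<in> carrier KM" "g \<in> carrier KM" "\<And>a. a \<in> finite_part M \<Longrightarrow> f a = g a"
  shows "f = g"
  using assms by (intro PiE_ext[of f "finite_part M" _ g]) (auto simp: algebra_carrier_iff)

lemma finsum_swap:
  assumes "finite A" "finite B" "\<And>a b. a \<in> A \<Longrightarrow> b \<in> B \<Longrightarrow> h a b \<in> carrier K"
  shows "(\<Oplus>\<^bsub>K\<^esub>a\<in>A. \<Oplus>\<^bsub>K\<^esub>b\<in>B. h a b) = (\<Oplus>\<^bsub>K\<^esub>b\<in>B. \<Oplus>\<^bsub>K\<^esub>a\<in>A. h a b)"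
  using assms(1,3)
proof (induction A rule: finite_induct)
  case empty
  then show ?case by (simp add: K.finsum_zero)
next
  case (insert x A)
  have "(\<Oplus>\<^bsub>K\<^esub>b\<in>B. \<Oplus>\<^bsub>K\<^esub>a\<in>insert x A. h a b)
      = (\<Oplus>\<^bsub>K\<^esub>b\<in>B. h x b \<oplus>\<^bsub>K\<^esub> (\<Oplus>\<^bsub>K\<^esub>a\<in>A. h a b))"
    using insert by (intro K.finsum_cong' refl) (auto intro!: K.finsum_closed K.finsum_insert)
  also have "\<dots> = (\<Oplus>\<^bsub>K\<^esub>b\<in>B. h x b) \<oplus>\<^bsub>K\<^esub> (\<Oplus>\<^bsub>K\<^esub>b\<in>B. \<Oplus>\<^bsub>K\<^esub>a\<in>A. h a b)"
    using insert by (intro K.finsum_addf) (auto intro!: K.finsum_closed)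
  finally show ?case
    using insert by (subst K.finsum_insert) (auto intro!: K.finsum_closed)
qed

lemma coeff_mult:
  assumes f: "f \<in> carrier KM" and g: "g \<in> carrier KM" and c: "c \<in> finite_part M"
    and A: "finite A" "supp K M f \<subseteq> A" "A \<subseteq> finite_part M"
    and B: "finite B" "supp K M g \<subseteq> B" "B \<subseteq> finite_part M"
  shows "(f \<otimes>\<^bsub>KM\<^esub> g) c =
    (\<Oplus>\<^bsub>K\<^esub>a\<in>A. \<Oplus>\<^bsub>K\<^esub>b\<in>B. if a \<otimes>\<^bsub>M\<^esub> b = c then f a \<otimes>\<^bsub>K\<^esub> g b else \<zero>\<^bsub>K\<^esub>)"
proof -
  note [simp] = coeff_closed[OF f] coeff_supp_closed[OF f]
    coeff_closed[OF g] coeff_supp_closed[OF g]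
  let ?h = "\<lambda>a b. if a \<otimes>\<^bsub>M\<^esub> b = c then f a \<otimes>\<^bsub>K\<^esub> g b else \<zero>\<^bsub>K\<^esub>"
  have cl: "?h a b \<in> carrier K" if "a \<in> A" "b \<in> B" for a b
    using that A B f g by (auto simp: subset_iff)
  have inner: "(\<Oplus>\<^bsub>K\<^esub>b\<in>supp K M g. ?h a b) = (\<Oplus>\<^bsub>K\<^esub>b\<in>B. ?h a b)" if a: "a \<in> A" for a
  proof (rule K.add.finprod_mono_neutral_cong_left)
    fix b assume b: "b \<in> B - supp K M g"
    then have "g b = \<zero>\<^bsub>K\<^esub>" using B by (auto simp: supp_def)
    moreover have "f a \<in> carrier K" using a A f by auto
    ultimately show "?h a b = \<zero>\<^bsub>K\<^esub>" by simp
  qed (use B cl[OF a] in \<open>auto split: if_splits\<close>)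
  have z: "(\<Oplus>\<^bsub>K\<^esub>b\<in>B. ?h a b) = \<zero>\<^bsub>K\<^esub>" if "a \<in> A - supp K M f" for a
  proof -
    have "f a = \<zero>\<^bsub>K\<^esub>" using that A by (auto simp: supp_def)
    then have "?h a b = \<zero>\<^bsub>K\<^esub>" if "b \<in> B" for b
      using that B g by (auto simp: subset_iff)
    then show ?thesis by (rule K.add.finprod_one_eqI)
  qed
  have "(f \<otimes>\<^bsub>KM\<^esub> g) c = (\<Oplus>\<^bsub>K\<^esub>a\<in>supp K M f. \<Oplus>\<^bsub>K\<^esub>b\<in>supp K M g. ?h a b)"
    unfolding algebra_mult using c by (rule restrict_apply')
  also have "\<dots> = (\<Oplus>\<^bsub>K\<^esub>a\<in>A. \<Oplus>\<^bsub>K\<^esub>b\<in>B. ?h a b)"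
    by (rule K.add.finprod_mono_neutral_cong_left)
      (use A z inner cl in \<open>auto intro!: K.finsum_closed simp: Pi_iff\<close>)
  finally show ?thesis .
qed

lemma supp_mult:
  "supp K M (f \<otimes>\<^bsub>KM\<^esub> g) \<subseteq> (\<lambda>(a, b). a \<otimes>\<^bsub>M\<^esub> b) ` (supp K M f \<times> supp K M g)"
proof
  fix c assume c: "c \<in> supp K M (f \<otimes>\<^bsub>KM\<^esub> g)"
  then have cM: "c \<in> finite_part M" and nz: "(f \<otimes>\<^bsub>KM\<^esub> g) c \<noteq> \<zero>\<^bsub>K\<^esub>"
    unfolding supp_def by blast+
  have "\<exists>a\<in>supp K M f. \<exists>b\<in>supp K M g. a \<otimes>\<^bsub>M\<^esub> b = c"
  proof (rule ccontr)
    assume ne: "\<not> ?thesis"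
    have "(f \<otimes>\<^bsub>KM\<^esub> g) c = (\<Oplus>\<^bsub>K\<^esub>a\<in>supp K M f. \<Oplus>\<^bsub>K\<^esub>b\<in>supp K M g.
        if a \<otimes>\<^bsub>M\<^esub> b = c then f a \<otimes>\<^bsub>K\<^esub> g b else \<zero>\<^bsub>K\<^esub>)"
      unfolding algebra_mult using cM by (rule restrict_apply')
    also have "\<dots> = \<zero>\<^bsub>K\<^esub>"
    proof (intro K.add.finprod_one_eqI)
      fix a b assume "a \<in> supp K M f" "b \<in> supp K M g"
      then have "a \<otimes>\<^bsub>M\<^esub> b \<noteq> c" using ne by blast
      then show "(if a \<otimes>\<^bsub>M\<^esub> b = c then f a \<otimes>\<^bsub>K\<^esub> g b else \<zero>\<^bsub>K\<^esub>) = \<zero>\<^bsub>K\<^esub>"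
        by (rule if_not_P)
    qed
    finally show False using nz by contradiction
  qed
  then obtain a b where "(a, b) \<in> supp K M f \<times> supp K M g" "c = a \<otimes>\<^bsub>M\<^esub> b" by blast
  then show "c \<in> (\<lambda>(a, b). a \<otimes>\<^bsub>M\<^esub> b) ` (supp K M f \<times> supp K M g)"
    by (intro rev_image_eqI) auto
qed

lemma supp_finite [simp]: "f \<in> carrier KM \<Longrightarrow> finite (supp K M f)"
  by (simp add: algebra_carrier_iff)

lemma mult_closed [simp]:
  assumes f: "f \<in> carrier KM" and g: "g \<in> carrier KM"
  shows "f \<otimes>\<^bsub>KM\<^esub> g \<in> carrier KM"
proof -
  note [simp] = coeff_closed[OF f] coeff_supp_closed[OF f]
    coeff_closed[OF g] coeff_supp_closed[OF g]
  have "finite (supp K M (f \<otimes>\<^bsub>KM\<^esub> g))"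
    by (rule finite_subset[OF supp_mult]) (use f g in auto)
  moreover have "(f \<otimes>\<^bsub>KM\<^esub> g) c \<in> carrier K" if c: "c \<in> finite_part M" for c
    unfolding coeff_mult[OF f g c supp_finite[OF f] order_refl supp_subset
        supp_finite[OF g] order_refl supp_subset]
    using f g by (auto intro!: K.finsum_closed)
  moreover have "f \<otimes>\<^bsub>KM\<^esub> g \<in> extensional (finite_part M)"
    unfolding algebra_mult by (rule restrict_extensional)
  ultimately show ?thesis unfolding algebra_carrier_iff PiE_iff by blast
qed

lemma monomial_closed [simp]: "monomial K M a \<in> carrier KM"
proof -
  have "supp K M (monomial K M a) \<subseteq> {a}"
    by (auto simp: supp_def monomial_def split: if_splits)
  then show ?thesis
    by (auto simp: algebra_carrier_iff monomial_def intro: finite_subset)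
qed

lemma mult_monomial:
  assumes "a \<in> carrier M" "b \<in> carrier M"
  shows "monomial K M a \<otimes>\<^bsub>KM\<^esub> monomial K M b = monomial K M (a \<otimes>\<^bsub>M\<^esub> b)"
proof (rule algebra_eqI)
  fix c assume c: "c \<in> finite_part M"
  let ?A = "{a} \<inter> finite_part M" and ?B = "{b} \<inter> finite_part M"
  have "(monomial K M a \<otimes>\<^bsub>KM\<^esub> monomial K M b) c =
      (\<Oplus>\<^bsub>K\<^esub>x\<in>?A. \<Oplus>\<^bsub>K\<^esub>y\<in>?B. if x \<otimes>\<^bsub>M\<^esub> y = c
        then monomial K M a x \<otimes>\<^bsub>K\<^esub> monomial K M b y else \<zero>\<^bsub>K\<^esub>)"
  proof (rule coeff_mult)
    show "supp K M (monomial K M a) \<subseteq> ?A" "supp K M (monomial K M b) \<subseteq> ?B"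
      by (auto simp: supp_def monomial_def split: if_splits)
  qed (use c in auto)
  also have "\<dots> = (if a \<otimes>\<^bsub>M\<^esub> b = c then \<one>\<^bsub>K\<^esub> else \<zero>\<^bsub>K\<^esub>)"
  proof (cases "a \<in> finite_part M \<and> b \<in> finite_part M")
    case True
    then show ?thesis by (simp add: monomial_def)
  next
    case False
    then have "a \<otimes>\<^bsub>M\<^esub> b \<noteq> c" using finite_part_factor[OF assms] c by auto
    then show ?thesis using False by (cases "a \<in> finite_part M") (auto simp: monomial_def)
  qed
  also have "\<dots> = monomial K M (a \<otimes>\<^bsub>M\<^esub> b) c" using c by (simp add: monomial_def)
  finally show "(monomial K M a \<otimes>\<^bsub>KM\<^esub> monomial K M b) c = monomial K M (a \<otimes>\<^bsub>M\<^esub> b) c" .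
qed auto

lemma mult_comm:
  assumes f: "f \<in> carrier KM" and g: "g \<in> carrier KM"
  shows "f \<otimes>\<^bsub>KM\<^esub> g = g \<otimes>\<^bsub>KM\<^esub> f"
proof (rule algebra_eqI)
  note [simp] = coeff_closed[OF f] coeff_supp_closed[OF f]
    coeff_closed[OF g] coeff_supp_closed[OF g]
  fix c assume c: "c \<in> finite_part M"
  let ?h = "\<lambda>a b. if a \<otimes>\<^bsub>M\<^esub> b = c then f a \<otimes>\<^bsub>K\<^esub> g b else \<zero>\<^bsub>K\<^esub>"
  have cl: "?h a b \<in> carrier K" if "a \<in> supp K M f" "b \<in> supp K M g" for a b
    using that f g by auto
  have "(f \<otimes>\<^bsub>KM\<^esub> g) c = (\<Oplus>\<^bsub>K\<^esub>a\<in>supp K M f. \<Oplus>\<^bsub>K\<^esub>b\<in>supp K M g. ?h a b)"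
    unfolding algebra_mult using c by (rule restrict_apply')
  also have "\<dots> = (\<Oplus>\<^bsub>K\<^esub>b\<in>supp K M g. \<Oplus>\<^bsub>K\<^esub>a\<in>supp K M f. ?h a b)"
    by (rule finsum_swap) (use f g cl in auto)
  also have "\<dots> = (\<Oplus>\<^bsub>K\<^esub>b\<in>supp K M g. \<Oplus>\<^bsub>K\<^esub>a\<in>supp K M f.
      if b \<otimes>\<^bsub>M\<^esub> a = c then g b \<otimes>\<^bsub>K\<^esub> f a else \<zero>\<^bsub>K\<^esub>)"
  proof (intro K.finsum_cong' refl)
    fix a b assume ab: "b \<in> supp K M g" "a \<in> supp K M f"
    then have "a \<in> carrier M" "b \<in> carrier M" using supp_subset by (auto simp: finite_part_def supp_def)
    then show "?h a b = (if b \<otimes>\<^bsub>M\<^esub> a = c then g b \<otimes>\<^bsub>K\<^esub> f a else \<zero>\<^bsub>K\<^esub>)"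
      using ab f g by (auto simp: M.m_comm K.m_comm)
  qed (use f g in \<open>auto intro!: K.finsum_closed\<close>)
  also have "\<dots> = (g \<otimes>\<^bsub>KM\<^esub> f) c"
    unfolding algebra_mult using c by (rule restrict_apply'[symmetric])
  finally show "(f \<otimes>\<^bsub>KM\<^esub> g) c = (g \<otimes>\<^bsub>KM\<^esub> f) c" .
qed (use f g in auto)

lemma coeff_mult_assoc:
  assumes f: "f \<in> carrier KM" and g: "g \<in> carrier KM" and h: "h \<in> carrier KM"
    and d: "d \<in> finite_part M"
  shows "((f \<otimes>\<^bsub>KM\<^esub> g) \<otimes>\<^bsub>KM\<^esub> h) d =
    (\<Oplus>\<^bsub>K\<^esub>a\<in>supp K M f. \<Oplus>\<^bsub>K\<^esub>b\<in>supp K M g. \<Oplus>\<^bsub>K\<^esub>c\<in>supp K M h.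
      if a \<otimes>\<^bsub>M\<^esub> b \<otimes>\<^bsub>M\<^esub> c = d then f a \<otimes>\<^bsub>K\<^esub> g b \<otimes>\<^bsub>K\<^esub> h c else \<zero>\<^bsub>K\<^esub>)"
    (is "_ = ?rhs")
proof -
  note [simp] = coeff_closed[OF f] coeff_supp_closed[OF f]
    coeff_closed[OF g] coeff_supp_closed[OF g]
    coeff_closed[OF h] coeff_supp_closed[OF h]
  let ?A = "supp K M f" and ?B = "supp K M g" and ?C = "supp K M h"
  have inM: "a \<in> carrier M" if "a \<in> supp K M x" for a x
    using that supp_subset by (auto simp: supp_def)
  define E where "E = ((\<lambda>(a, b). a \<otimes>\<^bsub>M\<^esub> b) ` (?A \<times> ?B)) \<inter> finite_part M"
  have E: "finite E" "E \<subseteq> finite_part M" "supp K M (f \<otimes>\<^bsub>KM\<^esub> g) \<subseteq> E"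
    using f g supp_mult[of f g] supp_subset unfolding E_def by auto
  have EM: "e \<in> carrier M" if "e \<in> E" for e
    using that E by auto
  define k where "k = (\<lambda>a b c e. if a \<otimes>\<^bsub>M\<^esub> b = e \<and> e \<otimes>\<^bsub>M\<^esub> c = d
    then f a \<otimes>\<^bsub>K\<^esub> g b \<otimes>\<^bsub>K\<^esub> h c else \<zero>\<^bsub>K\<^esub>)"
  have kcl: "k a b c e \<in> carrier K" if "a \<in> ?A" "b \<in> ?B" "c \<in> ?C" for a b c e
    using that f g h by (auto simp: k_def)
  have "((f \<otimes>\<^bsub>KM\<^esub> g) \<otimes>\<^bsub>KM\<^esub> h) d =
      (\<Oplus>\<^bsub>K\<^esub>e\<in>E. \<Oplus>\<^bsub>K\<^esub>c\<in>?C. if e \<otimes>\<^bsub>M\<^esub> c = d then (f \<otimes>\<^bsub>KM\<^esub> g) e \<otimes>\<^bsub>K\<^esub> h c else \<zero>\<^bsub>K\<^esub>)"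
    by (rule coeff_mult) (use f g h d E supp_subset in auto)
  also have "\<dots> = (\<Oplus>\<^bsub>K\<^esub>e\<in>E. \<Oplus>\<^bsub>K\<^esub>c\<in>?C. \<Oplus>\<^bsub>K\<^esub>a\<in>?A. \<Oplus>\<^bsub>K\<^esub>b\<in>?B. k a b c e)"
  proof (intro K.finsum_cong' refl)
    fix e c assume e: "e \<in> E" and c: "c \<in> ?C"
    have hc: "h c \<in> carrier K" using c h by auto
    have fg: "(f \<otimes>\<^bsub>KM\<^esub> g) e =
        (\<Oplus>\<^bsub>K\<^esub>a\<in>?A. \<Oplus>\<^bsub>K\<^esub>b\<in>?B. if a \<otimes>\<^bsub>M\<^esub> b = e then f a \<otimes>\<^bsub>K\<^esub> g b else \<zero>\<^bsub>K\<^esub>)"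
      unfolding algebra_mult using subsetD[OF E(2) e] by (rule restrict_apply')
    show "(if e \<otimes>\<^bsub>M\<^esub> c = d then (f \<otimes>\<^bsub>KM\<^esub> g) e \<otimes>\<^bsub>K\<^esub> h c else \<zero>\<^bsub>K\<^esub>)
        = (\<Oplus>\<^bsub>K\<^esub>a\<in>?A. \<Oplus>\<^bsub>K\<^esub>b\<in>?B. k a b c e)"
    proof (cases "e \<otimes>\<^bsub>M\<^esub> c = d")
      case True
      have "(f \<otimes>\<^bsub>KM\<^esub> g) e \<otimes>\<^bsub>K\<^esub> h c = (\<Oplus>\<^bsub>K\<^esub>a\<in>?A.
          (\<Oplus>\<^bsub>K\<^esub>b\<in>?B. if a \<otimes>\<^bsub>M\<^esub> b = e then f a \<otimes>\<^bsub>K\<^esub> g b else \<zero>\<^bsub>K\<^esub>) \<otimes>\<^bsub>K\<^esub> h c)"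
        unfolding fg using f g hc
        by (intro K.finsum_ldistr) (auto intro!: K.finsum_closed)
      also have "\<dots> = (\<Oplus>\<^bsub>K\<^esub>a\<in>?A. \<Oplus>\<^bsub>K\<^esub>b\<in>?B.
          (if a \<otimes>\<^bsub>M\<^esub> b = e then f a \<otimes>\<^bsub>K\<^esub> g b else \<zero>\<^bsub>K\<^esub>) \<otimes>\<^bsub>K\<^esub> h c)"
        using f g hc
        by (intro K.finsum_cong' refl K.finsum_ldistr) (auto intro!: K.finsum_closed)
      also have "\<dots> = (\<Oplus>\<^bsub>K\<^esub>a\<in>?A. \<Oplus>\<^bsub>K\<^esub>b\<in>?B. k a b c e)"
      proof (intro K.finsum_cong' refl)
        fix a b assume "a \<in> ?A" "b \<in> ?B"
        then show "(if a \<otimes>\<^bsub>M\<^esub> b = e then f a \<otimes>\<^bsub>K\<^esub> g b else \<zero>\<^bsub>K\<^esub>) \<otimes>\<^bsub>K\<^esub> h c = k a b c e"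
          using hc True by (simp add: k_def)
      qed (use c kcl in \<open>auto intro!: K.finsum_closed\<close>)
      finally show ?thesis using True by simp
    next
      case False
      then show ?thesis by (simp add: k_def K.finsum_zero)
    qed
  qed (use kcl in \<open>auto intro!: K.finsum_closed\<close>)
  also have "\<dots> = (\<Oplus>\<^bsub>K\<^esub>e\<in>E. \<Oplus>\<^bsub>K\<^esub>a\<in>?A. \<Oplus>\<^bsub>K\<^esub>b\<in>?B. \<Oplus>\<^bsub>K\<^esub>c\<in>?C. k a b c e)"
  proof (rule K.finsum_cong'[OF refl])
    fix e assume "e \<in> E"
    have "(\<Oplus>\<^bsub>K\<^esub>c\<in>?C. \<Oplus>\<^bsub>K\<^esub>a\<in>?A. \<Oplus>\<^bsub>K\<^esub>b\<in>?B. k a b c e)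
        = (\<Oplus>\<^bsub>K\<^esub>a\<in>?A. \<Oplus>\<^bsub>K\<^esub>c\<in>?C. \<Oplus>\<^bsub>K\<^esub>b\<in>?B. k a b c e)"
      by (rule finsum_swap) (use f h kcl in \<open>auto intro!: K.finsum_closed\<close>)
    also have "\<dots> = (\<Oplus>\<^bsub>K\<^esub>a\<in>?A. \<Oplus>\<^bsub>K\<^esub>b\<in>?B. \<Oplus>\<^bsub>K\<^esub>c\<in>?C. k a b c e)"
      by (intro K.finsum_cong' refl finsum_swap)
        (use g h kcl in \<open>auto intro!: K.finsum_closed\<close>)
    finally show "(\<Oplus>\<^bsub>K\<^esub>c\<in>?C. \<Oplus>\<^bsub>K\<^esub>a\<in>?A. \<Oplus>\<^bsub>K\<^esub>b\<in>?B. k a b c e)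
        = (\<Oplus>\<^bsub>K\<^esub>a\<in>?A. \<Oplus>\<^bsub>K\<^esub>b\<in>?B. \<Oplus>\<^bsub>K\<^esub>c\<in>?C. k a b c e)" .
  qed (use kcl in \<open>auto intro!: K.finsum_closed\<close>)
  also have "\<dots> = (\<Oplus>\<^bsub>K\<^esub>a\<in>?A. \<Oplus>\<^bsub>K\<^esub>e\<in>E. \<Oplus>\<^bsub>K\<^esub>b\<in>?B. \<Oplus>\<^bsub>K\<^esub>c\<in>?C. k a b c e)"
    by (rule finsum_swap) (use f E kcl in \<open>auto intro!: K.finsum_closed\<close>)
  also have "\<dots> = (\<Oplus>\<^bsub>K\<^esub>a\<in>?A. \<Oplus>\<^bsub>K\<^esub>b\<in>?B. \<Oplus>\<^bsub>K\<^esub>e\<in>E. \<Oplus>\<^bsub>K\<^esub>c\<in>?C. k a b c e)"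
    by (intro K.finsum_cong' refl finsum_swap)
      (use g E kcl in \<open>auto intro!: K.finsum_closed\<close>)
  also have "\<dots> = (\<Oplus>\<^bsub>K\<^esub>a\<in>?A. \<Oplus>\<^bsub>K\<^esub>b\<in>?B. \<Oplus>\<^bsub>K\<^esub>c\<in>?C. \<Oplus>\<^bsub>K\<^esub>e\<in>E. k a b c e)"
    by (intro K.finsum_cong' refl finsum_swap)
      (use h E kcl in \<open>auto intro!: K.finsum_closed\<close>)
  also have "\<dots> = ?rhs"
  proof (intro K.finsum_cong' refl)
    fix a b c assume abc: "a \<in> ?A" "b \<in> ?B" "c \<in> ?C"
    let ?v = "f a \<otimes>\<^bsub>K\<^esub> g b \<otimes>\<^bsub>K\<^esub> h c"
    have v: "?v \<in> carrier K" using abc f g h by auto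
    show "(\<Oplus>\<^bsub>K\<^esub>e\<in>E. k a b c e) = (if a \<otimes>\<^bsub>M\<^esub> b \<otimes>\<^bsub>M\<^esub> c = d then ?v else \<zero>\<^bsub>K\<^esub>)"
    proof (cases "a \<otimes>\<^bsub>M\<^esub> b \<otimes>\<^bsub>M\<^esub> c = d")
      case True
      then have "a \<otimes>\<^bsub>M\<^esub> b \<in> finite_part M"
        using finite_part_factor(1)[of "a \<otimes>\<^bsub>M\<^esub> b" c] abc inM d by auto
      then have abE: "a \<otimes>\<^bsub>M\<^esub> b \<in> E" using abc by (auto simp: E_def)
      have "(\<Oplus>\<^bsub>K\<^esub>e\<in>E. k a b c e) = (\<Oplus>\<^bsub>K\<^esub>e\<in>E. if a \<otimes>\<^bsub>M\<^esub> b = e then ?v else \<zero>\<^bsub>K\<^esub>)"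
        using True v by (intro K.finsum_cong' refl) (auto simp: k_def)
      also have "\<dots> = ?v"
        using K.finsum_singleton[OF abE E(1), of "\<lambda>_. ?v"] v by simp
      finally show ?thesis using True by simp
    next
      case False
      then have "k a b c e = \<zero>\<^bsub>K\<^esub>" for e by (auto simp: k_def)
      then show ?thesis using False by (simp add: K.finsum_zero)
    qed
  qed (use f g h in \<open>auto intro!: K.finsum_closed\<close>)
  finally show ?thesis .
qed

lemma mult_assoc:
  assumes f: "f \<in> carrier KM" and g: "g \<in> carrier KM" and h: "h \<in> carrier KM"
  shows "(f \<otimes>\<^bsub>KM\<^esub> g) \<otimes>\<^bsub>KM\<^esub> h = f \<otimes>\<^bsub>KM\<^esub> (g \<otimes>\<^bsub>KM\<^esub> h)"
proof (rule algebra_eqI)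
  note [simp] = coeff_closed[OF f] coeff_supp_closed[OF f]
    coeff_closed[OF g] coeff_supp_closed[OF g]
    coeff_closed[OF h] coeff_supp_closed[OF h]
  fix d assume d: "d \<in> finite_part M"
  let ?A = "supp K M f" and ?B = "supp K M g" and ?C = "supp K M h"
  have inM: "a \<in> carrier M" if "a \<in> supp K M x" for a x
    using that supp_subset by (auto simp: supp_def)
  have "(f \<otimes>\<^bsub>KM\<^esub> (g \<otimes>\<^bsub>KM\<^esub> h)) d = ((g \<otimes>\<^bsub>KM\<^esub> h) \<otimes>\<^bsub>KM\<^esub> f) d"
    by (subst mult_comm) (use f g h in auto)
  also have "\<dots> = (\<Oplus>\<^bsub>K\<^esub>b\<in>?B. \<Oplus>\<^bsub>K\<^esub>c\<in>?C. \<Oplus>\<^bsub>K\<^esub>a\<in>?A.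
      if b \<otimes>\<^bsub>M\<^esub> c \<otimes>\<^bsub>M\<^esub> a = d then g b \<otimes>\<^bsub>K\<^esub> h c \<otimes>\<^bsub>K\<^esub> f a else \<zero>\<^bsub>K\<^esub>)"
    by (rule coeff_mult_assoc) (use f g h d in auto)
  also have "\<dots> = (\<Oplus>\<^bsub>K\<^esub>b\<in>?B. \<Oplus>\<^bsub>K\<^esub>a\<in>?A. \<Oplus>\<^bsub>K\<^esub>c\<in>?C.
      if b \<otimes>\<^bsub>M\<^esub> c \<otimes>\<^bsub>M\<^esub> a = d then g b \<otimes>\<^bsub>K\<^esub> h c \<otimes>\<^bsub>K\<^esub> f a else \<zero>\<^bsub>K\<^esub>)"
    by (intro K.finsum_cong' refl finsum_swap) (use f g h in \<open>auto intro!: K.finsum_closed\<close>)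
  also have "\<dots> = (\<Oplus>\<^bsub>K\<^esub>a\<in>?A. \<Oplus>\<^bsub>K\<^esub>b\<in>?B. \<Oplus>\<^bsub>K\<^esub>c\<in>?C.
      if b \<otimes>\<^bsub>M\<^esub> c \<otimes>\<^bsub>M\<^esub> a = d then g b \<otimes>\<^bsub>K\<^esub> h c \<otimes>\<^bsub>K\<^esub> f a else \<zero>\<^bsub>K\<^esub>)"
    by (rule finsum_swap) (use f g h in \<open>auto intro!: K.finsum_closed\<close>)
  also have "\<dots> = (\<Oplus>\<^bsub>K\<^esub>a\<in>?A. \<Oplus>\<^bsub>K\<^esub>b\<in>?B. \<Oplus>\<^bsub>K\<^esub>c\<in>?C.
      if a \<otimes>\<^bsub>M\<^esub> b \<otimes>\<^bsub>M\<^esub> c = d then f a \<otimes>\<^bsub>K\<^esub> g b \<otimes>\<^bsub>K\<^esub> h c else \<zero>\<^bsub>K\<^esub>)"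
  proof (intro K.finsum_cong' refl)
    fix a b c assume abc: "a \<in> ?A" "b \<in> ?B" "c \<in> ?C"
    have "b \<otimes>\<^bsub>M\<^esub> c \<otimes>\<^bsub>M\<^esub> a = a \<otimes>\<^bsub>M\<^esub> b \<otimes>\<^bsub>M\<^esub> c"
      using inM[OF abc(1)] inM[OF abc(2)] inM[OF abc(3)] by (simp add: M.m_ac)
    moreover have "g b \<otimes>\<^bsub>K\<^esub> h c \<otimes>\<^bsub>K\<^esub> f a = f a \<otimes>\<^bsub>K\<^esub> g b \<otimes>\<^bsub>K\<^esub> h c"
      using f g h abc by (simp add: K.m_ac)
    ultimately show "(if b \<otimes>\<^bsub>M\<^esub> c \<otimes>\<^bsub>M\<^esub> a = d then g b \<otimes>\<^bsub>K\<^esub> h c \<otimes>\<^bsub>K\<^esub> f a else \<zero>\<^bsub>K\<^esub>)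
        = (if a \<otimes>\<^bsub>M\<^esub> b \<otimes>\<^bsub>M\<^esub> c = d then f a \<otimes>\<^bsub>K\<^esub> g b \<otimes>\<^bsub>K\<^esub> h c else \<zero>\<^bsub>K\<^esub>)"
      by simp
  qed (use f g h in \<open>auto intro!: K.finsum_closed\<close>)
  also have "\<dots> = ((f \<otimes>\<^bsub>KM\<^esub> g) \<otimes>\<^bsub>KM\<^esub> h) d"
    by (rule coeff_mult_assoc[symmetric]) (use f g h d in auto)
  finally show "((f \<otimes>\<^bsub>KM\<^esub> g) \<otimes>\<^bsub>KM\<^esub> h) d = (f \<otimes>\<^bsub>KM\<^esub> (g \<otimes>\<^bsub>KM\<^esub> h)) d" ..
qed (use f g h in auto)

lemma one_mult:
  assumes f: "f \<in> carrier KM"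
  shows "\<one>\<^bsub>KM\<^esub> \<otimes>\<^bsub>KM\<^esub> f = f"
proof (rule algebra_eqI)
  note [simp] = coeff_closed[OF f] coeff_supp_closed[OF f]
  fix c assume c: "c \<in> finite_part M"
  have one: "\<one>\<^bsub>M\<^esub> \<in> finite_part M"
    using finite_part_factor(1)[of "\<one>\<^bsub>M\<^esub>" c] c by simp
  have "(\<one>\<^bsub>KM\<^esub> \<otimes>\<^bsub>KM\<^esub> f) c = (\<Oplus>\<^bsub>K\<^esub>a\<in>{\<one>\<^bsub>M\<^esub>}. \<Oplus>\<^bsub>K\<^esub>b\<in>insert c (supp K M f).
      if a \<otimes>\<^bsub>M\<^esub> b = c then monomial K M \<one>\<^bsub>M\<^esub> a \<otimes>\<^bsub>K\<^esub> f b else \<zero>\<^bsub>K\<^esub>)"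
    unfolding algebra_ops(1) 
  proof (rule coeff_mult)
    show "supp K M (monomial K M \<one>\<^bsub>M\<^esub>) \<subseteq> {\<one>\<^bsub>M\<^esub>}"
      by (auto simp: supp_def monomial_def split: if_splits)
    show "insert c (supp K M f) \<subseteq> finite_part M" using c supp_subset by blast
  qed (use c f one in auto)
  also have "\<dots> = (\<Oplus>\<^bsub>K\<^esub>b\<in>insert c (supp K M f).
      if \<one>\<^bsub>M\<^esub> \<otimes>\<^bsub>M\<^esub> b = c then monomial K M \<one>\<^bsub>M\<^esub> \<one>\<^bsub>M\<^esub> \<otimes>\<^bsub>K\<^esub> f b else \<zero>\<^bsub>K\<^esub>)"
    (is "(\<Oplus>\<^bsub>K\<^esub>a\<in>_. ?g a) = ?g \<one>\<^bsub>M\<^esub>")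
  proof -
    have "?g \<one>\<^bsub>M\<^esub> \<in> carrier K"
      using f c one by (intro K.finsum_closed) (auto simp: monomial_def)
    then show ?thesis by (simp add: K.finsum_insert)
  qed
  also have "\<dots> = (\<Oplus>\<^bsub>K\<^esub>b\<in>insert c (supp K M f). if c = b then f b else \<zero>\<^bsub>K\<^esub>)"
    using f c one supp_subset[of f]
    by (intro K.finsum_cong' refl) (auto simp: monomial_def supp_def)
  also have "\<dots> = f c"
    by (rule K.finsum_singleton) (use f c in auto)
  finally show "(\<one>\<^bsub>KM\<^esub> \<otimes>\<^bsub>KM\<^esub> f) c = f c" .
next
  show "\<one>\<^bsub>KM\<^esub> \<otimes>\<^bsub>KM\<^esub> f \<in> carrier KM"
    by (rule mult_closed) (use f in \<open>simp_all add: algebra_ops\<close>)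
qed (use f in auto)

lemma add_closed:
  assumes f: "f \<in> carrier KM" and g: "g \<in> carrier KM"
  shows "f \<oplus>\<^bsub>KM\<^esub> g \<in> carrier KM"
proof -
  note [simp] = coeff_closed[OF f] coeff_supp_closed[OF f]
    coeff_closed[OF g] coeff_supp_closed[OF g]
  have "supp K M (f \<oplus>\<^bsub>KM\<^esub> g) \<subseteq> supp K M f \<union> supp K M g"
    by (auto simp: supp_def algebra_ops)
  then have "finite (supp K M (f \<oplus>\<^bsub>KM\<^esub> g))"
    using f g by (meson finite_UnI finite_subset supp_finite)
  then show ?thesis
    using f g by (auto simp: algebra_carrier_iff algebra_ops)
qed

lemma mult_distrib:
  assumes f: "f \<in> carrier KM" and g: "g \<in> carrier KM" and h: "h \<in> carrier KM"
  shows "(f \<oplus>\<^bsub>KM\<^esub> g) \<otimes>\<^bsub>KM\<^esub> h = f \<otimes>\<^bsub>KM\<^esub> h \<oplus>\<^bsub>KM\<^esub> g \<otimes>\<^bsub>KM\<^esub> h"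
proof (rule algebra_eqI)
  note [simp] = coeff_closed[OF f] coeff_supp_closed[OF f]
    coeff_closed[OF g] coeff_supp_closed[OF g]
    coeff_closed[OF h] coeff_supp_closed[OF h]
  fix d assume d: "d \<in> finite_part M"
  let ?A = "supp K M f \<union> supp K M g" and ?C = "supp K M h"
  let ?t = "\<lambda>k a c. if a \<otimes>\<^bsub>M\<^esub> c = d then k a \<otimes>\<^bsub>K\<^esub> h c else \<zero>\<^bsub>K\<^esub>"
  have A: "finite ?A" "?A \<subseteq> finite_part M"
    using f g supp_subset by auto
  then have cl: "k a \<in> carrier K" if "a \<in> ?A" "k \<in> carrier KM" for k a
    using that coeff_closed by blast
  have *: "(k \<otimes>\<^bsub>KM\<^esub> h) d = (\<Oplus>\<^bsub>K\<^esub>a\<in>?A. \<Oplus>\<^bsub>K\<^esub>c\<in>?C. ?t k a c)"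
    if "k \<in> carrier KM" "supp K M k \<subseteq> ?A" for k
    by (rule coeff_mult) (use that A h d supp_subset in auto)
  have fg: "f \<oplus>\<^bsub>KM\<^esub> g \<in> carrier KM" by (rule add_closed[OF f g])
  have "((f \<oplus>\<^bsub>KM\<^esub> g) \<otimes>\<^bsub>KM\<^esub> h) d = (\<Oplus>\<^bsub>K\<^esub>a\<in>?A. \<Oplus>\<^bsub>K\<^esub>c\<in>?C. ?t (f \<oplus>\<^bsub>KM\<^esub> g) a c)"
    by (rule *[OF fg]) (auto simp: supp_def algebra_ops)
  also have "\<dots> = (\<Oplus>\<^bsub>K\<^esub>a\<in>?A. \<Oplus>\<^bsub>K\<^esub>c\<in>?C. ?t f a c \<oplus>\<^bsub>K\<^esub> ?t g a c)"
  proof (intro K.finsum_cong' refl)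
    fix a c assume a: "a \<in> ?A" and c: "c \<in> ?C"
    have "(f \<oplus>\<^bsub>KM\<^esub> g) a = f a \<oplus>\<^bsub>K\<^esub> g a" using a A by (auto simp: algebra_ops)
    moreover have "f a \<in> carrier K" "g a \<in> carrier K" using cl[OF a] f g by blast+
    ultimately show "?t (f \<oplus>\<^bsub>KM\<^esub> g) a c = ?t f a c \<oplus>\<^bsub>K\<^esub> ?t g a c"
      using c h by (simp add: K.l_distr)
  qed (use cl[OF _ f] cl[OF _ g] h in \<open>auto intro!: K.finsum_closed\<close>)
  also have "\<dots> = (\<Oplus>\<^bsub>K\<^esub>a\<in>?A. (\<Oplus>\<^bsub>K\<^esub>c\<in>?C. ?t f a c) \<oplus>\<^bsub>K\<^esub> (\<Oplus>\<^bsub>K\<^esub>c\<in>?C. ?t g a c))"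
    by (intro K.finsum_cong' refl K.finsum_addf)
      (use cl[OF _ f] cl[OF _ g] h in \<open>auto intro!: K.finsum_closed\<close>)
  also have "\<dots> = (\<Oplus>\<^bsub>K\<^esub>a\<in>?A. \<Oplus>\<^bsub>K\<^esub>c\<in>?C. ?t f a c) \<oplus>\<^bsub>K\<^esub> (\<Oplus>\<^bsub>K\<^esub>a\<in>?A. \<Oplus>\<^bsub>K\<^esub>c\<in>?C. ?t g a c)"
    by (intro K.finsum_addf) (use cl[OF _ f] cl[OF _ g] h in \<open>auto intro!: K.finsum_closed\<close>)
  also have "\<dots> = (f \<otimes>\<^bsub>KM\<^esub> h \<oplus>\<^bsub>KM\<^esub> g \<otimes>\<^bsub>KM\<^esub> h) d"
    using *[OF f] *[OF g] d by (simp add: algebra_ops)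
  finally show "((f \<oplus>\<^bsub>KM\<^esub> g) \<otimes>\<^bsub>KM\<^esub> h) d = (f \<otimes>\<^bsub>KM\<^esub> h \<oplus>\<^bsub>KM\<^esub> g \<otimes>\<^bsub>KM\<^esub> h) d" .
qed (use f g h add_closed in auto)

theorem binoid_algebra_cring: "cring KM"
proof (rule cringI)
  show "abelian_group KM"
  proof (rule abelian_groupI)
    show z: "\<zero>\<^bsub>KM\<^esub> \<in> carrier KM"
      by (auto simp: algebra_carrier_iff algebra_ops supp_def cong: conj_cong)
    fix f assume f: "f \<in> carrier KM"
    note [simp] = coeff_closed[OF f]
    show "\<zero>\<^bsub>KM\<^esub> \<oplus>\<^bsub>KM\<^esub> f = f"
      by (rule algebra_eqI[OF add_closed[OF z f] f]) (simp add: algebra_ops)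
    let ?g = "\<lambda>a\<in>finite_part M. \<ominus>\<^bsub>K\<^esub> f a"
    have "supp K M ?g \<subseteq> supp K M f"
      using f by (auto simp: supp_def)
    then have g: "?g \<in> carrier KM"
      using f by (auto simp: algebra_carrier_iff intro: finite_subset)
    have "?g \<oplus>\<^bsub>KM\<^esub> f = \<zero>\<^bsub>KM\<^esub>"
      by (rule algebra_eqI[OF add_closed[OF g f] z]) (simp add: algebra_ops K.l_neg)
    then show "\<exists>g\<in>carrier KM. g \<oplus>\<^bsub>KM\<^esub> f = \<zero>\<^bsub>KM\<^esub>" using g by blast
    fix g assume g: "g \<in> carrier KM"
    note [simp] = coeff_closed[OF g]
    show fg: "f \<oplus>\<^bsub>KM\<^esub> g \<in> carrier KM" by (rule add_closed[OF f g])
    show "f \<oplus>\<^bsub>KM\<^esub> g = g \<oplus>\<^bsub>KM\<^esub> f"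
      unfolding algebra_ops by (rule restrict_ext) (use f g in \<open>simp add: K.a_comm\<close>)
    fix h assume h: "h \<in> carrier KM"
    note [simp] = coeff_closed[OF h]
    show "f \<oplus>\<^bsub>KM\<^esub> g \<oplus>\<^bsub>KM\<^esub> h = f \<oplus>\<^bsub>KM\<^esub> (g \<oplus>\<^bsub>KM\<^esub> h)"
      unfolding algebra_ops by (rule restrict_ext) (use f g h in \<open>simp add: K.a_assoc\<close>)
  qed
  show "comm_monoid KM"
  proof (rule comm_monoidI)
    show "\<one>\<^bsub>KM\<^esub> \<in> carrier KM" by (simp add: algebra_ops)
  qed (simp_all add: mult_assoc one_mult, simp add: mult_comm)
qed (use mult_distrib in auto)

end


subsection \<open>The combinatorial open sets\<close>

context binoid_over_cring
begin

lemma mem_ring_open_combinatorial_iff: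
  "P \<in> ring_open KM (combinatorial_ideal K M I) \<longleftrightarrow>
    primeideal P KM \<and> (\<exists>a\<in>I. monomial K M a \<notin> P)"
proof (cases "primeideal P KM")
  case True
  interpret KM: cring KM by (rule binoid_algebra_cring)
  have "monomial K M ` I \<subseteq> combinatorial_ideal K M I"
    unfolding combinatorial_ideal_def by (rule KM.genideal_self) auto
  moreover have "combinatorial_ideal K M I \<subseteq> P" if "monomial K M ` I \<subseteq> P"
    unfolding combinatorial_ideal_def
    using KM.genideal_minimal that True primeideal.axioms(1) by blast
  ultimately show ?thesis using True by (auto simp: ring_open_def)
qed (simp add: ring_open_def)

theorem openin_combinatorial_topology_iff:
  "openin (combinatorial_topology K M) U \<longleftrightarrow>
    (\<exists>I. binoid_ideal M I \<and> U = ring_open KM (combinatorial_ideal K M I))"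
proof
  let ?D = "\<lambda>I. ring_open KM (combinatorial_ideal K M I)"
  interpret KM: cring KM by (rule binoid_algebra_cring)
  have z: "?D {infty M} = {}"
  proof -
      have "monomial K M (infty M) = \<zero>\<^bsub>KM\<^esub>"
        unfolding algebra_ops monomial_def
        by (rule restrict_ext) (simp add: finite_part_def)
      then have "monomial K M (infty M) \<in> P" if "primeideal P KM" for P
        using that by (metis additive_subgroup.zero_closed ideal.axioms(1) primeideal.axioms(1))
      then show ?thesis using mem_ring_open_combinatorial_iff by blast
  qed
  assume "openin (combinatorial_topology K M) U"
  then have "generate_topology_on {?D I |I. binoid_ideal M I} U"
    unfolding combinatorial_topology_def openin_topology_generated_by_iff .
  then show "\<exists>I. binoid_ideal M I \<and> U = ?D I"
  proof induction
    case Empty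
    have "binoid_ideal M {infty M}" by (simp add: binoid_ideal_def)
    then show ?case using z by metis
  next
    case (Int U V)
    then obtain I J where I: "binoid_ideal M I" "U = ?D I" and J: "binoid_ideal M J" "V = ?D J"
      by blast
    have sub: "I \<subseteq> carrier M" "J \<subseteq> carrier M" using I J by (auto simp: binoid_ideal_def)
    have "U \<inter> V = ?D (I \<inter> J)"
    proof (intro equalityI subsetI)
      fix P assume "P \<in> U \<inter> V"
      then obtain a b where P: "primeideal P KM"
        and a: "a \<in> I" "monomial K M a \<notin> P" and b: "b \<in> J" "monomial K M b \<notin> P"
        using I J mem_ring_open_combinatorial_iff by auto
      have ab: "a \<in> carrier M" "b \<in> carrier M" using a b sub by auto
      have "monomial K M (a \<otimes>\<^bsub>M\<^esub> b) \<notin> P"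
        using primeideal.I_prime[OF P, of "monomial K M a" "monomial K M b"] a b
        by (auto simp: mult_monomial[OF ab])
      moreover have "a \<otimes>\<^bsub>M\<^esub> b \<in> I" using I a ab by (simp add: binoid_ideal_def)
      moreover have "b \<otimes>\<^bsub>M\<^esub> a \<in> J" using J b ab by (simp add: binoid_ideal_def)
      ultimately show "P \<in> ?D (I \<inter> J)"
        using P M.m_comm[OF ab] unfolding mem_ring_open_combinatorial_iff by auto
    qed (use I J mem_ring_open_combinatorial_iff in auto)
    moreover have "binoid_ideal M (I \<inter> J)" using I J by (auto simp: binoid_ideal_def)
    ultimately show ?case by blast
  next
    case (UN \<K>)
    define J where "J = insert (infty M) (\<Union>{I. binoid_ideal M I \<and> ?D I \<in> \<K>})"
    have J: "binoid_ideal M J" by (auto simp: J_def binoid_ideal_def)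
    have "\<Union>\<K> = ?D J"
    proof (intro equalityI subsetI)
      fix P assume "P \<in> \<Union>\<K>"
      then obtain U where U: "U \<in> \<K>" "P \<in> U" by blast
      then obtain I where "binoid_ideal M I" "U = ?D I" using UN by blast
      then show "P \<in> ?D J"
        using U mem_ring_open_combinatorial_iff by (auto simp: J_def)
    next
      fix P assume "P \<in> ?D J"
      then obtain a where P: "primeideal P KM" and a: "a \<in> J" "monomial K M a \<notin> P"
        unfolding mem_ring_open_combinatorial_iff by blast
      then have "a \<noteq> infty M" using z mem_ring_open_combinatorial_iff by blast
      then obtain I where "binoid_ideal M I" "?D I \<in> \<K>" "a \<in> I"
        using a by (auto simp: J_def)
      then show "P \<in> \<Union>\<K>" using P a mem_ring_open_combinatorial_iff by blast
    qed
    then show ?case using J by blast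
  next
    case (Basis U)
    then show ?case by blast
  qed
next
  assume "\<exists>I. binoid_ideal M I \<and> U = ring_open KM (combinatorial_ideal K M I)"
  then show "openin (combinatorial_topology K M) U"
    unfolding combinatorial_topology_def by (intro topology_generated_by_Basis) blast
qed

end


subsection \<open>The values of the structure sheaf of a binoid at basic open sets\<close>

context comm_monoid
begin

lemma loc_rel_equiv:
  assumes "submonoid S G"
  shows "equiv (carrier G \<times> S) (loc_rel G S)"
proof (rule equivI)
  interpret submonoid S G by fact
  have S: "s \<in> carrier G" if "s \<in> S" for s using that subset by blast
  show "loc_rel G S \<subseteq> (carrier G \<times> S) \<times> carrier G \<times> S" by (auto simp: loc_rel_def)
  show "refl_on (carrier G \<times> S) (loc_rel G S)"
    by (auto simp: loc_rel_def refl_on_def)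
  show "sym (loc_rel G S)"
    by (rule symI, clarsimp simp: loc_rel_def) metis
  show "trans (loc_rel G S)"
  proof (rule transI, clarsimp simp: loc_rel_def)
    fix a s b t c r u v
    assume c: "a \<in> carrier G" "b \<in> carrier G" "c \<in> carrier G" "s \<in> S" "t \<in> S" "r \<in> S" "u \<in> S" "v \<in> S"
      and 1: "u \<otimes> (t \<otimes> a) = u \<otimes> (s \<otimes> b)" and 2: "v \<otimes> (r \<otimes> b) = v \<otimes> (t \<otimes> c)"
    note cl = c(1-3) c(4-8)[THEN S]
    have "(u \<otimes> v \<otimes> t) \<otimes> (r \<otimes> a) = v \<otimes> r \<otimes> (u \<otimes> (t \<otimes> a))" using cl by (simp add: m_ac)
    also have "\<dots> = v \<otimes> r \<otimes> (u \<otimes> (s \<otimes> b))" by (simp only: 1)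
    also have "\<dots> = u \<otimes> s \<otimes> (v \<otimes> (r \<otimes> b))" using cl by (simp add: m_ac)
    also have "\<dots> = u \<otimes> s \<otimes> (v \<otimes> (t \<otimes> c))" by (simp only: 2)
    also have "\<dots> = (u \<otimes> v \<otimes> t) \<otimes> (s \<otimes> c)" using cl by (simp add: m_ac)
    finally show "\<exists>u\<in>S. u \<otimes> (r \<otimes> a) = u \<otimes> (s \<otimes> c)" using c by blast
  qed
qed

lemma loc_frac_eq_iff:
  assumes "submonoid S G" "a \<in> carrier G" "b \<in> carrier G" "s \<in> S" "t \<in> S"
  shows "loc_frac G S a s = loc_frac G S b t \<longleftrightarrow> (\<exists>u\<in>S. u \<otimes> (t \<otimes> a) = u \<otimes> (s \<otimes> b))"
  unfolding loc_frac_def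
  using eq_equiv_class_iff[OF loc_rel_equiv[OF assms(1)], of "(a, s)" "(b, t)"] assms
  by (simp add: loc_rel_def)

lemma loc_frac_closed:
  assumes "a \<in> carrier G" "s \<in> S"
  shows "loc_frac G S a s \<in> loc_carrier G S"
  unfolding loc_frac_def loc_carrier_def by (rule quotientI) (use assms in simp)

lemma loc_carrierE:
  assumes "X \<in> loc_carrier G S"
  obtains a s where "a \<in> carrier G" "s \<in> S" "X = loc_frac G S a s"
  using assms unfolding loc_frac_def loc_carrier_def by (auto elim!: quotientE)

lemma loc_mult_frac:
  assumes S: "submonoid S G" and "a \<in> carrier G" "b \<in> carrier G" "s \<in> S" "t \<in> S"
  shows "loc_mult G S (loc_frac G S a s) (loc_frac G S b t) = loc_frac G S (a \<otimes> b) (s \<otimes> t)"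
proof -
  interpret submonoid S G by fact
  have cl: "s \<in> carrier G" if "s \<in> S" for s using that subset by blast
  have "loc_frac G S (a \<otimes> b) (s \<otimes> t) = loc_frac G S (a' \<otimes> b') (s' \<otimes> t')"
    if "((a, s), (a', s')) \<in> loc_rel G S" "((b, t), (b', t')) \<in> loc_rel G S" for a s a' s' b t b' t'
  proof -
    from that obtain u v where
      c: "a \<in> carrier G" "a' \<in> carrier G" "b \<in> carrier G" "b' \<in> carrier G"
        "s \<in> S" "s' \<in> S" "t \<in> S" "t' \<in> S" "u \<in> S" "v \<in> S"
      and 1: "u \<otimes> (s' \<otimes> a) = u \<otimes> (s \<otimes> a')" and 2: "v \<otimes> (t' \<otimes> b) = v \<otimes> (t \<otimes> b')"
      by (auto simp: loc_rel_def)
    note cc = c(1-4) c(5-10)[THEN cl]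
    have "(u \<otimes> v) \<otimes> ((s' \<otimes> t') \<otimes> (a \<otimes> b)) = (u \<otimes> (s' \<otimes> a)) \<otimes> (v \<otimes> (t' \<otimes> b))"
      using cc by (simp add: m_ac)
    also have "\<dots> = (u \<otimes> (s \<otimes> a')) \<otimes> (v \<otimes> (t \<otimes> b'))" by (simp only: 1 2)
    also have "\<dots> = (u \<otimes> v) \<otimes> ((s \<otimes> t) \<otimes> (a' \<otimes> b'))" using cc by (simp add: m_ac)
    finally show ?thesis
      using c loc_frac_eq_iff[OF S, of "a \<otimes> b" "a' \<otimes> b'" "s \<otimes> t" "s' \<otimes> t'"] by auto
  qed
  then have "congruent2 (loc_rel G S) (loc_rel G S)
      (\<lambda>x y. case x of (a, s) \<Rightarrow> case y of (b, t) \<Rightarrow> loc_frac G S (a \<otimes> b) (s \<otimes> t))"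
    by (auto simp: congruent2_def)
  from UN_equiv_class2[OF loc_rel_equiv[OF S] loc_rel_equiv[OF S] this, of "(a, s)" "(b, t)"]
  show ?thesis
    using assms unfolding loc_mult_def loc_frac_def[of G S a s] loc_frac_def[of G S b t]
    by (simp add: case_prod_beta)
qed

end

context binoid
begin

lemma prime_submonoid: "binoid_prime M p \<Longrightarrow> submonoid (carrier M - p) M"
  by (simp add: binoid_prime_def)

lemma powers_submonoid: "f \<in> carrier M \<Longrightarrow> submonoid (range (\<lambda>n::nat. f [^] n)) M"
proof (rule submonoid.intro)
  assume f: "f \<in> carrier M"
  then show "range (\<lambda>n::nat. f [^] n) \<subseteq> carrier M" by auto
  show "\<one> \<in> range (\<lambda>n::nat. f [^] n)" by (rule range_eqI[of _ _ 0]) simp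
  show "x \<otimes> y \<in> range (\<lambda>n::nat. f [^] n)"
    if "x \<in> range (\<lambda>n::nat. f [^] n)" "y \<in> range (\<lambda>n::nat. f [^] n)" for x y
    using that f nat_pow_mult[OF f] by blast
qed

lemma basic_open_power:
  assumes "f \<in> carrier M" "p \<in> binoid_basic_open M f"
  shows "f [^] (n::nat) \<in> carrier M - p"
proof -
  interpret submonoid "carrier M - p" M
    using assms prime_submonoid by (simp add: binoid_basic_open_def)
  have "f \<in> carrier M - p" using assms by (simp add: binoid_basic_open_def)
  then show ?thesis by (induction n) (auto simp del: Diff_iff)
qed

lemma basic_open_power_neq_infty:
  assumes "f \<in> carrier M" "p \<in> binoid_basic_open M f"
  shows "f [^] (n::nat) \<noteq> infty M"
  using basic_open_power[OF assms, of n] assms(2)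
  by (auto simp: binoid_basic_open_def binoid_prime_def binoid_ideal_def)

text \<open>If \<open>f\<close> is not nilpotent, \<open>D(f)\<close> has a point with no smaller open neighbourhood.\<close>

lemma basic_open_closed_point:
  assumes f: "f \<in> carrier M" and nil: "\<And>n::nat. f [^] n \<noteq> infty M"
  obtains p where "p \<in> binoid_basic_open M f"
    and "\<And>a. a \<in> carrier M - p \<Longrightarrow> \<exists>b\<in>carrier M. \<exists>n::nat. a \<otimes> b = f [^] n"
    and "\<And>V. openin (binoid_Spec M) V \<Longrightarrow> p \<in> V \<Longrightarrow> binoid_basic_open M f \<subseteq> V"
proof -
  define p where "p = {a \<in> carrier M. \<not> (\<exists>b\<in>carrier M. \<exists>n::nat. a \<otimes> b = f [^] n)}"
  have mem: "a \<notin> p \<longleftrightarrow> (\<exists>b\<in>carrier M. \<exists>n::nat. a \<otimes> b = f [^] n)" if "a \<in> carrier M" for a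
    using that by (simp add: p_def)
  have inf: "infty M \<in> p"
    using nil by (auto simp: p_def dest: sym)
  have "a \<otimes> b \<in> p" if ab: "a \<in> p" "b \<in> carrier M" for a b
  proof (rule ccontr)
    have a: "a \<in> carrier M" using ab by (simp add: p_def)
    assume "a \<otimes> b \<notin> p"
    then obtain c n where c: "c \<in> carrier M" "a \<otimes> b \<otimes> c = f [^] (n::nat)" using mem a ab by auto
    then have "a \<otimes> (b \<otimes> c) = f [^] n" using a ab by (simp add: m_assoc)
    then have "a \<notin> p" using mem[OF a] c ab by blast
    then show False using ab by blast
  qed
  then have ideal: "binoid_ideal M p" using inf by (auto simp: binoid_ideal_def p_def)
  have sub: "submonoid (carrier M - p) M"
  proof (rule submonoid.intro)
    have "\<one> \<otimes> \<one> = f [^] (0::nat)" by simp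
    then show "\<one> \<in> carrier M - p" using mem[OF one_closed] one_closed by blast
    fix a b assume "a \<in> carrier M - p" "b \<in> carrier M - p"
    then obtain c d m n where *: "a \<in> carrier M" "b \<in> carrier M" "c \<in> carrier M" "d \<in> carrier M"
      "a \<otimes> c = f [^] (m::nat)" "b \<otimes> d = f [^] (n::nat)" using mem by auto
    have "(a \<otimes> b) \<otimes> (c \<otimes> d) = (a \<otimes> c) \<otimes> (b \<otimes> d)" using *(1-4) by (simp add: m_ac)
    also have "\<dots> = f [^] (m + n)" using * f by (simp add: nat_pow_mult)
    finally show "a \<otimes> b \<in> carrier M - p" using mem[of "a \<otimes> b"] * by blast
  qed blast
  have "f \<otimes> \<one> = f [^] (1::nat)" using f by simp
  then have "f \<notin> p" using mem[OF f] one_closed by blast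
  then have pU: "p \<in> binoid_basic_open M f"
    using ideal sub by (simp add: binoid_basic_open_def binoid_prime_def)
  have min: "p \<in> V \<longrightarrow> binoid_basic_open M f \<subseteq> V"
    if "generate_topology_on {binoid_basic_open M g |g. g \<in> carrier M} V" for V
    using that
  proof induction
    case (Basis V)
    then obtain g where g: "g \<in> carrier M" "V = binoid_basic_open M g" by blast
    show ?case
    proof (intro impI subsetI)
      fix r assume "p \<in> V" and r: "r \<in> binoid_basic_open M f"
      then obtain b n where b: "b \<in> carrier M" "g \<otimes> b = f [^] (n::nat)"
        using mem g by (auto simp: binoid_basic_open_def)
      have "g \<notin> r"
      proof
        assume "g \<in> r"
        moreover have "binoid_ideal M r" using r by (simp add: binoid_basic_open_def binoid_prime_def)
        ultimately have "g \<otimes> b \<in> r" using b(1) by (simp add: binoid_ideal_def)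
        then show False using b basic_open_power[OF f r, of n] by simp
      qed
      then show "r \<in> V" using r g by (simp add: binoid_basic_open_def)
    qed
  qed blast+
  show thesis
    by (rule that[OF pU]) (use mem min in \<open>auto simp: binoid_Spec_def openin_topology_generated_by_iff\<close>)
qed

theorem sections_basic_open:
  assumes f: "f \<in> carrier M"
  defines "S \<equiv> range (\<lambda>n::nat. f [^] n)" and "U \<equiv> binoid_basic_open M f"
  shows "\<exists>\<phi>\<in>iso (binoid_localization M S) (sections (binoid_structure_sheaf M) U).
    \<forall>a\<in>carrier M. \<forall>s\<in>S. \<phi> (loc_frac M S a s) = (\<lambda>p\<in>U. loc_frac M (carrier M - p) a s)"
proof -
  have S: "submonoid S M" unfolding S_def by (rule powers_submonoid[OF f])
  interpret S: submonoid S M by fact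
  have SM: "s \<in> carrier M" if "s \<in> S" for s using that S.subset by blast
  have Sp: "S \<subseteq> carrier M - p" if "p \<in> U" for p
    using basic_open_power[OF f] that unfolding S_def U_def by blast
  have P: "submonoid (carrier M - p) M" if "p \<in> U" for p
    using that prime_submonoid by (simp add: U_def binoid_basic_open_def)
  have openU: "openin (binoid_Spec M) U"
    unfolding binoid_Spec_def U_def by (rule topology_generated_by_Basis) (use f in blast)
  define \<psi> where "\<psi> a s = (\<lambda>p\<in>U. loc_frac M (carrier M - p) a s)" for a s
  have \<psi>_eq: "\<psi> a s = \<psi> b t \<longleftrightarrow> loc_frac M S a s = loc_frac M S b t"
    if ab: "a \<in> carrier M" "b \<in> carrier M" "s \<in> S" "t \<in> S" for a b s t
  proof
    assume eq: "loc_frac M S a s = loc_frac M S b t"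
    show "\<psi> a s = \<psi> b t"
      unfolding \<psi>_def
    proof (rule restrict_ext)
      fix p assume p: "p \<in> U"
      show "loc_frac M (carrier M - p) a s = loc_frac M (carrier M - p) b t"
        using eq ab Sp[OF p] loc_frac_eq_iff[OF S, of a b s t] loc_frac_eq_iff[OF P[OF p], of a b s t]
        by blast
    qed
  next
    assume eq: "\<psi> a s = \<psi> b t"
    have "\<exists>u\<in>S. u \<otimes> (t \<otimes> a) = u \<otimes> (s \<otimes> b)"
    proof (cases "infty M \<in> S")
      case False
      then have "f [^] (n::nat) \<noteq> infty M" for n unfolding S_def by (metis rangeI)
      then obtain p where p: "p \<in> U"
        and div: "\<And>a. a \<in> carrier M - p \<Longrightarrow> \<exists>b\<in>carrier M. \<exists>n::nat. a \<otimes> b = f [^] n"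
        using basic_open_closed_point[OF f] unfolding U_def by metis
      have "loc_frac M (carrier M - p) a s = loc_frac M (carrier M - p) b t"
        using fun_cong[OF eq, of p] p by (simp add: \<psi>_def)
      then obtain u where u: "u \<in> carrier M - p" "u \<otimes> (t \<otimes> a) = u \<otimes> (s \<otimes> b)"
        using loc_frac_eq_iff[OF P[OF p], of a b s t] ab Sp[OF p] by blast
      obtain v n where v: "v \<in> carrier M" "u \<otimes> v = f [^] (n::nat)" using div[OF u(1)] by blast
      have cl: "u \<in> carrier M" "s \<in> carrier M" "t \<in> carrier M" using u ab SM by auto
      have "(u \<otimes> v) \<otimes> (t \<otimes> a) = v \<otimes> (u \<otimes> (t \<otimes> a))"
        using cl v(1) ab by (simp add: m_ac)
      also have "\<dots> = v \<otimes> (u \<otimes> (s \<otimes> b))" by (simp only: u(2))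
      also have "\<dots> = (u \<otimes> v) \<otimes> (s \<otimes> b)" using cl v(1) ab by (simp add: m_ac)
      finally show ?thesis using v by (auto simp: S_def)
    next
      case True
      then show ?thesis using ab SM by (intro bexI[of _ "infty M"]) auto
    qed
    then show "loc_frac M S a s = loc_frac M S b t" using loc_frac_eq_iff[OF S] ab by blast
  qed
  define \<phi> where "\<phi> X = (THE y. \<exists>a\<in>carrier M. \<exists>s\<in>S. X = loc_frac M S a s \<and> y = \<psi> a s)" for X
  have \<phi>: "\<phi> (loc_frac M S a s) = \<psi> a s" if "a \<in> carrier M" "s \<in> S" for a s
    unfolding \<phi>_def by (rule the_equality) (use that \<psi>_eq in blast)+
  let ?L = "binoid_localization M S" and ?O = "sections (binoid_structure_sheaf M) U"
  have L: "carrier ?L = loc_carrier M S" "mult ?L = loc_mult M S"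
    by (simp_all add: binoid_localization_def)
  have O: "carrier ?O = fraction_sections M (binoid_Spec M) U"
    "x \<otimes>\<^bsub>?O\<^esub> y = (\<lambda>p\<in>U. loc_mult M (carrier M - p) (x p) (y p))" for x y
    by (simp_all add: binoid_structure_sheaf_def binoid_localization_def)
  have \<psi>_closed: "\<psi> a s \<in> fraction_sections M (binoid_Spec M) U" if as: "a \<in> carrier M" "s \<in> S" for a s
    unfolding fraction_sections_def
  proof (intro CollectI conjI ballI)
    show "\<psi> a s \<in> (\<Pi>\<^sub>E p\<in>U. loc_carrier M (carrier M - p))"
      unfolding \<psi>_def using as Sp loc_frac_closed by (auto simp: subset_iff)
    fix p assume p: "p \<in> U"
    show "\<exists>V. openin (binoid_Spec M) V \<and> p \<in> V \<and> V \<subseteq> U \<and> (\<exists>a'\<in>carrier M. \<exists>f\<in>carrier M.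
        \<forall>q\<in>V. f \<notin> q \<and> \<psi> a s q = loc_frac M (carrier M - q) a' f)"
      using openU p as SM Sp unfolding \<psi>_def
      by (intro exI[of _ U] conjI bexI[of _ a] bexI[of _ s]) auto
  qed
  have "\<phi> \<in> hom ?L ?O"
  proof (rule homI)
    fix X assume "X \<in> carrier ?L"
    then show "\<phi> X \<in> carrier ?O"
      unfolding L O by (elim loc_carrierE) (simp add: \<phi> \<psi>_closed)
  next
    fix X Y assume "X \<in> carrier ?L" "Y \<in> carrier ?L"
    then obtain a s b t where ab: "a \<in> carrier M" "s \<in> S" "b \<in> carrier M" "t \<in> S"
      and XY: "X = loc_frac M S a s" "Y = loc_frac M S b t"
      unfolding L by (elim loc_carrierE)
    have "\<psi> (a \<otimes> b) (s \<otimes> t) = (\<lambda>p\<in>U. loc_mult M (carrier M - p) (\<psi> a s p) (\<psi> b t p))"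
      unfolding \<psi>_def
    proof (rule restrict_ext)
      fix p assume p: "p \<in> U"
      then show "loc_frac M (carrier M - p) (a \<otimes> b) (s \<otimes> t) = loc_mult M (carrier M - p)
          ((\<lambda>p\<in>U. loc_frac M (carrier M - p) a s) p) ((\<lambda>p\<in>U. loc_frac M (carrier M - p) b t) p)"
        using loc_mult_frac[OF P[OF p], of a b s t] ab Sp[OF p] by (simp only: restrict_apply') blast
    qed
    then show "\<phi> (X \<otimes>\<^bsub>?L\<^esub> Y) = \<phi> X \<otimes>\<^bsub>?O\<^esub> \<phi> Y"
      unfolding L O XY using ab S by (simp add: loc_mult_frac \<phi>)
  qed
  moreover have "inj_on \<phi> (carrier ?L)"
    unfolding L
  proof (rule inj_onI)
    fix X Y assume "X \<in> loc_carrier M S" "Y \<in> loc_carrier M S" and eq: "\<phi> X = \<phi> Y"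
    then obtain a s b t where ab: "a \<in> carrier M" "s \<in> S" "b \<in> carrier M" "t \<in> S"
      and XY: "X = loc_frac M S a s" "Y = loc_frac M S b t"
      by (elim loc_carrierE)
    show "X = Y" using eq ab \<psi>_eq[of a b s t] unfolding XY by (simp only: \<phi>)
  qed
  moreover have "x \<in> \<phi> ` carrier ?L" if "x \<in> carrier ?O" for x
  proof -
    have x: "x \<in> (\<Pi>\<^sub>E p\<in>U. loc_carrier M (carrier M - p))"
      and loc: "\<And>p. p \<in> U \<Longrightarrow> \<exists>V. openin (binoid_Spec M) V \<and> p \<in> V \<and> V \<subseteq> U \<and>
        (\<exists>a\<in>carrier M. \<exists>g\<in>carrier M. \<forall>q\<in>V. g \<notin> q \<and> x q = loc_frac M (carrier M - q) a g)"
      using that unfolding O fraction_sections_def by blast+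
    have "\<exists>a\<in>carrier M. \<exists>s\<in>S. x = \<psi> a s"
    proof (cases "U = {}")
      case True
      then have "x = \<psi> \<one> \<one>" using x by (auto simp: \<psi>_def)
      then show ?thesis using S.one_closed by blast
    next
      case False
      then have "f [^] (n::nat) \<noteq> infty M" for n
        using basic_open_power_neq_infty[OF f] by (auto simp: U_def)
      then obtain p where p: "p \<in> U"
        and div: "\<And>a. a \<in> carrier M - p \<Longrightarrow> \<exists>b\<in>carrier M. \<exists>n::nat. a \<otimes> b = f [^] n"
        and min: "\<And>V. openin (binoid_Spec M) V \<Longrightarrow> p \<in> V \<Longrightarrow> U \<subseteq> V"
        using basic_open_closed_point[OF f] unfolding U_def by metis
      obtain a g where a: "a \<in> carrier M" "g \<in> carrier M"
        and g: "\<And>q. q \<in> U \<Longrightarrow> g \<notin> q \<and> x q = loc_frac M (carrier M - q) a g"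
      proof -
        obtain V a g where V: "openin (binoid_Spec M) V" "p \<in> V" "a \<in> carrier M" "g \<in> carrier M"
          "\<forall>q\<in>V. g \<notin> q \<and> x q = loc_frac M (carrier M - q) a g" using loc[OF p] by blast
        then have "U \<subseteq> V" using min by blast
        with V show thesis by (intro that[of a g]) auto
      qed
      obtain b n where b: "b \<in> carrier M" "g \<otimes> b = f [^] (n::nat)" using div a g p by blast
      have bS: "g \<otimes> b \<in> S" using b by (simp add: S_def)
      have "x q = \<psi> (a \<otimes> b) (g \<otimes> b) q" if q: "q \<in> U" for q
      proof -
        have "\<one> \<otimes> ((g \<otimes> b) \<otimes> a) = \<one> \<otimes> (g \<otimes> (a \<otimes> b))"
          using a b(1) by (simp add: m_ac)
        then have "loc_frac M (carrier M - q) a g = loc_frac M (carrier M - q) (a \<otimes> b) (g \<otimes> b)"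
          using loc_frac_eq_iff[OF P[OF q], of a "a \<otimes> b" g "g \<otimes> b"] a b g[OF q] bS Sp[OF q]
            submonoid.one_closed[OF P[OF q]] by blast
        then show ?thesis using g[OF q] q by (simp add: \<psi>_def)
      qed
      then have "x = \<psi> (a \<otimes> b) (g \<otimes> b)"
        using x by (intro extensionalityI[of _ U]) (auto simp: \<psi>_def PiE_def)
      then show ?thesis using a b bS by blast
    qed
    then obtain a s where as: "a \<in> carrier M" "s \<in> S" "x = \<psi> a s" by blast
    then have "x = \<phi> (loc_frac M S a s)" by (simp add: \<phi>)
    then show ?thesis using as loc_frac_closed L by blast
  qed
  ultimately have "\<phi> \<in> iso ?L ?O"
    by (auto simp: iso_def bij_betw_def hom_def)
  then show ?thesis using \<phi> by (intro bexI[of _ \<phi>]) (auto simp: \<psi>_def)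
qed

end

end

(*
  A combinatorial open set is the preimage of an open set of Spec M under the retraction that sends a
  prime P of K[M] to the prime of all a with T^a in P. Let s be a unit section over D(T^h). As K[M] is
  reduced, s = x / T^(nh) and its inverse is y / T^(mh), so T^h x y is a power of T^h. For a prime q of M
  the complement of q is a torsion-free cancellative monoid and can be ordered on finite sets; comparing
  smallest and largest terms shows that x has exactly one term outside each q that does not contain h,
  and this term is the same for all these q. So s is given by one fraction c T^a / T^f on D(T^h).
  The scalar c and the fraction a - f in the localization of M are determined by the germ of s at each
  point, so they glue to sections of the two summands.
*)
theory Submission
  imports Defs "HOL-Algebra.Ring_Divisibility"
begin

section \<open>Orders on cancellative torsion-free monoids\<close>

text \<open>\<open>K[M]\<close> has zero divisors whenever two elements other than
  \<open>infty\<close> multiply to \<open>infty\<close>, so extremal terms say nothing in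
  \<open>K[M]\<close> itself. Modulo \<open>K[q]\<close> only the terms outside the prime
  \<open>q\<close> remain, and these multiply in a monoid without \<open>infty\<close>. Nothing is
  lost: as M is reduced, its primes have only \<open>infty\<close> in common, so an element lying in
  every \<open>K[q]\<close> is zero. Hence \<open>K[M]\<close> is reduced as well, and identities in
  it may be checked at all its primes. An identity known only over \<open>D(T^h)\<close> becomes
  global after multiplication by \<open>T^h\<close>. Orders are built inside the monoid, without its
  group of differences: equality is the initial order (cancellation), and finitely many comparisons
  are added one by one; torsion-freeness settles the pairs for which neither direction can be added.
  One extremal term shows that a product is nonzero modulo \<open>K[q]\<close>; the comparison of
  both extremes shows that a factor of a monomial has a single term. Elements of a localization have
  no preferred representatives, so the isomorphism first appears as a relation between unit sections
  and pairs, and uniqueness turns it into a map.\<close>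

definition cancel_order :: "('a, 'b) monoid_scheme \<Rightarrow> ('a \<Rightarrow> 'a \<Rightarrow> bool) \<Rightarrow> bool"
  where "cancel_order G po \<longleftrightarrow>
    (\<forall>x\<in>carrier G. po x x) \<and>
    (\<forall>x\<in>carrier G. \<forall>y\<in>carrier G. \<forall>z\<in>carrier G. po x y \<longrightarrow> po y z \<longrightarrow> po x z) \<and>
    (\<forall>x\<in>carrier G. \<forall>y\<in>carrier G. po x y \<longrightarrow> po y x \<longrightarrow> x = y) \<and>
    (\<forall>x\<in>carrier G. \<forall>y\<in>carrier G. \<forall>z\<in>carrier G. po (z \<otimes>\<^bsub>G\<^esub> x) (z \<otimes>\<^bsub>G\<^esub> y) \<longleftrightarrow> po x y)"

lemma cancel_orderD:
  assumes "cancel_order G po" "x \<in> carrier G" "y \<in> carrier G"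
  shows cancel_order_refl: "po x x"
    and cancel_order_trans: "z \<in> carrier G \<Longrightarrow> po x y \<Longrightarrow> po y z \<Longrightarrow> po x z"
    and cancel_order_antisym: "po x y \<Longrightarrow> po y x \<Longrightarrow> x = y"
    and cancel_order_mult_iff: "z \<in> carrier G \<Longrightarrow> po (z \<otimes>\<^bsub>G\<^esub> x) (z \<otimes>\<^bsub>G\<^esub> y) \<longleftrightarrow> po x y"
  using assms unfolding cancel_order_def by blast+

text \<open>The axioms are symmetric under reversal, so every statement on least elements also
  serves for largest ones.\<close>

lemma cancel_order_converse: "cancel_order G po \<Longrightarrow> cancel_order G (\<lambda>x y. po y x)"
  unfolding cancel_order_def by blast

context comm_monoid
begin

lemma cancel_order_mult_mono:
  assumes po: "cancel_order G po" and "x \<in> carrier G" "x' \<in> carrier G" "y \<in> carrier G" "y' \<in> carrier G"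
    and "po x x'" "po y y'"
  shows "po (x \<otimes> y) (x' \<otimes> y')"
proof -
  have "po (x \<otimes> y) (x \<otimes> y')" using cancel_order_mult_iff[OF po, of y y' x] assms by simp
  moreover have "po (y' \<otimes> x) (y' \<otimes> x')" using cancel_order_mult_iff[OF po, of x x' y'] assms by simp
  ultimately show ?thesis
    using cancel_order_trans[OF po, of "x \<otimes> y" "x \<otimes> y'" "x' \<otimes> y'"] assms by (simp add: m_comm)
qed

lemma cancel_order_pow_mono:
  assumes po: "cancel_order G po" and "x \<in> carrier G" "y \<in> carrier G" "po x y"
  shows "po (x [^] (n::nat)) (y [^] n)"
proof (induction n)
  case 0
  then show ?case using cancel_order_refl[OF po one_closed one_closed] by simp
next
  case (Suc n)
  then show ?case
    using cancel_order_mult_mono[OF po, of "x [^] n" "y [^] n" x y] assms by simp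
qed

text \<open>Adjoining the relation \<open>e \<le> d\<close> fails to be antisymmetric only if \<open>d\<^sup>n \<le> e\<^sup>n\<close> for some \<open>n \<ge> 1\<close>.
  If adjoining \<open>d \<le> e\<close> fails as well, then \<open>d\<close> and \<open>e\<close> have a common power.\<close>

lemma cancel_order_adjoin:
  assumes po: "cancel_order G po" and d: "d \<in> carrier G" and e: "e \<in> carrier G"
    and ne: "\<And>n::nat. n \<ge> 1 \<Longrightarrow> \<not> po (d [^] n) (e [^] n)"
  defines "po' \<equiv> \<lambda>x y. \<exists>n::nat. po (x \<otimes> d [^] n) (y \<otimes> e [^] n)"
  shows "cancel_order G po'" "\<And>x y. x \<in> carrier G \<Longrightarrow> y \<in> carrier G \<Longrightarrow> po x y \<Longrightarrow> po' x y" "po' e d"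
proof -
  show sub: "po' x y" if "x \<in> carrier G" "y \<in> carrier G" "po x y" for x y
    unfolding po'_def using that by (intro exI[of _ 0]) simp
  show "po' e d"
    unfolding po'_def
    using cancel_order_refl[OF po, of "e \<otimes> d"] d e by (intro exI[of _ 1]) (simp add: m_comm)
  \<comment> \<open>Multiplying the two inequalities puts a factor \<open>y\<close> on either side;
    it cancels because \<open>po\<close> reflects multiplication.\<close>
  have trans: "po (x \<otimes> d [^] (n + m)) (z \<otimes> e [^] (n + m))"
    if c: "x \<in> carrier G" "y \<in> carrier G" "z \<in> carrier G"
      and 1: "po (x \<otimes> d [^] n) (y \<otimes> e [^] n)" and 2: "po (y \<otimes> d [^] m) (z \<otimes> e [^] m)"
    for x y z and n m :: nat
  proof -
    have "po ((x \<otimes> d [^] n) \<otimes> (y \<otimes> d [^] m)) ((y \<otimes> e [^] n) \<otimes> (z \<otimes> e [^] m))"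
      by (rule cancel_order_mult_mono[OF po]) (use c d e 1 2 in auto)
    moreover have "(x \<otimes> d [^] n) \<otimes> (y \<otimes> d [^] m) = y \<otimes> (x \<otimes> d [^] (n + m))"
      using c d by (simp add: m_ac nat_pow_mult[symmetric])
    moreover have "(y \<otimes> e [^] n) \<otimes> (z \<otimes> e [^] m) = y \<otimes> (z \<otimes> e [^] (n + m))"
      using c e by (simp add: m_ac nat_pow_mult[symmetric])
    ultimately show ?thesis
      using cancel_order_mult_iff[OF po, of "x \<otimes> d [^] (n + m)" "z \<otimes> e [^] (n + m)" y] c d e by simp
  qed
  have antisym: "x = y" if c: "x \<in> carrier G" "y \<in> carrier G" and xy: "po' x y" "po' y x" for x y
  proof -
    obtain n m :: nat where nm: "po (x \<otimes> d [^] n) (y \<otimes> e [^] n)" "po (y \<otimes> d [^] m) (x \<otimes> e [^] m)"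
      using xy unfolding po'_def by blast
    \<comment> \<open>Going from \<open>x\<close> through \<open>y\<close> back to \<open>x\<close>
      and cancelling \<open>x\<close> compares equal powers of \<open>d\<close> and
      \<open>e\<close>. By \<open>ne\<close> this is impossible for a positive exponent, and for
      exponent 0 both inequalities are those of \<open>po\<close>.\<close>
    then have "po (d [^] (n + m)) (e [^] (n + m))"
      using trans[of x y x n m] cancel_order_mult_iff[OF po, of "d [^] (n + m)" "e [^] (n + m)" x] c d e
      by simp
    then have "n + m = 0" using ne[of "n + m"] by linarith
    then show ?thesis using nm c cancel_order_antisym[OF po, of x y] by simp
  qed
  have mult: "po' (z \<otimes> x) (z \<otimes> y) \<longleftrightarrow> po' x y"
    if "x \<in> carrier G" "y \<in> carrier G" "z \<in> carrier G" for x y z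
  proof -
    have "po (z \<otimes> x \<otimes> d [^] n) (z \<otimes> y \<otimes> e [^] n) \<longleftrightarrow> po (x \<otimes> d [^] n) (y \<otimes> e [^] n)" for n :: nat
      using cancel_order_mult_iff[OF po, of "x \<otimes> d [^] n" "y \<otimes> e [^] n" z] that d e by (simp add: m_assoc)
    then show ?thesis unfolding po'_def by blast
  qed
  show "cancel_order G po'"
    unfolding cancel_order_def
  proof (intro conjI ballI impI)
    show "po' x x" if "x \<in> carrier G" for x using that sub cancel_order_refl[OF po] by blast
    show "po' x z" if "x \<in> carrier G" "y \<in> carrier G" "z \<in> carrier G" "po' x y" "po' y z" for x y z
      using that trans unfolding po'_def by blast
  qed (use antisym mult in blast)+
qed

text \<open>Each step only enlarges the order, so earlier comparisons survive. Adding
  \<open>e \<le> d\<close> is blocked only by some \<open>d [^] n \<le> e [^] n\<close>, adding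
  \<open>d \<le> e\<close> only by some \<open>e [^] m \<le> d [^] m\<close>. If both are blocked,
  torsion-freeness gives \<open>d = e\<close>.\<close>

lemma cancel_order_total_on_finite:
  assumes cancel: "\<And>a b c. a \<in> carrier G \<Longrightarrow> b \<in> carrier G \<Longrightarrow> c \<in> carrier G \<Longrightarrow>
      a \<otimes> b = a \<otimes> c \<Longrightarrow> b = c"
    and torsion_free: "\<And>a b n. a \<in> carrier G \<Longrightarrow> b \<in> carrier G \<Longrightarrow> n \<ge> 1 \<Longrightarrow>
      a [^] (n::nat) = b [^] n \<Longrightarrow> a = b"
    and D: "finite D" "D \<subseteq> carrier G \<times> carrier G"
  shows "\<exists>po. cancel_order G po \<and> (\<forall>(d, e)\<in>D. po d e \<or> po e d)"
  using D
proof (induction D rule: finite_induct)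
  case empty
  \<comment> \<open>For equality, reflecting multiplication is exactly the cancellation law.\<close>
  have "cancel_order G (=)" unfolding cancel_order_def using cancel by blast
  then show ?case by blast
next
  case (insert x D)
  obtain d e where x: "x = (d, e)" "d \<in> carrier G" "e \<in> carrier G" using insert by auto
  obtain po where po: "cancel_order G po" and tot: "\<forall>(d, e)\<in>D. po d e \<or> po e d"
    using insert by auto
  have ext: ?case
    if "cancel_order G po'" "\<And>x y. x \<in> carrier G \<Longrightarrow> y \<in> carrier G \<Longrightarrow> po x y \<Longrightarrow> po' x y" "po' d e \<or> po' e d" for po'
    using that tot insert.prems x by (intro exI[of _ po']) fastforce
  show ?case
  proof (cases "\<exists>n::nat. n \<ge> 1 \<and> po (d [^] n) (e [^] n)")
    case False
    then show ?thesis
      by (intro ext[OF cancel_order_adjoin(1)[OF po x(2,3)] cancel_order_adjoin(2)[OF po x(2,3)]]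
          disjI2 cancel_order_adjoin(3)[OF po x(2,3)]) auto
  next
    case True
    then obtain n :: nat where n: "n \<ge> 1" "po (d [^] n) (e [^] n)" by blast
    show ?thesis
    proof (cases "\<exists>m::nat. m \<ge> 1 \<and> po (e [^] m) (d [^] m)")
      case False
      then show ?thesis
        by (intro ext[OF cancel_order_adjoin(1)[OF po x(3,2)] cancel_order_adjoin(2)[OF po x(3,2)]]
            disjI1 cancel_order_adjoin(3)[OF po x(3,2)]) auto
    next
      case True
      then obtain m :: nat where m: "m \<ge> 1" "po (e [^] m) (d [^] m)" by blast
      \<comment> \<open>Taking powers brings both inequalities to the common exponent
        \<open>n * m\<close>, where antisymmetry applies.\<close>
      have "po (d [^] (n * m)) (e [^] (n * m))"
        using cancel_order_pow_mono[OF po _ _ n(2), of m] x by (simp add: nat_pow_pow)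
      moreover have "po (e [^] (n * m)) (d [^] (n * m))"
        using cancel_order_pow_mono[OF po _ _ m(2), of n] x by (simp add: nat_pow_pow mult.commute)
      ultimately have "d [^] (n * m) = e [^] (n * m)"
        using cancel_order_antisym[OF po] x by simp
      then have "d = e" using torsion_free[OF x(2,3), of "n * m"] n m by (simp add: Suc_le_eq)
      then show ?thesis using cancel_order_refl[OF po x(2)] by (intro ext[OF po]) auto
    qed
  qed
qed

lemma cancel_order_finite_least:
  assumes po: "cancel_order G po" and "finite A" "A \<noteq> {}" "A \<subseteq> carrier G"
    and "\<And>a b. a \<in> A \<Longrightarrow> b \<in> A \<Longrightarrow> po a b \<or> po b a"
  shows "\<exists>m\<in>A. \<forall>a\<in>A. po m a"
  using assms(2-)
proof (induction A rule: finite_ne_induct)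
  case (singleton x)
  then show ?case by auto
next
  case (insert x F)
  then obtain m where m: "m \<in> F" "\<forall>a\<in>F. po m a" by auto
  show ?case
  proof (cases "po x m")
    case True
    then have "po x a" if "a \<in> F" for a
      using cancel_order_trans[OF po, of x m a] m that insert.prems by auto
    then show ?thesis using cancel_order_refl[OF po, of x x] insert.prems by auto
  next
    case False
    then have "po m x" using insert.prems m by auto
    then show ?thesis using m by auto
  qed
qed

section \<open>Unique products of two finite sets\<close>

definition unique_product :: "'a set \<Rightarrow> 'a set \<Rightarrow> 'a \<Rightarrow> 'a \<Rightarrow> bool"
  where "unique_product A B a b \<longleftrightarrow> a \<in> A \<and> b \<in> B \<and>
    (\<forall>a'\<in>A. \<forall>b'\<in>B. a' \<otimes> b' = a \<otimes> b \<longrightarrow> a' = a \<and> b' = b)"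

text \<open>The chain \<open>a \<otimes> b \<le> x \<otimes> b \<le> x \<otimes> y = a \<otimes>
  b\<close> collapses, likewise the one through \<open>a \<otimes> y\<close>; cancelling gives
  \<open>x = a\<close> and \<open>y = b\<close>.\<close>

lemma cancel_order_least_unique_product:
  assumes po: "cancel_order G po" and "A \<subseteq> carrier G" "B \<subseteq> carrier G"
    and a: "a \<in> A" "\<And>x. x \<in> A \<Longrightarrow> po a x" and b: "b \<in> B" "\<And>y. y \<in> B \<Longrightarrow> po b y"
  shows "unique_product A B a b"
  unfolding unique_product_def
proof (intro conjI ballI impI a(1) b(1))
  fix x y assume xy: "x \<in> A" "y \<in> B" and eq: "x \<otimes> y = a \<otimes> b"
  then have cl: "x \<in> carrier G" "y \<in> carrier G" "a \<in> carrier G" "b \<in> carrier G" using assms by auto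
  have 1: "po (a \<otimes> b) (a \<otimes> y)" "po (b \<otimes> a) (b \<otimes> x)"
    using cancel_order_mult_iff[OF po] cl a(2)[OF xy(1)] b(2)[OF xy(2)] by auto
  have 2: "po (y \<otimes> a) (y \<otimes> x)" "po (x \<otimes> b) (x \<otimes> y)"
    using cancel_order_mult_iff[OF po] cl a(2)[OF xy(1)] b(2)[OF xy(2)] by auto
  have "a \<otimes> y = a \<otimes> b" "x \<otimes> b = a \<otimes> b"
    using cancel_order_antisym[OF po, of "a \<otimes> y" "a \<otimes> b"] cancel_order_antisym[OF po, of "x \<otimes> b" "a \<otimes> b"]
      1 2 cl eq by (simp_all add: m_comm)
  then have "po (b \<otimes> x) (b \<otimes> a)" "po (a \<otimes> y) (a \<otimes> b)"
    using cancel_order_refl[OF po, of "a \<otimes> b" "a \<otimes> b"] cl by (simp_all add: m_comm)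
  then have "po x a" "po y b" using cancel_order_mult_iff[OF po] cl by auto
  then show "x = a" "y = b"
    using a(2)[OF xy(1)] b(2)[OF xy(2)] cancel_order_antisym[OF po] cl by auto
qed

text \<open>The two pairs are formed by the least and by the largest elements. If their products
  agree, uniqueness identifies the largest elements with the least ones, so both sets are
  singletons. This last clause is what later leaves a factor of a monomial with one term outside a
  prime.\<close>

theorem finite_unique_products:
  assumes cancel: "\<And>a b c. a \<in> carrier G \<Longrightarrow> b \<in> carrier G \<Longrightarrow> c \<in> carrier G \<Longrightarrow>
      a \<otimes> b = a \<otimes> c \<Longrightarrow> b = c"
    and torsion_free: "\<And>a b n. a \<in> carrier G \<Longrightarrow> b \<in> carrier G \<Longrightarrow> n \<ge> 1 \<Longrightarrow>
      a [^] (n::nat) = b [^] n \<Longrightarrow> a = b"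
    and A: "finite A" "A \<noteq> {}" "A \<subseteq> carrier G" and B: "finite B" "B \<noteq> {}" "B \<subseteq> carrier G"
  obtains a b a' b' where "unique_product A B a b" "unique_product A B a' b'"
    "a \<otimes> b = a' \<otimes> b' \<Longrightarrow> A = {a} \<and> B = {b}"
proof -
  have "finite ((A \<union> B) \<times> (A \<union> B))" "(A \<union> B) \<times> (A \<union> B) \<subseteq> carrier G \<times> carrier G"
    using A B by auto
  from cancel_order_total_on_finite[OF cancel torsion_free this]
  obtain po where po: "cancel_order G po" and tot: "\<forall>x\<in>A \<union> B. \<forall>y\<in>A \<union> B. po x y \<or> po y x"
    by fast
  note ge = cancel_order_converse[OF po]
  obtain a where a: "a \<in> A" "\<And>x. x \<in> A \<Longrightarrow> po a x"
    using cancel_order_finite_least[OF po A] tot by blast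
  obtain b where b: "b \<in> B" "\<And>x. x \<in> B \<Longrightarrow> po b x"
    using cancel_order_finite_least[OF po B] tot by blast
  obtain a' where a': "a' \<in> A" "\<And>x. x \<in> A \<Longrightarrow> po x a'"
    using cancel_order_finite_least[OF ge A] tot by blast
  obtain b' where b': "b' \<in> B" "\<And>x. x \<in> B \<Longrightarrow> po x b'"
    using cancel_order_finite_least[OF ge B] tot by blast
  have 1: "unique_product A B a b"
    by (rule cancel_order_least_unique_product[OF po A(3) B(3) a b])
  have 2: "unique_product A B a' b'"
    by (rule cancel_order_least_unique_product[OF ge A(3) B(3) a' b'])
  show thesis
  proof (rule that[OF 1 2])
    assume "a \<otimes> b = a' \<otimes> b'"
    then have "a' = a" "b' = b" using 1 a'(1) b'(1) unfolding unique_product_def by metis+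
    then have "x = a" if "x \<in> A" for x
      using a(2)[OF that] a'(2)[OF that] cancel_order_antisym[OF po] a(1) that A by blast
    moreover have "x = b" if "x \<in> B" for x
      using b(2)[OF that] b'(2)[OF that] \<open>b' = b\<close> cancel_order_antisym[OF po] b(1) that B by blast
    ultimately show "A = {a} \<and> B = {b}" using a(1) b(1) by blast
  qed
qed

end

section \<open>Sections over basic open sets of reduced rings\<close>

lemma (in primeideal) complement_submonoid: "submonoid (carrier R - I) R"
proof (rule submonoid.intro)
  show "\<one> \<in> carrier R - I" using one_imp_carrier I_notcarr by auto
qed (use I_prime in auto)

context cring
begin

text \<open>An ideal that is maximal among those containing \<open>J\<close> and no power of \<open>t\<close> is prime.\<close>

lemma exists_prime_avoiding:
  assumes J: "ideal J R" and t: "t \<in> carrier R" and pow: "\<And>n::nat. t [^] n \<notin> J"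
  obtains P where "primeideal P R" "J \<subseteq> P" "t \<notin> P"
proof -
  define A where "A = {I. ideal I R \<and> J \<subseteq> I \<and> (\<forall>n::nat. t [^] n \<notin> I)}"
  have "\<exists>P\<in>A. \<forall>I\<in>A. P \<subseteq> I \<longrightarrow> I = P"
  proof (rule subset_Zorn_nonempty)
    show "A \<noteq> {}" using J pow unfolding A_def by blast
    fix C assume C: "C \<noteq> {}" "subset.chain A C"
    then have CA: "C \<subseteq> A" by (simp add: pred_on.chain_def)
    then have "subset.chain {I. ideal I R} C" using C(2) unfolding pred_on.chain_def A_def by blast
    then have "ideal (\<Union>C) R" using chain_Union_is_ideal[of C] C(1) by simp
    moreover have "J \<subseteq> \<Union>C" using C(1) CA unfolding A_def by blast
    moreover have "t [^] n \<notin> \<Union>C" for n :: nat using CA unfolding A_def by blast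
    ultimately show "\<Union>C \<in> A" unfolding A_def by blast
  qed
  then obtain P where PA: "P \<in> A" and maxA: "\<And>I. I \<in> A \<Longrightarrow> P \<subseteq> I \<Longrightarrow> I = P" by blast
  have P: "ideal P R" "J \<subseteq> P" "\<And>n::nat. t [^] n \<notin> P" using PA by (simp_all add: A_def)
  have max: "\<exists>n::nat. t [^] n \<in> I" if "ideal I R" "P \<subseteq> I" "I \<noteq> P" for I
  proof (rule ccontr)
    assume "\<not> ?thesis"
    then have "I \<in> A" using that P(2) by (simp add: A_def)
    then show False using maxA that by simp
  qed
  interpret P: ideal P R by fact
  \<comment> \<open>By maximality the ideal generated by \<open>P\<close> and \<open>a\<close>
    contains a power of \<open>t\<close>, here written as an element of \<open>P\<close> plus a
    multiple of \<open>a\<close>.\<close>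
  have ext: "\<exists>n::nat. \<exists>p\<in>P. \<exists>x\<in>carrier R. t [^] n = p \<oplus> x \<otimes> a" if a: "a \<in> carrier R" "a \<notin> P" for a
  proof -
    have sub: "P \<subseteq> P <+> PIdl a"
    proof
      fix p assume p: "p \<in> P"
      then have "p = p \<oplus> \<zero> \<otimes> a" using a by simp
      then show "p \<in> P <+> PIdl a" using p unfolding set_add_def' cgenideal_def by blast
    qed
    have "\<zero> \<oplus> a \<in> P <+> PIdl a"
      using P.zero_closed cgenideal_self[OF a(1)] unfolding set_add_def' by blast
    then have "P <+> PIdl a \<noteq> P" using a by auto
    then obtain n :: nat where "t [^] n \<in> P <+> PIdl a"
      using max[OF add_ideals[OF P(1) cgenideal_ideal[OF a(1)]] sub] by blast
    then show ?thesis unfolding set_add_def' cgenideal_def by blast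
  qed
  have "primeideal P R"
  proof (rule primeidealI[OF P(1) is_cring])
    show "carrier R \<noteq> P" using P(3) t by blast
    fix a b assume ab: "a \<in> carrier R" "b \<in> carrier R" "a \<otimes> b \<in> P"
    show "a \<in> P \<or> b \<in> P"
    proof (rule ccontr)
      assume "\<not> (a \<in> P \<or> b \<in> P)"
      then obtain n m p q x y where *: "t [^] (n::nat) = p \<oplus> x \<otimes> a" "t [^] (m::nat) = q \<oplus> y \<otimes> b"
        "p \<in> P" "q \<in> P" "x \<in> carrier R" "y \<in> carrier R" using ext ab by meson
      then have pq: "p \<in> carrier R" "q \<in> carrier R" using P.Icarr by auto
      \<comment> \<open>A product of powers of \<open>t\<close> is again such a power, while every
        summand of the expansion has a factor in \<open>P\<close>: one of \<open>p\<close>,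
        \<open>q\<close> or \<open>a \<otimes> b\<close>.\<close>
      have "t [^] (n + m) = (p \<oplus> x \<otimes> a) \<otimes> (q \<oplus> y \<otimes> b)" using * t by (simp add: nat_pow_mult[symmetric])
      also have "\<dots> = p \<otimes> (q \<oplus> y \<otimes> b) \<oplus> (x \<otimes> a \<otimes> q \<oplus> x \<otimes> y \<otimes> (a \<otimes> b))"
        using *(3-) pq ab by (simp add: l_distr r_distr m_ac a_ac)
      also have "\<dots> \<in> P"
      proof -
        have "p \<otimes> (q \<oplus> y \<otimes> b) \<in> P" using P.I_r_closed[of p "q \<oplus> y \<otimes> b"] * pq ab by simp
        moreover have "x \<otimes> a \<otimes> q \<in> P" "x \<otimes> y \<otimes> (a \<otimes> b) \<in> P" using P.I_l_closed * ab by simp_all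
        ultimately show ?thesis by simp
      qed
      finally show False using P(3) by blast
    qed
  qed
  moreover have "t \<notin> P" using P(3)[of 1] t by simp
  ultimately show thesis using that P(2) by blast
qed

text \<open>The nilradical is the intersection of all primes: avoid the powers of \<open>x\<close>
  over the zero ideal. Exponent 0 in \<open>reduced\<close> is harmless, since it concerns only the
  zero ring.\<close>

lemma reduced_eq_zeroI:
  assumes reduced: "\<And>x n. x \<in> carrier R \<Longrightarrow> x [^] (n::nat) = \<zero> \<Longrightarrow> x = \<zero>"
    and x: "x \<in> carrier R" and "\<And>P. primeideal P R \<Longrightarrow> x \<in> P"
  shows "x = \<zero>"
proof (rule ccontr)
  assume "x \<noteq> \<zero>"
  then have "x [^] n \<notin> {\<zero>}" for n :: nat using reduced[OF x] by blast
  from exists_prime_avoiding[OF zeroideal x this] obtain P where "primeideal P R" "x \<notin> P" by blast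
  with assms(3) show False by blast
qed

text \<open>Since \<open>D(y)\<close> and \<open>D(z)\<close> meet in \<open>D(y z)\<close>, the
  generating sets form a basis and not merely a subbasis.\<close>

lemma openin_ring_Spec_basic:
  assumes "openin (ring_Spec R) V" "P \<in> V"
  obtains z where "z \<in> carrier R" "P \<in> ring_open R {z}" "ring_open R {z} \<subseteq> V"
proof -
  have "generate_topology_on {ring_open R {f} |f. f \<in> carrier R} V"
    using assms by (simp add: ring_Spec_def openin_topology_generated_by_iff)
  then have "\<forall>P\<in>V. \<exists>z\<in>carrier R. P \<in> ring_open R {z} \<and> ring_open R {z} \<subseteq> V"
  proof induction
    case (Int V W)
    show ?case
    proof
      fix P assume "P \<in> V \<inter> W"
      then obtain y z where yz: "y \<in> carrier R" "P \<in> ring_open R {y}" "ring_open R {y} \<subseteq> V"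
        "z \<in> carrier R" "P \<in> ring_open R {z}" "ring_open R {z} \<subseteq> W" using Int by blast
      have "ring_open R {y \<otimes> z} = ring_open R {y} \<inter> ring_open R {z}"
      proof (rule Set.set_eqI)
        fix Q
        show "Q \<in> ring_open R {y \<otimes> z} \<longleftrightarrow> Q \<in> ring_open R {y} \<inter> ring_open R {z}"
        proof (cases "primeideal Q R")
          case True
          then interpret Q: primeideal Q R .
          have "y \<otimes> z \<in> Q \<longleftrightarrow> y \<in> Q \<or> z \<in> Q"
            using yz(1,4) Q.I_prime Q.I_l_closed Q.I_r_closed by blast
          then show ?thesis unfolding ring_open_def by auto
        qed (simp add: ring_open_def)
      qed
      then show "\<exists>z\<in>carrier R. P \<in> ring_open R {z} \<and> ring_open R {z} \<subseteq> V \<inter> W"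
        using yz by (intro bexI[of _ "y \<otimes> z"]) auto
    qed
  qed blast+
  with assms that show thesis by blast
qed

text \<open>The elements \<open>y\<close> for which \<open>y s\<close> comes from \<open>R\<close> form an ideal, and each prime ideal of \<open>D(t)\<close>
  misses one of them. Since \<open>R\<close> is reduced, equality of sections can be tested at all primes, so
  that no finite subcovering is needed.\<close>

theorem section_basic_open_fraction:
  assumes reduced: "\<And>x n. x \<in> carrier R \<Longrightarrow> x [^] (n::nat) = \<zero> \<Longrightarrow> x = \<zero>"
    and s: "s \<in> fraction_sections R (ring_Spec R) U"
    and t: "t \<in> carrier R" and tU: "ring_open R {t} \<subseteq> U"
  obtains x n where "x \<in> carrier R"
    "\<And>Q. Q \<in> ring_open R {t} \<Longrightarrow> s Q = loc_frac R (carrier R - Q) x (t [^] (n::nat))"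
proof -
  let ?D = "ring_open R {t}"
  have sub: "submonoid (carrier R - Q) R" if "primeideal Q R" for Q
    using that primeideal.complement_submonoid by blast
  have D: "Q \<in> ?D \<longleftrightarrow> primeideal Q R \<and> t \<notin> Q" for Q by (simp add: ring_open_def)
  have loc: "\<exists>V. openin (ring_Spec R) V \<and> Q \<in> V \<and> V \<subseteq> U \<and>
      (\<exists>a\<in>carrier R. \<exists>f\<in>carrier R. \<forall>q\<in>V. f \<notin> q \<and> s q = loc_frac R (carrier R - q) a f)"
    if "Q \<in> U" for Q
    using s that unfolding fraction_sections_def by blast
  \<comment> \<open>The neighbourhood is shrunk to some \<open>D(z)\<close>, so that restricting to
    it can be expressed by a factor \<open>z\<close>.\<close>
  have local_frac: "\<exists>z\<in>carrier R - Q. \<exists>x\<in>carrier R. \<exists>y\<in>carrier R - Q.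
      \<forall>P. primeideal P R \<longrightarrow> z \<notin> P \<longrightarrow> y \<notin> P \<and> s P = loc_frac R (carrier R - P) x y"
    if Q: "Q \<in> ?D" for Q
  proof -
    have "Q \<in> U" using Q tU by blast
    from loc[OF this] obtain V x y where V: "openin (ring_Spec R) V" "Q \<in> V"
      and xy: "x \<in> carrier R" "y \<in> carrier R"
        "\<And>P. P \<in> V \<Longrightarrow> y \<notin> P \<and> s P = loc_frac R (carrier R - P) x y" by metis
    obtain z where z: "z \<in> carrier R" "Q \<in> ring_open R {z}" "ring_open R {z} \<subseteq> V"
      using openin_ring_Spec_basic[OF V] .
    have "z \<in> carrier R - Q" using z(1,2) by (simp add: ring_open_def)
    moreover have "y \<in> carrier R - Q" using xy V(2) by blast
    moreover have "P \<in> V" if "primeideal P R" "z \<notin> P" for P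
      using that z(3) by (auto simp: ring_open_def)
    ultimately show ?thesis using xy(1,3) by blast
  qed
  have "\<forall>Q\<in>?D. \<exists>a f. a \<in> carrier R \<and> f \<in> carrier R - Q \<and> s Q = loc_frac R (carrier R - Q) a f"
  proof
    fix Q assume "Q \<in> ?D"
    then have "s Q \<in> loc_carrier R (carrier R - Q)"
      using s tU by (auto simp: fraction_sections_def)
    then show "\<exists>a f. a \<in> carrier R \<and> f \<in> carrier R - Q \<and> s Q = loc_frac R (carrier R - Q) a f"
      by (elim loc_carrierE) blast
  qed
  \<comment> \<open>Representatives are chosen point by point, with no relation between different
    \<open>Q\<close>; they only serve to state equations in the localizations.\<close>
  then obtain num den where frac: "\<And>Q. Q \<in> ?D \<Longrightarrow> num Q \<in> carrier R \<and> den Q \<in> carrier R - Q \<and>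
      s Q = loc_frac R (carrier R - Q) (num Q) (den Q)"
    by metis
  \<comment> \<open>\<open>rep y x\<close> states \<open>y s = x\<close> in the localization at
    every point of \<open>D(t)\<close>, so \<open>J\<close> is the ideal of denominators of
    \<open>s\<close> over \<open>D(t)\<close>.\<close>
  define rep where "rep y x \<longleftrightarrow> (\<forall>Q\<in>?D. \<exists>u\<in>carrier R - Q. u \<otimes> (y \<otimes> num Q) = u \<otimes> (den Q \<otimes> x))" for y x
  define J where "J = {y \<in> carrier R. \<exists>x\<in>carrier R. rep y x}"
  have rep_add: "rep (y \<oplus> y') (x \<oplus> x')"
    if c: "x \<in> carrier R" "y \<in> carrier R" "x' \<in> carrier R" "y' \<in> carrier R" and r: "rep y x" "rep y' x'"
    for x y x' y'
    unfolding rep_def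
  proof
    fix Q assume Q: "Q \<in> ?D"
    from r Q obtain u v where u: "u \<in> carrier R - Q" "u \<otimes> (y \<otimes> num Q) = u \<otimes> (den Q \<otimes> x)"
      and v: "v \<in> carrier R - Q" "v \<otimes> (y' \<otimes> num Q) = v \<otimes> (den Q \<otimes> x')"
      unfolding rep_def by blast
    note cl = c u(1) v(1) frac[OF Q]
    have "(u \<otimes> v) \<otimes> ((y \<oplus> y') \<otimes> num Q) = v \<otimes> (u \<otimes> (y \<otimes> num Q)) \<oplus> u \<otimes> (v \<otimes> (y' \<otimes> num Q))"
      using cl by (simp add: l_distr r_distr m_ac)
    also have "\<dots> = v \<otimes> (u \<otimes> (den Q \<otimes> x)) \<oplus> u \<otimes> (v \<otimes> (den Q \<otimes> x'))" by (simp only: u v)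
    also have "\<dots> = (u \<otimes> v) \<otimes> (den Q \<otimes> (x \<oplus> x'))" using cl by (simp add: l_distr r_distr m_ac)
    finally have "(u \<otimes> v) \<otimes> ((y \<oplus> y') \<otimes> num Q) = (u \<otimes> v) \<otimes> (den Q \<otimes> (x \<oplus> x'))" .
    moreover have "u \<otimes> v \<in> carrier R - Q"
      using submonoid.m_closed[OF sub] u v Q D by blast
    ultimately show "\<exists>u\<in>carrier R - Q. u \<otimes> ((y \<oplus> y') \<otimes> num Q) = u \<otimes> (den Q \<otimes> (x \<oplus> x'))" by blast
  qed
  have rep_mult: "rep (z \<otimes> y) (z \<otimes> x)"
    if c: "x \<in> carrier R" "y \<in> carrier R" "z \<in> carrier R" and r: "rep y x" for x y z
    unfolding rep_def
  proof
    fix Q assume Q: "Q \<in> ?D"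
    from r Q obtain u where u: "u \<in> carrier R - Q" "u \<otimes> (y \<otimes> num Q) = u \<otimes> (den Q \<otimes> x)"
      unfolding rep_def by blast
    note cl = c u(1) frac[OF Q]
    have "u \<otimes> ((z \<otimes> y) \<otimes> num Q) = z \<otimes> (u \<otimes> (y \<otimes> num Q))" using cl by (simp add: m_ac)
    also have "\<dots> = z \<otimes> (u \<otimes> (den Q \<otimes> x))" by (simp only: u)
    also have "\<dots> = u \<otimes> (den Q \<otimes> (z \<otimes> x))" using cl by (simp add: m_ac)
    finally show "\<exists>u\<in>carrier R - Q. u \<otimes> ((z \<otimes> y) \<otimes> num Q) = u \<otimes> (den Q \<otimes> (z \<otimes> x))" using u by blast
  qed
  have rep_zero: "rep \<zero> \<zero>"
    unfolding rep_def
  proof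
    fix Q assume Q: "Q \<in> ?D"
    then have "\<one> \<in> carrier R - Q" using submonoid.one_closed[OF sub] D by blast
    then show "\<exists>u\<in>carrier R - Q. u \<otimes> (\<zero> \<otimes> num Q) = u \<otimes> (den Q \<otimes> \<zero>)" using frac[OF Q] by auto
  qed
  have J: "ideal J R"
  proof (rule idealI[OF ring_axioms])
    have neg: "\<ominus> \<one> \<otimes> y = \<ominus> y" if "y \<in> carrier R" for y using that by (simp add: l_minus)
    show "subgroup J (add_monoid R)"
    proof (rule group.subgroupI[OF a_group])
      show "J \<subseteq> carrier (add_monoid R)" by (auto simp: J_def)
      show "J \<noteq> {}" using rep_zero by (auto simp: J_def)
      show "inv\<^bsub>add_monoid R\<^esub> y \<in> J" if yJ: "y \<in> J" for y
      proof -
        obtain x where "y \<in> carrier R" "x \<in> carrier R" "rep y x" using yJ unfolding J_def by blast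
        then have "\<ominus> y \<in> J" using rep_mult[of x y "\<ominus> \<one>"] neg unfolding J_def by auto
        then show ?thesis by (simp add: a_inv_def)
      qed
      show "x \<otimes>\<^bsub>add_monoid R\<^esub> y \<in> J" if xyJ: "x \<in> J" "y \<in> J" for x y
      proof -
        obtain x' y' where "x \<in> carrier R" "y \<in> carrier R" "x' \<in> carrier R" "y' \<in> carrier R"
          "rep x x'" "rep y y'" using xyJ unfolding J_def by blast
        then show ?thesis
          using rep_add[of x' x y' y] unfolding J_def by (simp, intro bexI[of _ "x' \<oplus> y'"]) auto
      qed
    qed
    show 1: "x \<otimes> a \<in> J" if aJ: "a \<in> J" "x \<in> carrier R" for a x
    proof -
      obtain y where "a \<in> carrier R" "y \<in> carrier R" "rep a y" using aJ(1) unfolding J_def by blast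
      then show ?thesis
        using rep_mult[of y a x] aJ(2) unfolding J_def by (simp, intro bexI[of _ "x \<otimes> y"]) auto
    qed
    show "a \<otimes> x \<in> J" if "a \<in> J" "x \<in> carrier R" for a x
      using 1[OF that] that by (simp add: J_def m_comm)
  qed
  have "\<exists>n::nat. t [^] n \<in> J"
  proof (rule ccontr)
    assume "\<not> (\<exists>n::nat. t [^] n \<in> J)"
    then obtain P where P: "primeideal P R" "J \<subseteq> P" "t \<notin> P"
      using exists_prime_avoiding[OF J t] by blast
    then have PD: "P \<in> ?D" by (simp add: D)
    obtain z x y where c: "z \<in> carrier R - P" "x \<in> carrier R" "y \<in> carrier R - P"
      and xy: "\<And>Q. primeideal Q R \<Longrightarrow> z \<notin> Q \<Longrightarrow> y \<notin> Q \<and> s Q = loc_frac R (carrier R - Q) x y"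
      using local_frac[OF PD] by metis
    \<comment> \<open>Near \<open>P\<close> the section is \<open>x / y\<close> on
      \<open>D(z)\<close>. The factor \<open>z\<close> spreads \<open>y s = x\<close> over all of
      \<open>D(t)\<close>; this puts \<open>z \<otimes> y\<close> into \<open>J\<close>, although it
      is not in \<open>P\<close>.\<close>
    have "rep (z \<otimes> y) (z \<otimes> x)"
      unfolding rep_def
    proof
      fix Q assume Q: "Q \<in> ?D"
      obtain z' x' y' where c': "z' \<in> carrier R - Q" "x' \<in> carrier R" "y' \<in> carrier R - Q"
        and xy': "\<And>P. primeideal P R \<Longrightarrow> z' \<notin> P \<Longrightarrow> y' \<notin> P \<and> s P = loc_frac R (carrier R - P) x' y'"
        using local_frac[OF Q] by metis
      have Qp: "primeideal Q R" using Q D by blast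
      \<comment> \<open>This product lies in every prime: it does trivially if \<open>z\<close> or
        \<open>z'\<close> does, and at any other prime both fractions equal \<open>s\<close>, so a
        multiple of the difference by an element outside the prime is zero.\<close>
      have "z' \<otimes> z \<otimes> (y \<otimes> x' \<ominus> y' \<otimes> x) = \<zero>"
      proof (rule reduced_eq_zeroI[OF reduced])
        show "z' \<otimes> z \<otimes> (y \<otimes> x' \<ominus> y' \<otimes> x) \<in> carrier R" using c c' by simp
        fix P assume P: "primeideal P R"
        interpret P: primeideal P R by fact
        show "z' \<otimes> z \<otimes> (y \<otimes> x' \<ominus> y' \<otimes> x) \<in> P"
        proof (cases "z \<in> P \<or> z' \<in> P")
          case True
          then have "z' \<otimes> z \<in> P" using c c' P.I_l_closed P.I_r_closed by blast
          then show ?thesis using c c' P.I_r_closed by simp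
        next
          case False
          then have "loc_frac R (carrier R - P) x y = loc_frac R (carrier R - P) x' y'" "y \<notin> P" "y' \<notin> P"
            using xy[OF P] xy'[OF P] by auto
          then obtain v where v: "v \<in> carrier R - P" "v \<otimes> (y' \<otimes> x) = v \<otimes> (y \<otimes> x')"
            using loc_frac_eq_iff[OF sub[OF P], of x x' y y'] c c' by auto
          have "v \<otimes> (y \<otimes> x' \<ominus> y' \<otimes> x) = v \<otimes> (y \<otimes> x') \<ominus> v \<otimes> (y' \<otimes> x)"
            using v(1) c c' by (simp add: r_distr minus_eq r_minus)
          also have "\<dots> = \<zero>" unfolding v(2) using v(1) c c' by (simp add: minus_eq r_neg)
          finally have "v \<otimes> (y \<otimes> x' \<ominus> y' \<otimes> x) \<in> P" by simp
          then have "y \<otimes> x' \<ominus> y' \<otimes> x \<in> P" using P.I_prime[of v "y \<otimes> x' \<ominus> y' \<otimes> x"] v(1) c c' by auto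
          then show ?thesis using c c' P.I_l_closed by simp
        qed
      qed auto
      then have "z' \<otimes> z \<otimes> (y \<otimes> x') \<ominus> z' \<otimes> z \<otimes> (y' \<otimes> x) = \<zero>"
        using c c' by (simp add: r_distr minus_eq r_minus)
      then have eq: "z' \<otimes> z \<otimes> (y \<otimes> x') = z' \<otimes> z \<otimes> (y' \<otimes> x)"
        using c c' by (simp add: r_right_minus_eq)
      have "loc_frac R (carrier R - Q) (num Q) (den Q) = loc_frac R (carrier R - Q) x' y'"
        using xy'[OF Qp] frac[OF Q] c' by auto
      then obtain v where v: "v \<in> carrier R - Q" "v \<otimes> (y' \<otimes> num Q) = v \<otimes> (den Q \<otimes> x')"
        using loc_frac_eq_iff[OF sub[OF Qp], of "num Q" x' "den Q" y'] c' frac[OF Q] by auto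
      have d: "num Q \<in> carrier R" "den Q \<in> carrier R" using frac[OF Q] by auto
      have cl: "v \<in> carrier R" "y' \<in> carrier R" "z' \<in> carrier R" "x' \<in> carrier R"
        "z \<in> carrier R" "y \<in> carrier R" "x \<in> carrier R" using c c' v by auto
      have "(z' \<otimes> v \<otimes> y') \<otimes> ((z \<otimes> y) \<otimes> num Q) = z' \<otimes> z \<otimes> y \<otimes> (v \<otimes> (y' \<otimes> num Q))"
        using cl d by (simp add: m_ac)
      also have "\<dots> = z' \<otimes> z \<otimes> y \<otimes> (v \<otimes> (den Q \<otimes> x'))" by (simp only: v)
      also have "\<dots> = v \<otimes> den Q \<otimes> (z' \<otimes> z \<otimes> (y \<otimes> x'))" using cl d by (simp add: m_ac)
      also have "\<dots> = v \<otimes> den Q \<otimes> (z' \<otimes> z \<otimes> (y' \<otimes> x))" by (simp only: eq)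
      also have "\<dots> = (z' \<otimes> v \<otimes> y') \<otimes> (den Q \<otimes> (z \<otimes> x))" using cl d by (simp add: m_ac)
      finally show "\<exists>u\<in>carrier R - Q. u \<otimes> ((z \<otimes> y) \<otimes> num Q) = u \<otimes> (den Q \<otimes> (z \<otimes> x))"
        using submonoid.m_closed[OF sub[OF Qp]] v c' by blast
    qed
    then have "z \<otimes> y \<in> J" using c by (auto simp: J_def)
    moreover have "z \<otimes> y \<in> carrier R - P" using submonoid.m_closed[OF sub[OF P(1)]] c by blast
    ultimately show False using P by blast
  qed
  then obtain n :: nat and x where x: "x \<in> carrier R" "rep (t [^] n) x" by (auto simp: J_def)
  show thesis
  proof (rule that[OF x(1)])
    fix Q assume Q: "Q \<in> ?D"
    then have "t [^] n \<in> carrier R - Q"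
    proof (induction n)
      case 0
      then show ?case using submonoid.one_closed[OF sub] D by simp
    next
      case (Suc n)
      then show ?case using submonoid.m_closed[OF sub] D t nat_pow_Suc by auto
    qed
    then show "s Q = loc_frac R (carrier R - Q) x (t [^] n)"
      using frac[OF Q] x Q D loc_frac_eq_iff[OF sub, of Q "num Q" x "den Q" "t [^] n"]
      unfolding rep_def by auto
  qed
qed

end

section \<open>Monomial prime ideals\<close>

definition scaled_monomial ::
  "('k, 'c) ring_scheme \<Rightarrow> ('m, 'b) binoid_scheme \<Rightarrow> 'k \<Rightarrow> 'm \<Rightarrow> 'm \<Rightarrow> 'k"
  where "scaled_monomial K M c a = (\<lambda>b\<in>finite_part M. if b = a then c else \<zero>\<^bsub>K\<^esub>)"

text \<open>The retraction of \<open>Spec K[M]\<close> onto \<open>Spec M\<close>, left inverse to \<open>p \<mapsto> K[p]\<close>.\<close>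

definition monomial_radical ::
  "('k, 'c) ring_scheme \<Rightarrow> ('m, 'b) binoid_scheme \<Rightarrow> ('m \<Rightarrow> 'k) set \<Rightarrow> 'm set"
  where "monomial_radical K M P = {a \<in> carrier M. monomial K M a \<in> P}"

lemma monomial_eq_scaled: "monomial K M a = scaled_monomial K M \<one>\<^bsub>K\<^esub> a"
  by (simp add: monomial_def scaled_monomial_def)

context binoid_over_cring
begin

lemma scaled_monomial_closed [simp]:
  assumes "c \<in> carrier K" shows "scaled_monomial K M c a \<in> carrier KM"
proof -
  have "supp K M (scaled_monomial K M c a) \<subseteq> {a}"
    by (auto simp: supp_def scaled_monomial_def split: if_splits)
  then show ?thesis using assms
    by (auto simp: algebra_carrier_iff scaled_monomial_def intro: finite_subset)
qed

lemma supp_scaled_monomial: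
  "a \<in> finite_part M \<Longrightarrow> c \<noteq> \<zero>\<^bsub>K\<^esub> \<Longrightarrow> supp K M (scaled_monomial K M c a) = {a}"
  by (auto simp: supp_def scaled_monomial_def)

lemma coeff_mult_unique:
  assumes x: "x \<in> carrier KM" and y: "y \<in> carrier KM"
    and a: "a \<in> supp K M x" and b: "b \<in> supp K M y" and c: "a \<otimes>\<^bsub>M\<^esub> b \<in> finite_part M"
    and uniq: "\<And>a' b'. a' \<in> supp K M x \<Longrightarrow> b' \<in> supp K M y \<Longrightarrow> a' \<otimes>\<^bsub>M\<^esub> b' = a \<otimes>\<^bsub>M\<^esub> b \<Longrightarrow> a' = a \<and> b' = b"
  shows "(x \<otimes>\<^bsub>KM\<^esub> y) (a \<otimes>\<^bsub>M\<^esub> b) = x a \<otimes>\<^bsub>K\<^esub> y b"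
proof -
  let ?A = "supp K M x" and ?B = "supp K M y"
  note [simp] = coeff_supp_closed[OF x] coeff_supp_closed[OF y]
  have "(x \<otimes>\<^bsub>KM\<^esub> y) (a \<otimes>\<^bsub>M\<^esub> b) = (\<Oplus>\<^bsub>K\<^esub>a'\<in>?A. \<Oplus>\<^bsub>K\<^esub>b'\<in>?B.
      if a' \<otimes>\<^bsub>M\<^esub> b' = a \<otimes>\<^bsub>M\<^esub> b then x a' \<otimes>\<^bsub>K\<^esub> y b' else \<zero>\<^bsub>K\<^esub>)"
    unfolding algebra_mult using c by (rule restrict_apply')
  also have "\<dots> = (\<Oplus>\<^bsub>K\<^esub>a'\<in>?A. if a = a' then x a' \<otimes>\<^bsub>K\<^esub> y b else \<zero>\<^bsub>K\<^esub>)"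
  proof (intro K.finsum_cong' refl)
    fix a' assume a': "a' \<in> ?A"
    have "(\<Oplus>\<^bsub>K\<^esub>b'\<in>?B. if a' \<otimes>\<^bsub>M\<^esub> b' = a \<otimes>\<^bsub>M\<^esub> b then x a' \<otimes>\<^bsub>K\<^esub> y b' else \<zero>\<^bsub>K\<^esub>)
        = (\<Oplus>\<^bsub>K\<^esub>b'\<in>?B. if b = b' then if a = a' then x a' \<otimes>\<^bsub>K\<^esub> y b' else \<zero>\<^bsub>K\<^esub> else \<zero>\<^bsub>K\<^esub>)"
    proof (intro K.finsum_cong' refl)
      fix b' assume b': "b' \<in> ?B"
      have "a' \<otimes>\<^bsub>M\<^esub> b' = a \<otimes>\<^bsub>M\<^esub> b \<longleftrightarrow> a = a' \<and> b = b'" using uniq[OF a' b'] by blast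
      then show "(if a' \<otimes>\<^bsub>M\<^esub> b' = a \<otimes>\<^bsub>M\<^esub> b then x a' \<otimes>\<^bsub>K\<^esub> y b' else \<zero>\<^bsub>K\<^esub>)
          = (if b = b' then if a = a' then x a' \<otimes>\<^bsub>K\<^esub> y b' else \<zero>\<^bsub>K\<^esub> else \<zero>\<^bsub>K\<^esub>)" by simp
    qed (use a' in auto)
    also have "\<dots> = (if a = a' then x a' \<otimes>\<^bsub>K\<^esub> y b else \<zero>\<^bsub>K\<^esub>)"
      using K.finsum_singleton[OF b supp_finite[OF y], of "\<lambda>b'. if a = a' then x a' \<otimes>\<^bsub>K\<^esub> y b' else \<zero>\<^bsub>K\<^esub>"] a' by auto
    finally show "(\<Oplus>\<^bsub>K\<^esub>b'\<in>?B. if a' \<otimes>\<^bsub>M\<^esub> b' = a \<otimes>\<^bsub>M\<^esub> b then x a' \<otimes>\<^bsub>K\<^esub> y b' else \<zero>\<^bsub>K\<^esub>)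
        = (if a = a' then x a' \<otimes>\<^bsub>K\<^esub> y b else \<zero>\<^bsub>K\<^esub>)" .
  qed (use b in auto)
  also have "\<dots> = x a \<otimes>\<^bsub>K\<^esub> y b"
    using K.finsum_singleton[OF a supp_finite[OF x], of "\<lambda>a'. x a' \<otimes>\<^bsub>K\<^esub> y b"] b by auto
  finally show ?thesis .
qed

lemma scaled_monomial_infty: "scaled_monomial K M c (infty M) = \<zero>\<^bsub>KM\<^esub>"
  unfolding algebra_ops scaled_monomial_def by (rule restrict_ext) (simp add: finite_part_def)

lemma mult_scaled_monomial:
  assumes "a \<in> carrier M" "b \<in> carrier M" and c: "c \<in> carrier K" and d: "d \<in> carrier K"
  shows "scaled_monomial K M c a \<otimes>\<^bsub>KM\<^esub> scaled_monomial K M d b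
    = scaled_monomial K M (c \<otimes>\<^bsub>K\<^esub> d) (a \<otimes>\<^bsub>M\<^esub> b)"
proof (rule algebra_eqI)
  fix e assume e: "e \<in> finite_part M"
  let ?A = "{a} \<inter> finite_part M" and ?B = "{b} \<inter> finite_part M"
  have "(scaled_monomial K M c a \<otimes>\<^bsub>KM\<^esub> scaled_monomial K M d b) e =
      (\<Oplus>\<^bsub>K\<^esub>x\<in>?A. \<Oplus>\<^bsub>K\<^esub>y\<in>?B. if x \<otimes>\<^bsub>M\<^esub> y = e
        then scaled_monomial K M c a x \<otimes>\<^bsub>K\<^esub> scaled_monomial K M d b y else \<zero>\<^bsub>K\<^esub>)"
    by (rule coeff_mult[OF scaled_monomial_closed[OF c] scaled_monomial_closed[OF d] e])
      (auto simp: supp_def scaled_monomial_def split: if_splits)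
  also have "\<dots> = (if a \<otimes>\<^bsub>M\<^esub> b = e then c \<otimes>\<^bsub>K\<^esub> d else \<zero>\<^bsub>K\<^esub>)"
  proof (cases "a \<in> finite_part M \<and> b \<in> finite_part M")
    case True
    then have AB: "?A = {a}" "?B = {b}" by auto
    have cd: "c \<otimes>\<^bsub>K\<^esub> d \<in> carrier K" using c d by simp
    show ?thesis unfolding AB using True cd by (simp add: scaled_monomial_def)
  next
    case False
    then have ne: "a \<otimes>\<^bsub>M\<^esub> b \<noteq> e" using finite_part_factor[OF assms(1,2)] e by auto
    from False have "?A = {} \<or> ?B = {}" by blast
    then show ?thesis
    proof
      assume "?A = {}"
      then show ?thesis using ne by (simp only:) simp
    next
      assume B: "?B = {}"
      show ?thesis unfolding B using ne by (simp add: K.finsum_zero)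
    qed
  qed
  also have "\<dots> = scaled_monomial K M (c \<otimes>\<^bsub>K\<^esub> d) (a \<otimes>\<^bsub>M\<^esub> b) e" using e by (simp add: scaled_monomial_def)
  finally show "(scaled_monomial K M c a \<otimes>\<^bsub>KM\<^esub> scaled_monomial K M d b) e
    = scaled_monomial K M (c \<otimes>\<^bsub>K\<^esub> d) (a \<otimes>\<^bsub>M\<^esub> b) e" .
qed (use c d in simp_all)

text \<open>Turns membership in a generated ideal into a condition on supports. The right-hand side
  is an ideal because \<open>I\<close> absorbs products, and each of its elements is a finite sum of
  terms \<open>c T^a\<close> with \<open>a\<close> in \<open>I\<close>.\<close>

lemma combinatorial_ideal_eq:
  assumes I: "binoid_ideal M I"
  shows "combinatorial_ideal K M I = {x \<in> carrier KM. supp K M x \<subseteq> I}"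
proof
  interpret KM: cring KM by (rule binoid_algebra_cring)
  let ?J = "{x \<in> carrier KM. supp K M x \<subseteq> I}"
  have mult: "x \<otimes>\<^bsub>KM\<^esub> y \<in> ?J" if x: "x \<in> ?J" and y: "y \<in> carrier KM" for x y
  proof -
    have "supp K M (x \<otimes>\<^bsub>KM\<^esub> y) \<subseteq> I"
    proof
      fix c assume "c \<in> supp K M (x \<otimes>\<^bsub>KM\<^esub> y)"
      then obtain a b where "a \<in> supp K M x" "b \<in> supp K M y" "c = a \<otimes>\<^bsub>M\<^esub> b"
        using supp_mult[of x y] by auto
      moreover have "b \<in> carrier M" using \<open>b \<in> supp K M y\<close> by (simp add: supp_def)
      ultimately show "c \<in> I" using x I by (auto simp: binoid_ideal_def)
    qed
    then show ?thesis using x y by simp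
  qed
  have "ideal ?J KM"
  proof (rule idealI[OF KM.ring_axioms])
    show "subgroup ?J (add_monoid KM)"
    proof (rule group.subgroupI[OF KM.a_group])
      have "supp K M \<zero>\<^bsub>KM\<^esub> = {}" by (auto simp: supp_def algebra_ops)
      then show "?J \<noteq> {}" using KM.zero_closed by auto
      fix x assume x: "x \<in> ?J"
      have "\<ominus>\<^bsub>KM\<^esub> x = x \<otimes>\<^bsub>KM\<^esub> (\<ominus>\<^bsub>KM\<^esub> \<one>\<^bsub>KM\<^esub>)" using x by (simp add: KM.r_minus)
      then have "\<ominus>\<^bsub>KM\<^esub> x \<in> ?J" using mult[OF x, of "\<ominus>\<^bsub>KM\<^esub> \<one>\<^bsub>KM\<^esub>"] by simp
      then show "inv\<^bsub>add_monoid KM\<^esub> x \<in> ?J" unfolding a_inv_def .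
      fix y assume y: "y \<in> ?J"
      have "supp K M (x \<oplus>\<^bsub>KM\<^esub> y) \<subseteq> supp K M x \<union> supp K M y"
        using x y by (auto simp: supp_def algebra_ops)
      then show "x \<otimes>\<^bsub>add_monoid KM\<^esub> y \<in> ?J" using x y by auto
    qed auto
    show "a \<otimes>\<^bsub>KM\<^esub> x \<in> ?J" "x \<otimes>\<^bsub>KM\<^esub> a \<in> ?J" if "a \<in> ?J" "x \<in> carrier KM" for a x
      using mult[OF that] that KM.m_comm[of a x] by simp_all
  qed
  moreover have "supp K M (monomial K M a) \<subseteq> {a}" for a
    by (auto simp: supp_def monomial_def split: if_splits)
  ultimately show "combinatorial_ideal K M I \<subseteq> ?J"
    unfolding combinatorial_ideal_def by (intro KM.genideal_minimal) auto
  let ?C = "combinatorial_ideal K M I"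
  have C: "ideal ?C KM"
    unfolding combinatorial_ideal_def by (rule KM.genideal_ideal) auto
  interpret C: ideal ?C KM by fact
  have mono: "monomial K M a \<in> ?C" if "a \<in> I" for a
  proof -
    have "monomial K M ` I \<subseteq> ?C"
      unfolding combinatorial_ideal_def by (rule KM.genideal_self) auto
    then show ?thesis using that by blast
  qed
  \<comment> \<open>Induction runs over a finite set containing the support, so a term can be split
    off without asking whether its coefficient vanishes.\<close>
  have "x \<in> ?C" if "finite A" "A \<subseteq> I" "supp K M x \<subseteq> A" "x \<in> carrier KM" for A x
    using that
  proof (induction A arbitrary: x rule: finite_induct)
    case empty
    then have "x = \<zero>\<^bsub>KM\<^esub>"
      by (intro algebra_eqI[OF _ KM.zero_closed]) (auto simp: supp_def algebra_ops(2))
    then show ?case by simp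
  next
    case (insert a A)
    show ?case
    proof (cases "a \<in> finite_part M")
      \<comment> \<open>\<open>I\<close> contains \<open>infty M\<close>, which carries no
        coefficient, so this point can simply be dropped.\<close>
      case False
      then have "supp K M x \<subseteq> A" using insert.prems(2) supp_subset[of x] by blast
      then show ?thesis using insert.IH insert.prems by simp
    next
      case True
      let ?t = "scaled_monomial K M (x a) a"
      define y where "y = x \<ominus>\<^bsub>KM\<^esub> ?t"
      have xa: "x a \<in> carrier K" using coeff_closed[OF insert.prems(3) True] .
      then have t: "?t \<in> carrier KM" by simp
      have y: "y \<in> carrier KM" unfolding y_def by (rule KM.minus_closed[OF insert.prems(3) t])
      have xy: "y \<oplus>\<^bsub>KM\<^esub> ?t = x"
        unfolding y_def using insert.prems(3) t by (simp add: KM.minus_eq KM.a_assoc KM.l_neg)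
      have yb: "y b \<oplus>\<^bsub>K\<^esub> ?t b = x b" if "b \<in> finite_part M" for b
        using fun_cong[OF xy, of b] that by (simp add: algebra_ops(3))
      have "supp K M y \<subseteq> A"
      proof
        fix b assume b: "b \<in> supp K M y"
        then have bf: "b \<in> finite_part M" and nz: "y b \<noteq> \<zero>\<^bsub>K\<^esub>" by (auto simp: supp_def)
        have ycl: "y b \<in> carrier K" using coeff_closed[OF y bf] .
        have "b \<noteq> a"
        proof
          assume "b = a"
          then have "y a \<oplus>\<^bsub>K\<^esub> x a = x a" using yb[OF bf] bf by (simp add: scaled_monomial_def)
          then have "y a = \<zero>\<^bsub>K\<^esub>" using xa ycl \<open>b = a\<close> by (simp add: K.add.r_cancel_one)
          then show False using nz \<open>b = a\<close> by simp
        qed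
        then have "y b = x b" using yb[OF bf] bf ycl by (simp add: scaled_monomial_def)
        then have "b \<in> supp K M x" using bf nz by (simp add: supp_def)
        then show "b \<in> A" using insert.prems \<open>b \<noteq> a\<close> by blast
      qed
      then have "y \<in> ?C" using insert.IH insert.prems y by blast
      moreover have "?t = scaled_monomial K M (x a) \<one>\<^bsub>M\<^esub> \<otimes>\<^bsub>KM\<^esub> monomial K M a"
        unfolding monomial_eq_scaled using xa True by (simp add: mult_scaled_monomial)
      then have "?t \<in> ?C" using C.I_l_closed[OF mono] insert.prems xa by simp
      ultimately have "y \<oplus>\<^bsub>KM\<^esub> ?t \<in> ?C" by (rule C.a_closed)
      then show ?thesis by (simp only: xy)
    qed
  qed
  then show "?J \<subseteq> ?C" using supp_finite by blast
qed

end

section \<open>Primes of the binoid and primes of its algebra\<close>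

locale cancellative_binoid_algebra = binoid_over_cring K M
  for K :: "('k, 'c) ring_scheme" (structure) and M :: "('m, 'b) binoid_scheme" (structure) +
  assumes field_K: "field K"
    and reduced: "binoid_reduced M"
    and torsion_free: "binoid_torsion_free M"
    and cancellative: "binoid_cancellative M"
begin

sublocale KM: cring "binoid_algebra K M" by (rule binoid_algebra_cring)

lemma K_integral:
  "x \<in> carrier K \<Longrightarrow> y \<in> carrier K \<Longrightarrow> x \<otimes>\<^bsub>K\<^esub> y = \<zero>\<^bsub>K\<^esub> \<Longrightarrow> x = \<zero>\<^bsub>K\<^esub> \<or> y = \<zero>\<^bsub>K\<^esub>"
  by (rule domain.integral[OF field.axioms(1)[OF field_K]])

lemma K_one_neq_zero: "\<one>\<^bsub>K\<^esub> \<noteq> \<zero>\<^bsub>K\<^esub>"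
  by (rule domain.one_not_zero[OF field.axioms(1)[OF field_K]])

lemma prime_infty_mem: "binoid_prime M p \<Longrightarrow> infty M \<in> p"
  by (simp add: binoid_prime_def binoid_ideal_def)

lemma prime_mult_iff:
  assumes p: "binoid_prime M p" and ab: "a \<in> carrier M" "b \<in> carrier M"
  shows "a \<otimes>\<^bsub>M\<^esub> b \<in> p \<longleftrightarrow> a \<in> p \<or> b \<in> p"
proof -
  have "a \<otimes>\<^bsub>M\<^esub> b = b \<otimes>\<^bsub>M\<^esub> a" using ab by (rule M.m_comm)
  then show ?thesis
    using submonoid.m_closed[OF M.prime_submonoid[OF p], of a b] p ab
    unfolding binoid_prime_def binoid_ideal_def by (metis Diff_iff)
qed

lemma prime_one_notin: "binoid_prime M p \<Longrightarrow> \<one>\<^bsub>M\<^esub> \<notin> p"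
  using submonoid.one_closed[OF M.prime_submonoid] by blast

text \<open>The cancellation law of M asks for a product different from \<open>infty\<close>;
  outside a prime this is automatic.\<close>

lemma prime_cancel:
  assumes p: "binoid_prime M p" and "a \<in> carrier M" "b \<in> carrier M" "c \<in> carrier M"
    and eq: "a \<otimes>\<^bsub>M\<^esub> b = a \<otimes>\<^bsub>M\<^esub> c" and "a \<notin> p" "b \<notin> p"
  shows "b = c"
proof -
  have "a \<otimes>\<^bsub>M\<^esub> b \<notin> p" using prime_mult_iff[OF p assms(2,3)] assms(6,7) by blast
  then have "a \<otimes>\<^bsub>M\<^esub> b \<noteq> infty M" using prime_infty_mem[OF p] by metis
  then show ?thesis using cancellative assms unfolding binoid_cancellative_def by blast
qed

text \<open>As M is reduced, no power of \<open>a\<close> is \<open>infty\<close>, and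
  \<open>basic_open_closed_point\<close> supplies a point of \<open>D(a)\<close>.\<close>

lemma exists_prime_notin:
  assumes a: "a \<in> carrier M" "a \<noteq> infty M"
  obtains p where "binoid_prime M p" "a \<notin> p"
proof -
  have "a [^]\<^bsub>M\<^esub> n \<noteq> infty M" for n :: nat
  proof (cases "n = 0")
    \<comment> \<open>Reducedness speaks of positive exponents only. For exponent 0,
      \<open>\<one> = infty M\<close> would give
      \<open>a = \<one> \<otimes> a = infty M\<close>.\<close>
    case True
    have "\<one>\<^bsub>M\<^esub> \<noteq> infty M" using M.infty_absorb[OF a(1)] M.l_one[OF a(1)] a(2) by metis
    then show ?thesis using True by simp
  next
    case False
    then have "n \<ge> 1" by simp
    then show ?thesis using reduced a unfolding binoid_reduced_def by blast
  qed
  from M.basic_open_closed_point[OF a(1) this] obtain p where "p \<in> binoid_basic_open M a" by blast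
  with that show thesis by (auto simp: binoid_basic_open_def)
qed

text \<open>The complement of a prime ideal is a cancellative torsion-free monoid, and only
  factorisations inside it contribute to the coefficients of a product there.\<close>

lemma coeff_mult_extremal:
  assumes p: "binoid_prime M p" and x: "x \<in> carrier KM" and y: "y \<in> carrier KM"
    and ne: "\<not> supp K M x \<subseteq> p" "\<not> supp K M y \<subseteq> p"
  obtains a b a' b' where "a \<in> supp K M x - p" "b \<in> supp K M y - p"
    "a' \<in> supp K M x - p" "b' \<in> supp K M y - p"
    "(x \<otimes>\<^bsub>KM\<^esub> y) (a \<otimes>\<^bsub>M\<^esub> b) = x a \<otimes>\<^bsub>K\<^esub> y b"
    "(x \<otimes>\<^bsub>KM\<^esub> y) (a' \<otimes>\<^bsub>M\<^esub> b') = x a' \<otimes>\<^bsub>K\<^esub> y b'"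
    "a \<otimes>\<^bsub>M\<^esub> b = a' \<otimes>\<^bsub>M\<^esub> b' \<longrightarrow> supp K M x - p = {a}"
proof -
  define N where "N = M\<lparr>carrier := carrier M - p\<rparr>"
  interpret N: comm_monoid N
    unfolding N_def by (rule M.submonoid_is_comm_monoid[OF M.prime_submonoid[OF p]])
  have N: "carrier N = carrier M - p" "monoid.mult N = monoid.mult M" by (simp_all add: N_def)
  have pow: "a [^]\<^bsub>N\<^esub> n = a [^]\<^bsub>M\<^esub> n" for a and n :: nat
    unfolding N_def using M.nat_pow_consistent by metis
  let ?A = "supp K M x - p" and ?B = "supp K M y - p"
  have A: "finite ?A" "?A \<noteq> {}" "?A \<subseteq> carrier N" and B: "finite ?B" "?B \<noteq> {}" "?B \<subseteq> carrier N"
    using supp_finite[OF x] supp_finite[OF y] ne supp_subset[of x] supp_subset[of y] finite_part_closed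
    unfolding N by blast+
  have cancel: "b = c" if "a \<in> carrier N" "b \<in> carrier N" "c \<in> carrier N" "a \<otimes>\<^bsub>N\<^esub> b = a \<otimes>\<^bsub>N\<^esub> c" for a b c
    using that prime_cancel[OF p, of a b c] by (simp add: N)
  have tf: "a = b" if "a \<in> carrier N" "b \<in> carrier N" "n \<ge> 1" "a [^]\<^bsub>N\<^esub> (n::nat) = b [^]\<^bsub>N\<^esub> n" for a b n
    using that torsion_free unfolding binoid_torsion_free_def pow N by blast
  have "\<exists>a b a' b'. N.unique_product ?A ?B a b \<and> N.unique_product ?A ?B a' b' \<and>
      (a \<otimes>\<^bsub>N\<^esub> b = a' \<otimes>\<^bsub>N\<^esub> b' \<longrightarrow> ?A = {a} \<and> ?B = {b})"
    by (rule N.finite_unique_products[where A = ?A and B = ?B], erule (3) cancel, erule (3) tf,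
        (rule A B)+, blast)
  then obtain a b a' b' where 1: "N.unique_product ?A ?B a b" and 2: "N.unique_product ?A ?B a' b'"
    and 3: "a \<otimes>\<^bsub>M\<^esub> b = a' \<otimes>\<^bsub>M\<^esub> b' \<Longrightarrow> ?A = {a} \<and> ?B = {b}"
    unfolding N by blast
  \<comment> \<open>Uniqueness among the terms outside \<open>p\<close> is uniqueness among all
    terms: \<open>a \<otimes> b\<close> avoids \<open>p\<close>, so every factorisation of it has
    both factors outside \<open>p\<close>.\<close>
  have coeff: "(x \<otimes>\<^bsub>KM\<^esub> y) (a \<otimes>\<^bsub>M\<^esub> b) = x a \<otimes>\<^bsub>K\<^esub> y b" if u: "N.unique_product ?A ?B a b" for a b
  proof (rule coeff_mult_unique[OF x y])
    have ab: "a \<in> ?A" "b \<in> ?B" using u unfolding N.unique_product_def by auto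
    then show "a \<in> supp K M x" "b \<in> supp K M y" by auto
    have M: "a \<in> carrier M" "b \<in> carrier M" using ab A(3) B(3) unfolding N by auto
    then have np: "a \<otimes>\<^bsub>M\<^esub> b \<notin> p" using prime_mult_iff[OF p M] ab by blast
    then show "a \<otimes>\<^bsub>M\<^esub> b \<in> finite_part M" using M prime_infty_mem[OF p] unfolding finite_part_def
      by (metis DiffI M.m_closed singletonD)
    fix a' b' assume ab': "a' \<in> supp K M x" "b' \<in> supp K M y" and eq: "a' \<otimes>\<^bsub>M\<^esub> b' = a \<otimes>\<^bsub>M\<^esub> b"
    then have "a' \<in> carrier M" "b' \<in> carrier M" by (auto simp: supp_def)
    then have "a' \<notin> p" "b' \<notin> p" using prime_mult_iff[OF p, of a' b'] np eq by auto
    then show "a' = a \<and> b' = b" using u ab' eq unfolding N.unique_product_def N by blast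
  qed
  have mem: "a \<in> ?A" "b \<in> ?B" "a' \<in> ?A" "b' \<in> ?B"
    using 1 2 unfolding N.unique_product_def by blast+
  show thesis by (rule that[OF mem coeff[OF 1] coeff[OF 2]]) (use 3 in blast)
qed

lemma combinatorial_ideal_mem_iff:
  "binoid_prime M p \<Longrightarrow> x \<in> combinatorial_ideal K M p \<longleftrightarrow> x \<in> carrier KM \<and> supp K M x \<subseteq> p"
  by (simp add: combinatorial_ideal_eq binoid_prime_def)

text \<open>If both factors have terms outside \<open>p\<close>, an extremal product of such terms
  has coefficient \<open>x a \<otimes> y b\<close>, which is nonzero in a field, and it sits outside
  \<open>p\<close>.\<close>

theorem combinatorial_ideal_prime:
  assumes p: "binoid_prime M p"
  shows "primeideal (combinatorial_ideal K M p) KM"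
proof (rule primeidealI[OF _ KM.is_cring])
  note mem = combinatorial_ideal_mem_iff[OF p]
  show "ideal (combinatorial_ideal K M p) KM"
    unfolding combinatorial_ideal_def by (rule KM.genideal_ideal) auto
  have "\<one>\<^bsub>M\<^esub> \<in> finite_part M"
    using prime_one_notin[OF p] prime_infty_mem[OF p] by (auto simp: finite_part_def)
  then have "supp K M \<one>\<^bsub>KM\<^esub> = {\<one>\<^bsub>M\<^esub>}"
    unfolding algebra_ops monomial_eq_scaled using supp_scaled_monomial K_one_neq_zero by blast
  then have "\<one>\<^bsub>KM\<^esub> \<notin> combinatorial_ideal K M p" using mem prime_one_notin[OF p] by auto
  then show "carrier KM \<noteq> combinatorial_ideal K M p" using KM.one_closed by blast
  fix x y assume x: "x \<in> carrier KM" and y: "y \<in> carrier KM"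
    and xy: "x \<otimes>\<^bsub>KM\<^esub> y \<in> combinatorial_ideal K M p"
  show "x \<in> combinatorial_ideal K M p \<or> y \<in> combinatorial_ideal K M p"
  proof (rule ccontr)
    assume "\<not> ?thesis"
    then have "\<not> supp K M x \<subseteq> p" "\<not> supp K M y \<subseteq> p" using mem x y by blast+
    from coeff_mult_extremal[OF p x y this] obtain a b where
      ab: "a \<in> supp K M x - p" "b \<in> supp K M y - p"
      and coeff: "(x \<otimes>\<^bsub>KM\<^esub> y) (a \<otimes>\<^bsub>M\<^esub> b) = x a \<otimes>\<^bsub>K\<^esub> y b" by metis
    have M: "a \<in> carrier M" "b \<in> carrier M" using ab by (auto simp: supp_def)
    have "x a \<otimes>\<^bsub>K\<^esub> y b \<noteq> \<zero>\<^bsub>K\<^esub>"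
      using K_integral[of "x a" "y b"] coeff_supp_closed[OF x, of a] coeff_supp_closed[OF y, of b] ab
      by (auto simp: supp_def)
    moreover have np: "a \<otimes>\<^bsub>M\<^esub> b \<notin> p" using prime_mult_iff[OF p M] ab by blast
    then have "a \<otimes>\<^bsub>M\<^esub> b \<noteq> infty M" using prime_infty_mem[OF p] by metis
    ultimately have "a \<otimes>\<^bsub>M\<^esub> b \<in> supp K M (x \<otimes>\<^bsub>KM\<^esub> y)"
      using coeff M by (simp add: supp_def finite_part_def)
    then show False using np xy mem by blast
  qed
qed

text \<open>Some prime \<open>p\<close> misses a given term of \<open>x\<close>. Then
  \<open>x\<close> lies outside the prime \<open>K[p]\<close>, and so does every power of it,
  including the exponent 0 since \<open>K[p]\<close> is proper.\<close>

lemma algebra_reduced: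
  assumes x: "x \<in> carrier KM" and pow: "x [^]\<^bsub>KM\<^esub> (n::nat) = \<zero>\<^bsub>KM\<^esub>"
  shows "x = \<zero>\<^bsub>KM\<^esub>"
proof (rule ccontr)
  assume "x \<noteq> \<zero>\<^bsub>KM\<^esub>"
  then obtain a where a: "a \<in> finite_part M" "x a \<noteq> \<zero>\<^bsub>K\<^esub>"
    using algebra_eqI[OF x KM.zero_closed] by (auto simp: algebra_ops)
  then obtain p where p: "binoid_prime M p" "a \<notin> p"
    using exists_prime_notin[of a] by (auto simp: finite_part_def)
  interpret P: primeideal "combinatorial_ideal K M p" KM by (rule combinatorial_ideal_prime[OF p(1)])
  have "x \<notin> combinatorial_ideal K M p"
    using combinatorial_ideal_mem_iff[OF p(1)] a p(2) by (auto simp: supp_def)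
  moreover have "x [^]\<^bsub>KM\<^esub> n \<notin> combinatorial_ideal K M p"
  proof (induction n)
    case 0
    then show ?case using P.one_imp_carrier P.I_notcarr by auto
  next
    case (Suc n)
    then show ?case using P.I_prime[of "x [^]\<^bsub>KM\<^esub> n" x] x \<open>x \<notin> _\<close> by auto
  qed
  ultimately show False using pow P.zero_closed by simp
qed

lemma monomial_radical_mem_iff:
  "a \<in> carrier M \<Longrightarrow> a \<in> monomial_radical K M P \<longleftrightarrow> monomial K M a \<in> P"
  by (simp add: monomial_radical_def)

lemma monomial_radical_prime:
  assumes P: "primeideal P KM"
  shows "binoid_prime M (monomial_radical K M P)"
proof -
  interpret P: primeideal P KM by fact
  have "monomial K M (infty M) = \<zero>\<^bsub>KM\<^esub>"
    unfolding monomial_eq_scaled by (rule scaled_monomial_infty)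
  then have "infty M \<in> monomial_radical K M P" by (simp add: monomial_radical_def)
  moreover have "a \<otimes>\<^bsub>M\<^esub> b \<in> monomial_radical K M P" if "a \<in> monomial_radical K M P" "b \<in> carrier M" for a b
    using that P.I_r_closed[of "monomial K M a" "monomial K M b"] mult_monomial[of a b]
    by (auto simp: monomial_radical_def)
  moreover have "submonoid (carrier M - monomial_radical K M P) M"
  proof (rule submonoid.intro)
    have "monomial K M \<one>\<^bsub>M\<^esub> \<notin> P"
      using P.one_imp_carrier P.I_notcarr unfolding algebra_ops by auto
    then show "\<one>\<^bsub>M\<^esub> \<in> carrier M - monomial_radical K M P" by (simp add: monomial_radical_def)
    show "a \<otimes>\<^bsub>M\<^esub> b \<in> carrier M - monomial_radical K M P"
      if "a \<in> carrier M - monomial_radical K M P" "b \<in> carrier M - monomial_radical K M P" for a b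
      using that P.I_prime[of "monomial K M a" "monomial K M b"] mult_monomial[of a b]
      by (auto simp: monomial_radical_def)
  qed auto
  ultimately show ?thesis by (auto simp: binoid_prime_def binoid_ideal_def monomial_radical_def)
qed

text \<open>Consequently an element outside \<open>P\<close> is also outside \<open>K[p]\<close> for
  \<open>p\<close> the retraction of \<open>P\<close>, so equations of germs at \<open>P\<close> can
  be tested modulo \<open>K[p]\<close>.\<close>

lemma combinatorial_ideal_radical_subset:
  assumes P: "primeideal P KM"
  shows "combinatorial_ideal K M (monomial_radical K M P) \<subseteq> P"
  unfolding combinatorial_ideal_def
  using P by (intro KM.genideal_minimal) (auto simp: monomial_radical_def primeideal.axioms(1))

lemma monomial_mem_combinatorial_ideal_iff:
  assumes p: "binoid_prime M p" and a: "a \<in> carrier M"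
  shows "monomial K M a \<in> combinatorial_ideal K M p \<longleftrightarrow> a \<in> p"
proof (cases "a = infty M")
  case True
  have "supp K M (monomial K M a) = {}" unfolding True by (auto simp: supp_def monomial_def finite_part_def)
  then show ?thesis using True prime_infty_mem[OF p] combinatorial_ideal_mem_iff[OF p] by simp
next
  case False
  then have "supp K M (monomial K M a) = {a}"
    unfolding monomial_eq_scaled using supp_scaled_monomial K_one_neq_zero a by (simp add: finite_part_def)
  then show ?thesis using combinatorial_ideal_mem_iff[OF p] by simp
qed

lemma monomial_radical_combinatorial_ideal:
  assumes p: "binoid_prime M p"
  shows "monomial_radical K M (combinatorial_ideal K M p) = p"
proof -
  have "p \<subseteq> carrier M" using p by (simp add: binoid_prime_def binoid_ideal_def)
  then show ?thesis using monomial_mem_combinatorial_ideal_iff[OF p] by (auto simp: monomial_radical_def)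
qed

end

section \<open>Unit sections\<close>

text \<open>Compared with \<open>fraction_sections\<close> the numerator must avoid the primes too,
  so local inverses are visible by exchanging numerator and denominator. That the values lie in the
  localizations follows from the local form, hence \<open>extensional\<close> suffices.\<close>

definition unit_sections ::
  "('a, 'b) monoid_scheme \<Rightarrow> 'a set topology \<Rightarrow> 'a set set \<Rightarrow> ('a set \<Rightarrow> ('a \<times> 'a) set) set"
  where "unit_sections R X U =
    {s \<in> extensional U.
      \<forall>p\<in>U. \<exists>V. openin X V \<and> p \<in> V \<and> V \<subseteq> U \<and>
        (\<exists>a\<in>carrier R. \<exists>f\<in>carrier R. \<forall>q\<in>V. a \<notin> q \<and> f \<notin> q \<and> s q = loc_frac R (carrier R - q) a f)}"

lemma unit_sectionsE:
  assumes "s \<in> unit_sections R X U" "p \<in> U"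
  obtains V a f where "openin X V" "p \<in> V" "V \<subseteq> U" "a \<in> carrier R" "f \<in> carrier R"
    "\<forall>q\<in>V. a \<notin> q \<and> f \<notin> q \<and> s q = loc_frac R (carrier R - q) a f"
proof -
  have "\<forall>p\<in>U. \<exists>V. openin X V \<and> p \<in> V \<and> V \<subseteq> U \<and> (\<exists>a\<in>carrier R. \<exists>f\<in>carrier R.
      \<forall>q\<in>V. a \<notin> q \<and> f \<notin> q \<and> s q = loc_frac R (carrier R - q) a f)"
    using assms(1) unfolding unit_sections_def by simp
  from bspec[OF this assms(2)] show thesis
    by (elim exE conjE bexE) (rule that)
qed

lemma fraction_sectionsE:
  assumes "s \<in> fraction_sections R X U" "p \<in> U"
  obtains V a f where "openin X V" "p \<in> V" "V \<subseteq> U" "a \<in> carrier R" "f \<in> carrier R"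
    "\<forall>q\<in>V. f \<notin> q \<and> s q = loc_frac R (carrier R - q) a f"
proof -
  have "\<forall>p\<in>U. \<exists>V. openin X V \<and> p \<in> V \<and> V \<subseteq> U \<and> (\<exists>a\<in>carrier R. \<exists>f\<in>carrier R.
      \<forall>q\<in>V. f \<notin> q \<and> s q = loc_frac R (carrier R - q) a f)"
    using assms(1) unfolding fraction_sections_def by simp
  from bspec[OF this assms(2)] show thesis
    by (elim exE conjE bexE) (rule that)
qed

section \<open>Units among sections given by fractions, for rings and binoids at once\<close>

context comm_monoid
begin

context
  fixes X :: "'a set topology" and U :: "'a set set"
  assumes sub: "\<And>p. p \<in> U \<Longrightarrow> submonoid (carrier G - p) G"
    and absorb: "\<And>p a b. p \<in> U \<Longrightarrow> a \<in> p \<Longrightarrow> b \<in> carrier G \<Longrightarrow> a \<otimes> b \<in> p"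
begin

text \<open>From \<open>(a / f) (b / g) = 1\<close> at \<open>q\<close> there is \<open>u\<close>
  outside \<open>q\<close> with \<open>u a b = u f g\<close>. The right side lies outside
  \<open>q\<close>, so \<open>a\<close> cannot lie in \<open>q\<close>.\<close>

lemma unit_section_if_inverse:
  assumes s: "s \<in> fraction_sections G X U" and t: "t \<in> fraction_sections G X U"
    and st: "\<And>p. p \<in> U \<Longrightarrow> loc_mult G (carrier G - p) (s p) (t p) = loc_frac G (carrier G - p) \<one> \<one>"
  shows "s \<in> unit_sections G X U"
proof -
  have "\<exists>V. openin X V \<and> p \<in> V \<and> V \<subseteq> U \<and>
      (\<exists>a\<in>carrier G. \<exists>f\<in>carrier G. \<forall>q\<in>V. a \<notin> q \<and> f \<notin> q \<and> s q = loc_frac G (carrier G - q) a f)"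
    if p: "p \<in> U" for p
  proof -
    obtain V a f where V: "openin X V" "p \<in> V" "V \<subseteq> U" and af: "a \<in> carrier G" "f \<in> carrier G"
      and s_V: "\<forall>q\<in>V. f \<notin> q \<and> s q = loc_frac G (carrier G - q) a f"
      by (rule fraction_sectionsE[OF s p]) (rule that)
    obtain V' b g where V': "openin X V'" "p \<in> V'" "V' \<subseteq> U" and bg: "b \<in> carrier G" "g \<in> carrier G"
      and t_V: "\<forall>q\<in>V'. g \<notin> q \<and> t q = loc_frac G (carrier G - q) b g"
      by (rule fraction_sectionsE[OF t p]) (rule that)
    note s_eq = bspec[OF s_V] and t_eq = bspec[OF t_V]
    have "a \<notin> q" if q: "q \<in> V" "q \<in> V'" for q
    proof
      assume aq: "a \<in> q"
      have qU: "q \<in> U" using q V by blast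
      interpret S: submonoid "carrier G - q" G by (rule sub[OF qU])
      have fg: "f \<in> carrier G - q" "g \<in> carrier G - q" using s_eq[OF q(1)] t_eq[OF q(2)] af bg by auto
      have "loc_frac G (carrier G - q) (a \<otimes> b) (f \<otimes> g) = loc_frac G (carrier G - q) \<one> \<one>"
        using st[OF qU] s_eq[OF q(1)] t_eq[OF q(2)]
          loc_mult_frac[OF sub[OF qU] af(1) bg(1) fg] by simp
      then obtain u where u: "u \<in> carrier G - q" "u \<otimes> (\<one> \<otimes> (a \<otimes> b)) = u \<otimes> ((f \<otimes> g) \<otimes> \<one>)"
        using loc_frac_eq_iff[OF sub[OF qU], of "a \<otimes> b" \<one> "f \<otimes> g" \<one>] S.m_closed[OF fg] S.one_closed af bg
        by auto
      have "u \<otimes> ((f \<otimes> g) \<otimes> \<one>) \<in> carrier G - q" by (intro S.m_closed u(1) fg S.one_closed)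
      moreover have "u \<otimes> (\<one> \<otimes> (a \<otimes> b)) = a \<otimes> (b \<otimes> u)" using u(1) af bg by (simp add: m_ac)
      ultimately have "a \<otimes> (b \<otimes> u) \<notin> q" using u(2) by simp
      then show False using absorb[OF qU aq, of "b \<otimes> u"] bg u(1) by simp
    qed
    then show ?thesis
      using openin_Int[OF V(1) V'(1)] V V' af s_V by (intro exI[of _ "V \<inter> V'"] conjI bexI[of _ a] bexI[of _ f]) auto
  qed
  moreover have "s \<in> extensional U" using s unfolding fraction_sections_def by (simp add: PiE_def)
  ultimately show ?thesis unfolding unit_sections_def by blast
qed

lemma unit_sections_subset: "unit_sections G X U \<subseteq> fraction_sections G X U"
proof
  fix s assume s: "s \<in> unit_sections G X U"
  have "s p \<in> loc_carrier G (carrier G - p)" if p: "p \<in> U" for p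
  proof -
    from unit_sectionsE[OF s p] obtain V a f where "p \<in> V" "a \<in> carrier G" "f \<in> carrier G"
      "\<forall>q\<in>V. a \<notin> q \<and> f \<notin> q \<and> s q = loc_frac G (carrier G - q) a f" by metis
    then show ?thesis using loc_frac_closed[of a f "carrier G - p"] by simp
  qed
  then show "s \<in> fraction_sections G X U"
    using s unfolding unit_sections_def fraction_sections_def by (simp add: PiE_def) metis
qed

lemma unit_section_inverse:
  assumes s: "s \<in> unit_sections G X U"
  shows "\<exists>t\<in>unit_sections G X U. \<forall>p\<in>U.
    loc_mult G (carrier G - p) (s p) (t p) = loc_frac G (carrier G - p) \<one> \<one> \<and>
    loc_mult G (carrier G - p) (t p) (s p) = loc_frac G (carrier G - p) \<one> \<one>"
proof -
  \<comment> \<open>The inverse of \<open>a / f\<close> is \<open>f / a\<close>. Different local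
    representations must yield the same class, so it is defined pointwise by description;
    well-definedness is the symmetry of the fraction relation.\<close>
  define t where "t = (\<lambda>p\<in>U. THE Y. \<exists>a\<in>carrier G - p. \<exists>f\<in>carrier G - p.
    s p = loc_frac G (carrier G - p) a f \<and> Y = loc_frac G (carrier G - p) f a)"
  have t_eq: "t p = loc_frac G (carrier G - p) f a"
    if p: "p \<in> U" and af: "a \<in> carrier G" "a \<notin> p" "f \<in> carrier G" "f \<notin> p"
      and eq: "s p = loc_frac G (carrier G - p) a f" for p a f
  proof -
    have "(THE Y. \<exists>a\<in>carrier G - p. \<exists>f\<in>carrier G - p.
        s p = loc_frac G (carrier G - p) a f \<and> Y = loc_frac G (carrier G - p) f a)
      = loc_frac G (carrier G - p) f a"
    proof (rule the_equality)
      show "\<exists>a'\<in>carrier G - p. \<exists>f'\<in>carrier G - p. s p = loc_frac G (carrier G - p) a' f' \<and>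
          loc_frac G (carrier G - p) f a = loc_frac G (carrier G - p) f' a'"
        using af eq by blast
      fix Y assume "\<exists>a'\<in>carrier G - p. \<exists>f'\<in>carrier G - p. s p = loc_frac G (carrier G - p) a' f' \<and>
          Y = loc_frac G (carrier G - p) f' a'"
      then obtain a' f' where af': "a' \<in> carrier G - p" "f' \<in> carrier G - p"
        "s p = loc_frac G (carrier G - p) a' f'" "Y = loc_frac G (carrier G - p) f' a'" by blast
      then obtain u where u: "u \<in> carrier G - p" "u \<otimes> (f' \<otimes> a) = u \<otimes> (f \<otimes> a')"
        using loc_frac_eq_iff[OF sub[OF p], of a a' f f'] af eq by auto
      have "u \<otimes> (a \<otimes> f') = u \<otimes> (a' \<otimes> f)" using u af af' by (simp add: m_comm)
      then show "Y = loc_frac G (carrier G - p) f a"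
        using loc_frac_eq_iff[OF sub[OF p], of f' f a' a] af af' u(1) by auto
    qed
    then show ?thesis using p by (simp add: t_def)
  qed
  have inv: "loc_mult G (carrier G - p) (s p) (t p) = loc_frac G (carrier G - p) \<one> \<one> \<and>
      loc_mult G (carrier G - p) (t p) (s p) = loc_frac G (carrier G - p) \<one> \<one>" if p: "p \<in> U" for p
  proof -
    obtain a f where af: "a \<in> carrier G" "f \<in> carrier G" "a \<notin> p" "f \<notin> p"
      and eq: "s p = loc_frac G (carrier G - p) a f" using unit_sectionsE[OF s p] by metis
    interpret S: submonoid "carrier G - p" G by (rule sub[OF p])
    have "f \<otimes> a \<in> carrier G - p" by (rule S.m_closed) (use af in auto)
    then have "loc_frac G (carrier G - p) (a \<otimes> f) (f \<otimes> a) = loc_frac G (carrier G - p) \<one> \<one>"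
      using loc_frac_eq_iff[OF sub[OF p], of "a \<otimes> f" \<one> "f \<otimes> a" \<one>] S.one_closed af
      by (auto intro!: bexI[of _ \<one>] simp: m_comm)
    then show ?thesis
      using loc_mult_frac[OF sub[OF p], of a f f a] loc_mult_frac[OF sub[OF p], of f a a f] af
      by (simp add: t_eq[OF p af(1,3,2,4) eq] eq m_comm)
  qed
  have "t \<in> unit_sections G X U"
    unfolding unit_sections_def
  proof (intro CollectI conjI ballI)
    show "t \<in> extensional U" by (simp add: t_def)
    fix p assume "p \<in> U"
    from unit_sectionsE[OF s this] obtain V a f where V: "openin X V" "p \<in> V" "V \<subseteq> U"
      and af: "a \<in> carrier G" "f \<in> carrier G"
      and eq: "\<forall>q\<in>V. a \<notin> q \<and> f \<notin> q \<and> s q = loc_frac G (carrier G - q) a f" by metis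
    have "f \<notin> q \<and> a \<notin> q \<and> t q = loc_frac G (carrier G - q) f a" if q: "q \<in> V" for q
      using t_eq[of q a f] bspec[OF eq q] subsetD[OF V(3) q] af by simp
    then show "\<exists>V. openin X V \<and> p \<in> V \<and> V \<subseteq> U \<and> (\<exists>a\<in>carrier G. \<exists>f\<in>carrier G. \<forall>q\<in>V.
        a \<notin> q \<and> f \<notin> q \<and> t q = loc_frac G (carrier G - q) a f)"
      using V af by blast
  qed
  with inv show ?thesis by blast
qed

lemma Units_fraction_sections:
  assumes S: "carrier S = fraction_sections G X U"
    and mult: "\<And>s t. s \<otimes>\<^bsub>S\<^esub> t = (\<lambda>p\<in>U. loc_mult G (carrier G - p) (s p) (t p))"
    and one: "\<one>\<^bsub>S\<^esub> = (\<lambda>p\<in>U. loc_frac G (carrier G - p) \<one> \<one>)"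
  shows "Units S = unit_sections G X U"
proof (intro equalityI subsetI)
  fix s assume "s \<in> Units S"
  then obtain t where st: "s \<in> carrier S" "t \<in> carrier S" "s \<otimes>\<^bsub>S\<^esub> t = \<one>\<^bsub>S\<^esub>" unfolding Units_def by blast
  show "s \<in> unit_sections G X U"
  proof (rule unit_section_if_inverse)
    show "loc_mult G (carrier G - p) (s p) (t p) = loc_frac G (carrier G - p) \<one> \<one>" if "p \<in> U" for p
      using fun_cong[OF st(3), of p] that unfolding mult one by simp
  qed (use st S in auto)
next
  fix s assume s: "s \<in> unit_sections G X U"
  from unit_section_inverse[OF this] obtain t where t: "t \<in> unit_sections G X U"
    and inv: "\<forall>p\<in>U. loc_mult G (carrier G - p) (s p) (t p) = loc_frac G (carrier G - p) \<one> \<one> \<and>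
      loc_mult G (carrier G - p) (t p) (s p) = loc_frac G (carrier G - p) \<one> \<one>" by blast
  have "s \<otimes>\<^bsub>S\<^esub> t = \<one>\<^bsub>S\<^esub>" "t \<otimes>\<^bsub>S\<^esub> s = \<one>\<^bsub>S\<^esub>"
    unfolding mult one using inv by (auto intro!: restrict_ext)
  then show "s \<in> Units S" using s t unit_sections_subset S unfolding Units_def by blast
qed

end

end

section \<open>Monomial fractions and the units over \<open>D(T^h)\<close>\<close>

context cancellative_binoid_algebra
begin

lemma ring_open_monomial_iff:
  "h \<in> carrier M \<Longrightarrow> P \<in> ring_open KM {monomial K M h} \<longleftrightarrow>
    primeideal P KM \<and> h \<notin> monomial_radical K M P"
  by (simp add: ring_open_def monomial_radical_mem_iff)

lemma monomial_mult_scaled_monomial: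
  assumes "a \<in> carrier M" "b \<in> carrier M" "c \<in> carrier K"
  shows "monomial K M a \<otimes>\<^bsub>KM\<^esub> scaled_monomial K M c b = scaled_monomial K M c (a \<otimes>\<^bsub>M\<^esub> b)"
  using mult_scaled_monomial[of a b "\<one>\<^bsub>K\<^esub>" c] assms by (simp add: monomial_eq_scaled)

lemma scaled_monomial_notin:
  assumes P: "primeideal P KM" and a: "a \<in> carrier M" "a \<notin> monomial_radical K M P"
    and c: "c \<in> carrier K" "c \<noteq> \<zero>\<^bsub>K\<^esub>"
  shows "scaled_monomial K M c a \<notin> P"
proof
  assume mem: "scaled_monomial K M c a \<in> P"
  interpret P: primeideal P KM by fact
  obtain d where d: "d \<in> carrier K" "d \<otimes>\<^bsub>K\<^esub> c = \<one>\<^bsub>K\<^esub>"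
    using c field.field_Units[OF field_K] unfolding Units_def by blast
  have "scaled_monomial K M d \<one>\<^bsub>M\<^esub> \<otimes>\<^bsub>KM\<^esub> scaled_monomial K M c a = monomial K M a"
    using mult_scaled_monomial[of "\<one>\<^bsub>M\<^esub>" a d c] d c a by (simp add: monomial_eq_scaled)
  then have "monomial K M a \<in> P"
    using P.I_l_closed[OF mem, of "scaled_monomial K M d \<one>\<^bsub>M\<^esub>"] d by simp
  then show False using a by (simp add: monomial_radical_def)
qed

text \<open>A germ \<open>c T^a / T^f\<close> determines both the scalar and the fraction. The
  relation at \<open>P\<close> passes to the prime \<open>K[p]\<close>, where the exponents
  \<open>g \<otimes> a\<close> and \<open>f \<otimes> b\<close> survive because they lie outside
  \<open>p\<close>; two such terms cancel only if exponents and scalars agree.\<close>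

theorem loc_frac_scaled_monomial_eq_iff:
  assumes P: "primeideal P KM" and p: "p = monomial_radical K M P"
    and M: "a \<in> carrier M" "b \<in> carrier M" "f \<in> carrier M" "g \<in> carrier M"
    and np: "a \<notin> p" "b \<notin> p" "f \<notin> p" "g \<notin> p"
    and cd: "c \<in> carrier K" "c \<noteq> \<zero>\<^bsub>K\<^esub>" "d \<in> carrier K" "d \<noteq> \<zero>\<^bsub>K\<^esub>"
  shows "loc_frac KM (carrier KM - P) (scaled_monomial K M c a) (monomial K M f)
      = loc_frac KM (carrier KM - P) (scaled_monomial K M d b) (monomial K M g)
    \<longleftrightarrow> c = d \<and> loc_frac M (carrier M - p) a f = loc_frac M (carrier M - p) b g"
    (is "?L \<longleftrightarrow> _ \<and> ?R")
proof -
  interpret P: primeideal P KM by fact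
  have pp: "binoid_prime M p" unfolding p by (rule monomial_radical_prime[OF P])
  interpret Q: primeideal "combinatorial_ideal K M p" KM by (rule combinatorial_ideal_prime[OF pp])
  have mono: "monomial K M x \<in> carrier KM - P" if "x \<in> carrier M" "x \<notin> p" for x
    using that monomial_radical_mem_iff unfolding p by simp
  have L: "?L \<longleftrightarrow> (\<exists>u\<in>carrier KM - P. u \<otimes>\<^bsub>KM\<^esub> scaled_monomial K M c (g \<otimes>\<^bsub>M\<^esub> a)
      = u \<otimes>\<^bsub>KM\<^esub> scaled_monomial K M d (f \<otimes>\<^bsub>M\<^esub> b))"
    using KM.loc_frac_eq_iff[OF P.complement_submonoid, of "scaled_monomial K M c a" "scaled_monomial K M d b"
        "monomial K M f" "monomial K M g"] mono M np cd by (simp add: monomial_mult_scaled_monomial)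
  have R: "?R \<longleftrightarrow> (\<exists>u\<in>carrier M - p. u \<otimes>\<^bsub>M\<^esub> (g \<otimes>\<^bsub>M\<^esub> a) = u \<otimes>\<^bsub>M\<^esub> (f \<otimes>\<^bsub>M\<^esub> b))"
    by (rule M.loc_frac_eq_iff[OF M.prime_submonoid[OF pp]]) (use M np in auto)
  show ?thesis
  proof
    assume ?L
    then obtain u where u: "u \<in> carrier KM" "u \<notin> P"
      and eq: "u \<otimes>\<^bsub>KM\<^esub> scaled_monomial K M c (g \<otimes>\<^bsub>M\<^esub> a) = u \<otimes>\<^bsub>KM\<^esub> scaled_monomial K M d (f \<otimes>\<^bsub>M\<^esub> b)"
      using L by blast
    define x y where "x = scaled_monomial K M c (g \<otimes>\<^bsub>M\<^esub> a)" and "y = scaled_monomial K M d (f \<otimes>\<^bsub>M\<^esub> b)"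
    have xy: "x \<in> carrier KM" "y \<in> carrier KM" using cd by (simp_all add: x_def y_def)
    define e where "e = x \<ominus>\<^bsub>KM\<^esub> y"
    have e: "e \<in> carrier KM" using xy by (simp add: e_def)
    have ey: "e \<oplus>\<^bsub>KM\<^esub> y = x"
      unfolding e_def using xy by (simp add: KM.minus_eq KM.a_assoc KM.l_neg)
    have "u \<otimes>\<^bsub>KM\<^esub> e = u \<otimes>\<^bsub>KM\<^esub> x \<ominus>\<^bsub>KM\<^esub> u \<otimes>\<^bsub>KM\<^esub> y"
      unfolding e_def using u xy by (simp add: KM.minus_eq KM.r_distr KM.r_minus)
    also have "\<dots> = \<zero>\<^bsub>KM\<^esub>" using eq u xy unfolding x_def[symmetric] y_def[symmetric]
      by (simp add: KM.minus_eq KM.r_neg)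
    finally have "u \<otimes>\<^bsub>KM\<^esub> e \<in> combinatorial_ideal K M p" using Q.zero_closed by simp
    moreover have "u \<notin> combinatorial_ideal K M p"
      using u combinatorial_ideal_radical_subset[OF P] unfolding p by blast
    ultimately have "e \<in> combinatorial_ideal K M p" using Q.I_prime[OF u(1) e] by blast
    then have supp_e: "supp K M e \<subseteq> p" using combinatorial_ideal_mem_iff[OF pp] by blast
    have ga: "g \<otimes>\<^bsub>M\<^esub> a \<notin> p" using prime_mult_iff[OF pp M(4,1)] np by blast
    then have gaf: "g \<otimes>\<^bsub>M\<^esub> a \<in> finite_part M" using M prime_infty_mem[OF pp]
      unfolding finite_part_def by (metis DiffI M.m_closed singletonD)
    \<comment> \<open>\<open>e\<close> has no terms outside \<open>p\<close>, so its coefficient at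
      \<open>g \<otimes> a\<close> vanishes. That coefficient is \<open>c\<close> minus
      \<open>d\<close> if the exponents agree and \<open>c\<close> otherwise; the second case is
      excluded by \<open>c\<close> being nonzero.\<close>
    have "e (g \<otimes>\<^bsub>M\<^esub> a) = \<zero>\<^bsub>K\<^esub>" using ga gaf supp_e unfolding supp_def by blast
    moreover have "e (g \<otimes>\<^bsub>M\<^esub> a) \<oplus>\<^bsub>K\<^esub> y (g \<otimes>\<^bsub>M\<^esub> a) = x (g \<otimes>\<^bsub>M\<^esub> a)"
      using fun_cong[OF ey, of "g \<otimes>\<^bsub>M\<^esub> a"] gaf by (simp add: algebra_ops(3))
    ultimately have "y (g \<otimes>\<^bsub>M\<^esub> a) = x (g \<otimes>\<^bsub>M\<^esub> a)" using coeff_closed[OF xy(2) gaf] by simp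
    then have "(if g \<otimes>\<^bsub>M\<^esub> a = f \<otimes>\<^bsub>M\<^esub> b then d else \<zero>\<^bsub>K\<^esub>) = c"
      using gaf by (simp add: x_def y_def scaled_monomial_def)
    then have "g \<otimes>\<^bsub>M\<^esub> a = f \<otimes>\<^bsub>M\<^esub> b" "c = d" using cd(2) by (auto split: if_splits)
    moreover have "\<one>\<^bsub>M\<^esub> \<in> carrier M - p" using prime_one_notin[OF pp] by simp
    ultimately show "c = d \<and> ?R" unfolding R by metis
  next
    assume "c = d \<and> ?R"
    then obtain u where u: "u \<in> carrier M - p" "u \<otimes>\<^bsub>M\<^esub> (g \<otimes>\<^bsub>M\<^esub> a) = u \<otimes>\<^bsub>M\<^esub> (f \<otimes>\<^bsub>M\<^esub> b)" and "c = d"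
      unfolding R by blast
    then have "monomial K M u \<otimes>\<^bsub>KM\<^esub> scaled_monomial K M c (g \<otimes>\<^bsub>M\<^esub> a)
        = monomial K M u \<otimes>\<^bsub>KM\<^esub> scaled_monomial K M d (f \<otimes>\<^bsub>M\<^esub> b)"
      using M cd by (simp add: monomial_mult_scaled_monomial)
    then show ?L unfolding L using mono[of u] u(1) by blast
  qed
qed

lemma supp_monomial: "a \<in> finite_part M \<Longrightarrow> supp K M (monomial K M a) = {a}"
  unfolding monomial_eq_scaled using supp_scaled_monomial K_one_neq_zero by blast

lemma monomial_pow:
  assumes "h \<in> carrier M" shows "monomial K M h [^]\<^bsub>KM\<^esub> (n::nat) = monomial K M (h [^]\<^bsub>M\<^esub> n)"
  using assms by (induction n) (simp_all add: mult_monomial algebra_ops(1))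

lemma prime_pow_notin:
  assumes q: "binoid_prime M q" and h: "h \<in> carrier M" "h \<notin> q"
  shows "h [^]\<^bsub>M\<^esub> (n::nat) \<notin> q"
  using M.basic_open_power[OF h(1), of q n] q h(2) by (simp add: binoid_basic_open_def)

text \<open>Modulo each prime ideal \<open>q\<close> with \<open>h \<notin> q\<close> the factor \<open>x\<close> is supported at one point \<open>a\<close>. As \<open>a\<close>
  divides a power of \<open>h\<close>, it lies outside all these prime ideals, so it does not depend on \<open>q\<close>.\<close>

lemma factor_of_monomial:
  assumes h: "h \<in> carrier M" and x: "x \<in> carrier KM" and y: "y \<in> carrier KM"
    and xy: "x \<otimes>\<^bsub>KM\<^esub> y = monomial K M (h [^]\<^bsub>M\<^esub> (k::nat))"
  obtains c a where "c \<in> carrier K" "c \<noteq> \<zero>\<^bsub>K\<^esub>" "a \<in> carrier M"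
    "\<And>q. binoid_prime M q \<Longrightarrow> h \<notin> q \<Longrightarrow> a \<notin> q"
    "monomial K M h \<otimes>\<^bsub>KM\<^esub> x = scaled_monomial K M c (h \<otimes>\<^bsub>M\<^esub> a)"
proof (cases "h = infty M")
  \<comment> \<open>Here \<open>T^h = 0\<close> and every prime contains \<open>h\<close>; the
    scalar and the exponent 1 are placeholders.\<close>
  case True
  have "monomial K M h = \<zero>\<^bsub>KM\<^esub>" unfolding monomial_eq_scaled True by (rule scaled_monomial_infty)
  moreover have "scaled_monomial K M \<one>\<^bsub>K\<^esub> (h \<otimes>\<^bsub>M\<^esub> \<one>\<^bsub>M\<^esub>) = \<zero>\<^bsub>KM\<^esub>"
    using scaled_monomial_infty[of "\<one>\<^bsub>K\<^esub>"] True by simp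
  ultimately show thesis
    using x prime_infty_mem True K_one_neq_zero by (intro that[of "\<one>\<^bsub>K\<^esub>" "\<one>\<^bsub>M\<^esub>"]) auto
next
  case False
  have local: "\<exists>a b. supp K M x - q = {a} \<and> b \<in> carrier M \<and> a \<otimes>\<^bsub>M\<^esub> b = h [^]\<^bsub>M\<^esub> k"
    if q: "binoid_prime M q" "h \<notin> q" for q
  proof -
    interpret Q: primeideal "combinatorial_ideal K M q" KM by (rule combinatorial_ideal_prime[OF q(1)])
    have hk: "h [^]\<^bsub>M\<^esub> k \<notin> q" by (rule prime_pow_notin[OF q(1) h q(2)])
    then have hkf: "h [^]\<^bsub>M\<^esub> k \<in> finite_part M"
      using prime_infty_mem[OF q(1)] h unfolding finite_part_def by (metis DiffI M.nat_pow_closed singletonD)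
    then have sxy: "supp K M (x \<otimes>\<^bsub>KM\<^esub> y) = {h [^]\<^bsub>M\<^esub> k}" unfolding xy by (rule supp_monomial)
    then have "x \<otimes>\<^bsub>KM\<^esub> y \<notin> combinatorial_ideal K M q" using hk combinatorial_ideal_mem_iff[OF q(1)] by blast
    then have "\<not> supp K M x \<subseteq> q" "\<not> supp K M y \<subseteq> q"
      using combinatorial_ideal_mem_iff[OF q(1)] x y Q.I_l_closed Q.I_r_closed by blast+
    then obtain a b a' b' where
      ab: "a \<in> supp K M x - q" "b \<in> supp K M y - q" "a' \<in> supp K M x - q" "b' \<in> supp K M y - q"
      and coeff: "(x \<otimes>\<^bsub>KM\<^esub> y) (a \<otimes>\<^bsub>M\<^esub> b) = x a \<otimes>\<^bsub>K\<^esub> y b"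
        "(x \<otimes>\<^bsub>KM\<^esub> y) (a' \<otimes>\<^bsub>M\<^esub> b') = x a' \<otimes>\<^bsub>K\<^esub> y b'"
      and single: "a \<otimes>\<^bsub>M\<^esub> b = a' \<otimes>\<^bsub>M\<^esub> b' \<longrightarrow> supp K M x - q = {a}"
      by (rule coeff_mult_extremal[OF q(1) x y]) (rule that)
    have prod: "a \<otimes>\<^bsub>M\<^esub> b = h [^]\<^bsub>M\<^esub> k"
      if ab: "a \<in> supp K M x - q" "b \<in> supp K M y - q"
        and coeff: "(x \<otimes>\<^bsub>KM\<^esub> y) (a \<otimes>\<^bsub>M\<^esub> b) = x a \<otimes>\<^bsub>K\<^esub> y b" for a b
    proof -
      have cM: "a \<in> carrier M" "b \<in> carrier M" using ab by (auto simp: supp_def)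
      have "x a \<otimes>\<^bsub>K\<^esub> y b \<noteq> \<zero>\<^bsub>K\<^esub>"
        using K_integral[of "x a" "y b"] coeff_supp_closed[OF x, of a] coeff_supp_closed[OF y, of b] ab
        by (auto simp: supp_def)
      moreover have "a \<otimes>\<^bsub>M\<^esub> b \<notin> q" using prime_mult_iff[OF q(1) cM] ab by blast
      then have "a \<otimes>\<^bsub>M\<^esub> b \<noteq> infty M" using prime_infty_mem[OF q(1)] by metis
      ultimately have "a \<otimes>\<^bsub>M\<^esub> b \<in> supp K M (x \<otimes>\<^bsub>KM\<^esub> y)"
        using coeff cM by (simp add: supp_def finite_part_def)
      then show ?thesis using sxy by blast
    qed
    \<comment> \<open>Both extremal products have nonzero coefficients, but \<open>h [^] k\<close>
      is the only term of \<open>x y\<close>. So the two coincide and \<open>x\<close> has one term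
      outside \<open>q\<close>.\<close>
    have "a \<otimes>\<^bsub>M\<^esub> b = h [^]\<^bsub>M\<^esub> k" "a' \<otimes>\<^bsub>M\<^esub> b' = h [^]\<^bsub>M\<^esub> k"
      using prod ab coeff by blast+
    moreover have "b \<in> carrier M" using ab by (auto simp: supp_def)
    ultimately show ?thesis using single by metis
  qed
  obtain q0 where q0: "binoid_prime M q0" "h \<notin> q0" using exists_prime_notin[OF h False] .
  obtain a b where a: "supp K M x - q0 = {a}" and b: "b \<in> carrier M" "a \<otimes>\<^bsub>M\<^esub> b = h [^]\<^bsub>M\<^esub> k"
    using local[OF q0] by blast
  have as: "a \<in> supp K M x" using a by blast
  then have aM: "a \<in> carrier M" by (simp add: supp_def)
  have aq: "a \<notin> q" if q: "binoid_prime M q" "h \<notin> q" for q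
    using prime_mult_iff[OF q(1) aM b(1)] b(2) prime_pow_notin[OF q(1) h q(2)] by metis
  have single: "supp K M x - q = {a}" if q: "binoid_prime M q" "h \<notin> q" for q
  proof -
    obtain a' where "supp K M x - q = {a'}" using local[OF q] by blast
    moreover have "a \<in> supp K M x - q" using as aq[OF q] by blast
    ultimately show ?thesis by simp
  qed
  have xa: "x a \<in> carrier K" "x a \<noteq> \<zero>\<^bsub>K\<^esub>" using coeff_supp_closed[OF x as] as by (auto simp: supp_def)
  have ha_q0: "h \<otimes>\<^bsub>M\<^esub> a \<notin> q0" using prime_mult_iff[OF q0(1) h aM] q0 aq[OF q0] by blast
  have haf: "h \<otimes>\<^bsub>M\<^esub> a \<in> finite_part M"
    using prime_infty_mem[OF q0(1)] ha_q0 h aM unfolding finite_part_def by (metis DiffI M.m_closed singletonD)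
  have hf: "h \<in> finite_part M" using False h by (simp add: finite_part_def)
  have hx: "monomial K M h \<otimes>\<^bsub>KM\<^esub> x \<in> carrier KM" using x by simp
  \<comment> \<open>Any other term \<open>a'\<close> of \<open>x\<close> lies in every prime missing
    \<open>h\<close>. Then \<open>h \<otimes> a'\<close> lies in all primes of M and is
    \<open>infty\<close>, so the factor \<open>T^h\<close> removes that term.\<close>
  have "monomial K M h \<otimes>\<^bsub>KM\<^esub> x = scaled_monomial K M (x a) (h \<otimes>\<^bsub>M\<^esub> a)"
  proof (rule algebra_eqI[OF hx scaled_monomial_closed[OF xa(1)]])
    fix e assume e: "e \<in> finite_part M"
    show "(monomial K M h \<otimes>\<^bsub>KM\<^esub> x) e = scaled_monomial K M (x a) (h \<otimes>\<^bsub>M\<^esub> a) e"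
    proof (cases "e = h \<otimes>\<^bsub>M\<^esub> a")
      case True
      have "(monomial K M h \<otimes>\<^bsub>KM\<^esub> x) (h \<otimes>\<^bsub>M\<^esub> a) = monomial K M h h \<otimes>\<^bsub>K\<^esub> x a"
      proof (rule coeff_mult_unique[OF monomial_closed x _ as haf])
        show "h \<in> supp K M (monomial K M h)" using supp_monomial[OF hf] by blast
        fix h' a' assume "h' \<in> supp K M (monomial K M h)" "a' \<in> supp K M x" and eq: "h' \<otimes>\<^bsub>M\<^esub> a' = h \<otimes>\<^bsub>M\<^esub> a"
        then have h': "h' = h" "a' \<in> carrier M" using supp_monomial[OF hf] by (auto simp: supp_def)
        have "a = a'" by (rule prime_cancel[OF q0(1) h aM h'(2)]) (use eq h' q0 aq[OF q0] in auto)
        then show "h' = h \<and> a' = a" using h' by blast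
      qed
      also have "\<dots> = x a" using xa hf by (simp add: monomial_def)
      finally show ?thesis using True haf by (simp add: scaled_monomial_def)
    next
      case neq: False
      have "e \<notin> supp K M (monomial K M h \<otimes>\<^bsub>KM\<^esub> x)"
      proof
        assume "e \<in> supp K M (monomial K M h \<otimes>\<^bsub>KM\<^esub> x)"
        then obtain a' where a': "a' \<in> supp K M x" "e = h \<otimes>\<^bsub>M\<^esub> a'"
          using supp_mult[of "monomial K M h" x] supp_monomial[OF hf] by auto
        have a'M: "a' \<in> carrier M" using a' by (simp add: supp_def)
        obtain q where q: "binoid_prime M q" "e \<notin> q"
          using exists_prime_notin[of e] e by (auto simp: finite_part_def)
        then have "h \<notin> q" "a' \<notin> q" using prime_mult_iff[OF q(1) h a'M] a' by auto
        then have "a' = a" using single[OF q(1)] a' by blast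
        then show False using neq a' by blast
      qed
      then show ?thesis using e neq by (simp add: supp_def scaled_monomial_def)
    qed
  qed
  with that xa aM aq show thesis by blast
qed

text \<open>The section and its inverse are \<open>x / T^(nh)\<close> and \<open>y / T^(mh)\<close>
  over \<open>D(T^h)\<close>. Their product being 1 yields an equation at the primes of
  \<open>D(T^h)\<close> only; one factor \<open>T^h\<close> makes it an equation in
  \<open>K[M]\<close>, and another one reduces \<open>x\<close> to a single term.\<close>

theorem unit_section_monomial_form:
  assumes s: "s \<in> unit_sections KM (ring_Spec KM) U"
    and h: "h \<in> carrier M" and hU: "ring_open KM {monomial K M h} \<subseteq> U"
    and prime: "\<And>P. P \<in> U \<Longrightarrow> primeideal P KM"
  obtains c a f where "c \<in> carrier K" "c \<noteq> \<zero>\<^bsub>K\<^esub>" "a \<in> carrier M" "f \<in> carrier M"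
    "\<And>q. binoid_prime M q \<Longrightarrow> h \<notin> q \<Longrightarrow> a \<notin> q \<and> f \<notin> q"
    "\<And>P. P \<in> ring_open KM {monomial K M h} \<Longrightarrow>
      s P = loc_frac KM (carrier KM - P) (scaled_monomial K M c a) (monomial K M f)"
proof -
  let ?D = "ring_open KM {monomial K M h}" and ?t = "monomial K M h"
  have sub: "submonoid (carrier KM - P) KM" if "primeideal P KM" for P
    using primeideal.complement_submonoid[OF that] .
  have absorb: "x \<otimes>\<^bsub>KM\<^esub> y \<in> P" if "P \<in> U" "x \<in> P" "y \<in> carrier KM" for P x y
    using ideal.I_r_closed[OF primeideal.axioms(1)[OF prime[OF that(1)]]] that by blast
  have subU: "submonoid (carrier KM - P) KM" if "P \<in> U" for P using sub prime that by blast
  have D: "primeideal P KM" if "P \<in> ?D" for P using that by (simp add: ring_open_def)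
  have "\<exists>r\<in>unit_sections KM (ring_Spec KM) U. \<forall>P\<in>U.
      loc_mult KM (carrier KM - P) (s P) (r P) = loc_frac KM (carrier KM - P) \<one>\<^bsub>KM\<^esub> \<one>\<^bsub>KM\<^esub> \<and>
      loc_mult KM (carrier KM - P) (r P) (s P) = loc_frac KM (carrier KM - P) \<one>\<^bsub>KM\<^esub> \<one>\<^bsub>KM\<^esub>"
    by (rule KM.unit_section_inverse[OF subU absorb s])
  then obtain r where r: "r \<in> unit_sections KM (ring_Spec KM) U"
    and sr: "\<And>P. P \<in> U \<Longrightarrow> loc_mult KM (carrier KM - P) (s P) (r P)
      = loc_frac KM (carrier KM - P) \<one>\<^bsub>KM\<^esub> \<one>\<^bsub>KM\<^esub>" by metis
  have fs: "unit_sections KM (ring_Spec KM) U \<subseteq> fraction_sections KM (ring_Spec KM) U"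
    by (rule KM.unit_sections_subset[OF subU absorb])
  have frac: "\<exists>x\<in>carrier KM. \<exists>n::nat. \<forall>P\<in>?D. s P = loc_frac KM (carrier KM - P) x (?t [^]\<^bsub>KM\<^esub> n)"
    if "s \<in> unit_sections KM (ring_Spec KM) U" for s
    by (rule KM.section_basic_open_fraction[OF _ subsetD[OF fs that] monomial_closed hU])
      (erule (1) algebra_reduced, blast)
  obtain x n where x: "x \<in> carrier KM"
    and sx: "\<And>P. P \<in> ?D \<Longrightarrow> s P = loc_frac KM (carrier KM - P) x (?t [^]\<^bsub>KM\<^esub> (n::nat))"
    using frac[OF s] by metis
  obtain y m where y: "y \<in> carrier KM"
    and ry: "\<And>P. P \<in> ?D \<Longrightarrow> r P = loc_frac KM (carrier KM - P) y (?t [^]\<^bsub>KM\<^esub> (m::nat))"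
    using frac[OF r] by metis
  have tP: "?t [^]\<^bsub>KM\<^esub> (n::nat) \<in> carrier KM - P" if "P \<in> ?D" for P n
    using prime_pow_notin[OF monomial_radical_prime[OF D[OF that]] h] that ring_open_monomial_iff[OF h]
      monomial_pow[OF h] monomial_radical_mem_iff h by simp
  define e where "e = x \<otimes>\<^bsub>KM\<^esub> y \<ominus>\<^bsub>KM\<^esub> ?t [^]\<^bsub>KM\<^esub> (n + m)"
  have e: "e \<in> carrier KM" using x y by (simp add: e_def)
  \<comment> \<open>A prime contains \<open>?t\<close>, or it belongs to \<open>?D\<close> and then
    contains \<open>e\<close> by the relation between section and inverse. So
    \<open>?t \<otimes> e\<close> lies in every prime of a reduced ring.\<close>
  have "?t \<otimes>\<^bsub>KM\<^esub> e = \<zero>\<^bsub>KM\<^esub>"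
  proof (rule KM.reduced_eq_zeroI[OF algebra_reduced])
    show "?t \<otimes>\<^bsub>KM\<^esub> e \<in> carrier KM" using e by simp
    fix P assume P: "primeideal P KM"
    interpret P: primeideal P KM by fact
    show "?t \<otimes>\<^bsub>KM\<^esub> e \<in> P"
    proof (cases "?t \<in> P")
      case True
      then show ?thesis using P.I_r_closed e by blast
    next
      case False
      then have PD: "P \<in> ?D" using P by (simp add: ring_open_def)
      have "loc_frac KM (carrier KM - P) (x \<otimes>\<^bsub>KM\<^esub> y) (?t [^]\<^bsub>KM\<^esub> (n + m))
          = loc_frac KM (carrier KM - P) \<one>\<^bsub>KM\<^esub> \<one>\<^bsub>KM\<^esub>"
        using sr[of P] PD hU sx[OF PD] ry[OF PD]
          KM.loc_mult_frac[OF sub[OF P] x y tP[OF PD, of n] tP[OF PD, of m]]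
        by (simp add: KM.nat_pow_mult subset_iff)
      moreover have "\<one>\<^bsub>KM\<^esub> \<in> carrier KM - P" using submonoid.one_closed[OF sub[OF P]] .
      ultimately obtain u where u: "u \<in> carrier KM" "u \<notin> P"
        and eq: "u \<otimes>\<^bsub>KM\<^esub> (x \<otimes>\<^bsub>KM\<^esub> y) = u \<otimes>\<^bsub>KM\<^esub> ?t [^]\<^bsub>KM\<^esub> (n + m)"
        using KM.loc_frac_eq_iff[OF sub[OF P], of "x \<otimes>\<^bsub>KM\<^esub> y" "\<one>\<^bsub>KM\<^esub>" "?t [^]\<^bsub>KM\<^esub> (n + m)" "\<one>\<^bsub>KM\<^esub>"]
          tP[OF PD, of "n + m"] x y by auto
      have "u \<otimes>\<^bsub>KM\<^esub> e = u \<otimes>\<^bsub>KM\<^esub> (x \<otimes>\<^bsub>KM\<^esub> y) \<ominus>\<^bsub>KM\<^esub> u \<otimes>\<^bsub>KM\<^esub> ?t [^]\<^bsub>KM\<^esub> (n + m)"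
        unfolding e_def using u x y by (simp add: KM.minus_eq KM.r_distr KM.r_minus)
      also have "\<dots> = \<zero>\<^bsub>KM\<^esub>" unfolding eq using u by (simp add: KM.minus_eq KM.r_neg)
      finally have "u \<otimes>\<^bsub>KM\<^esub> e \<in> P" using P.zero_closed by simp
      then have "e \<in> P" using P.I_prime[OF u(1) e] u by blast
      then show ?thesis using P.I_l_closed by simp
    qed
  qed auto
  then have "?t \<otimes>\<^bsub>KM\<^esub> (x \<otimes>\<^bsub>KM\<^esub> y) \<ominus>\<^bsub>KM\<^esub> ?t \<otimes>\<^bsub>KM\<^esub> ?t [^]\<^bsub>KM\<^esub> (n + m) = \<zero>\<^bsub>KM\<^esub>"
    unfolding e_def using x y by (simp add: KM.minus_eq KM.r_distr KM.r_minus)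
  then have "?t \<otimes>\<^bsub>KM\<^esub> (x \<otimes>\<^bsub>KM\<^esub> y) = ?t \<otimes>\<^bsub>KM\<^esub> ?t [^]\<^bsub>KM\<^esub> (n + m)"
    using x y by (simp add: KM.r_right_minus_eq)
  then have "x \<otimes>\<^bsub>KM\<^esub> (?t \<otimes>\<^bsub>KM\<^esub> y) = ?t [^]\<^bsub>KM\<^esub> (Suc (n + m))"
    using x y by (simp add: KM.m_ac)
  \<comment> \<open>The extra \<open>?t\<close> is attached to \<open>y\<close>, so that
    \<open>x\<close> itself is the factor of a monomial to be described.\<close>
  then have xty: "x \<otimes>\<^bsub>KM\<^esub> (?t \<otimes>\<^bsub>KM\<^esub> y) = monomial K M (h [^]\<^bsub>M\<^esub> Suc (n + m))"
    by (simp only: monomial_pow[OF h])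
  have ty: "?t \<otimes>\<^bsub>KM\<^esub> y \<in> carrier KM" using y by simp
  obtain c a where c: "c \<in> carrier K" "c \<noteq> \<zero>\<^bsub>K\<^esub>" and a: "a \<in> carrier M"
    and aq: "\<And>q. binoid_prime M q \<Longrightarrow> h \<notin> q \<Longrightarrow> a \<notin> q"
    and tx: "?t \<otimes>\<^bsub>KM\<^esub> x = scaled_monomial K M c (h \<otimes>\<^bsub>M\<^esub> a)"
    using factor_of_monomial[OF h x ty xty] by metis
  show thesis
  \<comment> \<open>Enlarging \<open>x / T^(nh)\<close> by \<open>T^h\<close> makes the numerator
    the single term \<open>c T^(ha)\<close> and raises the exponent of the denominator to
    \<open>Suc n\<close>.\<close>
  proof (rule that[OF c, of "h \<otimes>\<^bsub>M\<^esub> a" "h [^]\<^bsub>M\<^esub> Suc n"])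
    show "h \<otimes>\<^bsub>M\<^esub> a \<in> carrier M" "h [^]\<^bsub>M\<^esub> Suc n \<in> carrier M" using h a by simp_all
    show "h \<otimes>\<^bsub>M\<^esub> a \<notin> q \<and> h [^]\<^bsub>M\<^esub> Suc n \<notin> q" if q: "binoid_prime M q" "h \<notin> q" for q
      using prime_mult_iff[OF q(1) h a] aq[OF q] prime_pow_notin[OF q(1) h q(2)] q(2) by blast
    fix P assume P: "P \<in> ?D"
    have "\<one>\<^bsub>KM\<^esub> \<otimes>\<^bsub>KM\<^esub> (?t [^]\<^bsub>KM\<^esub> Suc n \<otimes>\<^bsub>KM\<^esub> x) = \<one>\<^bsub>KM\<^esub> \<otimes>\<^bsub>KM\<^esub> (?t [^]\<^bsub>KM\<^esub> n \<otimes>\<^bsub>KM\<^esub> (?t \<otimes>\<^bsub>KM\<^esub> x))"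
      using x by (simp add: KM.m_ac)
    moreover have "\<one>\<^bsub>KM\<^esub> \<in> carrier KM - P" using submonoid.one_closed[OF sub[OF D[OF P]]] .
    ultimately have "\<exists>u\<in>carrier KM - P. u \<otimes>\<^bsub>KM\<^esub> (?t [^]\<^bsub>KM\<^esub> Suc n \<otimes>\<^bsub>KM\<^esub> x)
        = u \<otimes>\<^bsub>KM\<^esub> (?t [^]\<^bsub>KM\<^esub> n \<otimes>\<^bsub>KM\<^esub> (?t \<otimes>\<^bsub>KM\<^esub> x))" by (rule rev_bexI[rotated])
    then have "loc_frac KM (carrier KM - P) x (?t [^]\<^bsub>KM\<^esub> n)
        = loc_frac KM (carrier KM - P) (?t \<otimes>\<^bsub>KM\<^esub> x) (?t [^]\<^bsub>KM\<^esub> Suc n)"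
      by (rule iffD2[OF KM.loc_frac_eq_iff[OF sub[OF D[OF P]] x KM.m_closed[OF monomial_closed x] tP[OF P] tP[OF P]]])
    then show "s P = loc_frac KM (carrier KM - P) (scaled_monomial K M c (h \<otimes>\<^bsub>M\<^esub> a))
        (monomial K M (h [^]\<^bsub>M\<^esub> Suc n))"
      unfolding sx[OF P] tx monomial_pow[OF h] .
  qed
qed

end

section \<open>The isomorphism\<close>

text \<open>\<open>X\<close> is a germ \<open>c T\<^sup>a / T\<^sup>f\<close> at \<open>P\<close> with \<open>T\<^sup>a\<close> and \<open>T\<^sup>f\<close> outside \<open>P\<close>, and \<open>Y\<close> is the fraction of \<open>a\<close> and \<open>f\<close>
  in the localization of \<open>M\<close> below \<open>P\<close>.\<close>

definition monomial_fraction ::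
  "('k, 'c) ring_scheme \<Rightarrow> ('m, 'b) binoid_scheme \<Rightarrow> ('m \<Rightarrow> 'k) set \<Rightarrow>
    (('m \<Rightarrow> 'k) \<times> ('m \<Rightarrow> 'k)) set \<Rightarrow> 'k \<Rightarrow> ('m \<times> 'm) set \<Rightarrow> bool"
  where "monomial_fraction K M P X c Y \<longleftrightarrow> c \<in> carrier K \<and> c \<noteq> \<zero>\<^bsub>K\<^esub> \<and>
    (\<exists>a\<in>carrier M - monomial_radical K M P. \<exists>f\<in>carrier M - monomial_radical K M P.
      X = loc_frac (binoid_algebra K M) (carrier (binoid_algebra K M) - P)
        (scaled_monomial K M c a) (monomial K M f) \<and>
      Y = loc_frac M (carrier M - monomial_radical K M P) a f)"

definition spec_preimage ::
  "('k, 'c) ring_scheme \<Rightarrow> ('m, 'b) binoid_scheme \<Rightarrow> ('m \<Rightarrow> 'k) set set \<Rightarrow> 'm set set"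
  where "spec_preimage K M U = {p. binoid_prime M p \<and> combinatorial_ideal K M p \<in> U}"

text \<open>The graph of the isomorphism. The second component is tested only at retractions of
  points of \<open>U\<close>; for combinatorial \<open>U\<close> these are all of
  \<open>spec_preimage K M U\<close>, because \<open>K[p]\<close> retracts to \<open>p\<close>.
  Extensionality fixes the values elsewhere.\<close>

definition decomposes ::
  "('k, 'c) ring_scheme \<Rightarrow> ('m, 'b) binoid_scheme \<Rightarrow> ('m \<Rightarrow> 'k) set set \<Rightarrow>
    (('m \<Rightarrow> 'k) set \<Rightarrow> (('m \<Rightarrow> 'k) \<times> ('m \<Rightarrow> 'k)) set) \<Rightarrow>
    (('m \<Rightarrow> 'k) set \<Rightarrow> 'k) \<times> ('m set \<Rightarrow> ('m \<times> 'm) set) \<Rightarrow> bool"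
  where "decomposes K M U s x \<longleftrightarrow>
    fst x \<in> extensional U \<and> snd x \<in> extensional (spec_preimage K M U) \<and>
    (\<forall>P\<in>U. monomial_fraction K M P (s P) (fst x P) (snd x (monomial_radical K M P)))"

context binoid
begin

lemma topspace_binoid_Spec: "topspace (binoid_Spec M) = {p. binoid_prime M p}"
proof -
  have "\<one> \<notin> p" if "binoid_prime M p" for p
    using submonoid.one_closed[OF prime_submonoid[OF that]] by simp
  then show ?thesis
    unfolding binoid_Spec_def topology_generated_by_topspace by (auto simp: binoid_basic_open_def)
qed

lemma openin_basic_open: "f \<in> carrier M \<Longrightarrow> openin (binoid_Spec M) (binoid_basic_open M f)"
  unfolding binoid_Spec_def by (rule topology_generated_by_Basis) blast

end

context cancellative_binoid_algebra
begin

lemma openin_ring_open: "z \<in> carrier KM \<Longrightarrow> openin (ring_Spec KM) (ring_open KM {z})"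
  unfolding ring_Spec_def by (rule topology_generated_by_Basis) blast

text \<open>Continuity of the retraction: preimages respect intersections and unions, and
  \<open>D(f)\<close> pulls back to \<open>D(T^f)\<close>.\<close>

lemma openin_radical_preimage:
  assumes "openin (binoid_Spec M) V"
  shows "openin (ring_Spec KM) {P. primeideal P KM \<and> monomial_radical K M P \<in> V}"
proof -
  have "generate_topology_on {binoid_basic_open M f |f. f \<in> carrier M} V"
    using assms by (simp add: binoid_Spec_def openin_topology_generated_by_iff)
  then show ?thesis
  proof induction
    case Empty
    then show ?case by simp
  next
    case (Int V W)
    have "{P. primeideal P KM \<and> monomial_radical K M P \<in> V \<inter> W}
        = {P. primeideal P KM \<and> monomial_radical K M P \<in> V} \<inter> {P. primeideal P KM \<and> monomial_radical K M P \<in> W}"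
      by blast
    then show ?case using openin_Int[OF Int.IH] by simp
  next
    case (UN \<V>)
    have "{P. primeideal P KM \<and> monomial_radical K M P \<in> \<Union>\<V>}
        = (\<Union>V\<in>\<V>. {P. primeideal P KM \<and> monomial_radical K M P \<in> V})" by blast
    moreover have "openin (ring_Spec KM) (\<Union>V\<in>\<V>. {P. primeideal P KM \<and> monomial_radical K M P \<in> V})"
      by (rule openin_Union) (use UN.IH in blast)
    ultimately show ?case by (simp only:)
  next
    case (Basis V)
    then obtain f where f: "f \<in> carrier M" "V = binoid_basic_open M f" by blast
    have "{P. primeideal P KM \<and> monomial_radical K M P \<in> V} = ring_open KM {monomial K M f}"
      using f monomial_radical_prime by (auto simp: binoid_basic_open_def ring_open_monomial_iff)
    then show ?case using openin_ring_open[OF monomial_closed] by simp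
  qed
qed

lemma combinatorial_open_prime:
  assumes "openin (combinatorial_topology K M) U" "P \<in> U"
  shows "primeideal P KM"
  using assms unfolding openin_combinatorial_topology_iff by (auto simp: ring_open_def)

lemma combinatorial_open_basic:
  assumes "openin (combinatorial_topology K M) U" "P \<in> U"
  obtains h where "h \<in> carrier M" "h \<notin> monomial_radical K M P" "ring_open KM {monomial K M h} \<subseteq> U"
proof -
  obtain I where I: "binoid_ideal M I" "U = ring_open KM (combinatorial_ideal K M I)"
    using assms(1) unfolding openin_combinatorial_topology_iff by blast
  then obtain h where h: "h \<in> I" "monomial K M h \<notin> P"
    using assms(2) mem_ring_open_combinatorial_iff by blast
  then have hM: "h \<in> carrier M" using I by (auto simp: binoid_ideal_def)
  have "ring_open KM {monomial K M h} \<subseteq> U"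
    using h(1) I(2) mem_ring_open_combinatorial_iff by (auto simp: ring_open_def)
  with that hM h show thesis by (simp add: monomial_radical_mem_iff)
qed

text \<open>Membership in a basic set \<open>D(T^h)\<close> depends on a prime only through its
  retraction.\<close>

lemma combinatorial_open_radical_iff:
  assumes U: "openin (combinatorial_topology K M) U" and P: "primeideal P KM" and Q: "primeideal Q KM"
    and eq: "monomial_radical K M P = monomial_radical K M Q" and PU: "P \<in> U"
  shows "Q \<in> U"
proof -
  obtain h where h: "h \<in> carrier M" "h \<notin> monomial_radical K M P" "ring_open KM {monomial K M h} \<subseteq> U"
    using combinatorial_open_basic[OF U PU] .
  then have "Q \<in> ring_open KM {monomial K M h}" using ring_open_monomial_iff Q eq by simp
  then show ?thesis using h(3) by blast
qed

lemma radical_mem_spec_preimage: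
  assumes U: "openin (combinatorial_topology K M) U" and PU: "P \<in> U"
  shows "monomial_radical K M P \<in> spec_preimage K M U"
proof -
  have P: "primeideal P KM" by (rule combinatorial_open_prime[OF assms])
  have p: "binoid_prime M (monomial_radical K M P)" by (rule monomial_radical_prime[OF P])
  have "combinatorial_ideal K M (monomial_radical K M P) \<in> U"
    by (rule combinatorial_open_radical_iff[OF U P combinatorial_ideal_prime[OF p] _ PU])
      (simp add: monomial_radical_combinatorial_ideal[OF p])
  then show ?thesis using p by (simp add: spec_preimage_def)
qed

lemma spec_preimageD:
  assumes "p \<in> spec_preimage K M U"
  shows "binoid_prime M p" "combinatorial_ideal K M p \<in> U"
    "monomial_radical K M (combinatorial_ideal K M p) = p"
  using assms monomial_radical_combinatorial_ideal by (auto simp: spec_preimage_def)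

text \<open>One direction gives uniqueness of the decomposition of a section, the other recovers the
  section from its decomposition.\<close>

lemma monomial_fraction_eq_iff:
  assumes P: "primeideal P KM" and 1: "monomial_fraction K M P X c Y" and 2: "monomial_fraction K M P X' c' Y'"
  shows "X = X' \<longleftrightarrow> c = c' \<and> Y = Y'"
proof -
  let ?N = "carrier M - monomial_radical K M P"
  obtain a f where 3: "c \<in> carrier K" "c \<noteq> \<zero>\<^bsub>K\<^esub>" "a \<in> ?N" "f \<in> ?N"
    "X = loc_frac KM (carrier KM - P) (scaled_monomial K M c a) (monomial K M f)" "Y = loc_frac M ?N a f"
    using 1 unfolding monomial_fraction_def by blast
  obtain b g where 4: "c' \<in> carrier K" "c' \<noteq> \<zero>\<^bsub>K\<^esub>" "b \<in> ?N" "g \<in> ?N"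
    "X' = loc_frac KM (carrier KM - P) (scaled_monomial K M c' b) (monomial K M g)" "Y' = loc_frac M ?N b g"
    using 2 unfolding monomial_fraction_def by blast
  show ?thesis
    unfolding 3(5,6) 4(5,6)
    by (rule loc_frac_scaled_monomial_eq_iff[OF P refl]) (use 3(1-4) 4(1-4) in auto)
qed

lemma monomial_fraction_mult:
  assumes P: "primeideal P KM" and 1: "monomial_fraction K M P X c Y" and 2: "monomial_fraction K M P X' c' Y'"
  shows "monomial_fraction K M P (loc_mult KM (carrier KM - P) X X') (c \<otimes>\<^bsub>K\<^esub> c')
    (loc_mult M (carrier M - monomial_radical K M P) Y Y')"
proof -
  let ?N = "carrier M - monomial_radical K M P"
  obtain a f where 3: "c \<in> carrier K" "c \<noteq> \<zero>\<^bsub>K\<^esub>" "a \<in> ?N" "f \<in> ?N"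
    "X = loc_frac KM (carrier KM - P) (scaled_monomial K M c a) (monomial K M f)" "Y = loc_frac M ?N a f"
    using 1 unfolding monomial_fraction_def by blast
  obtain b g where 4: "c' \<in> carrier K" "c' \<noteq> \<zero>\<^bsub>K\<^esub>" "b \<in> ?N" "g \<in> ?N"
    "X' = loc_frac KM (carrier KM - P) (scaled_monomial K M c' b) (monomial K M g)" "Y' = loc_frac M ?N b g"
    using 2 unfolding monomial_fraction_def by blast
  have subM: "submonoid ?N M" by (rule M.prime_submonoid[OF monomial_radical_prime[OF P]])
  have M: "a \<in> carrier M" "b \<in> carrier M" "f \<in> carrier M" "g \<in> carrier M" using 3 4 by auto
  have fg: "monomial K M f \<in> carrier KM - P" "monomial K M g \<in> carrier KM - P"
    using 3(4) 4(4) monomial_radical_mem_iff by auto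
  have "loc_mult KM (carrier KM - P) X X' = loc_frac KM (carrier KM - P)
      (scaled_monomial K M (c \<otimes>\<^bsub>K\<^esub> c') (a \<otimes>\<^bsub>M\<^esub> b)) (monomial K M (f \<otimes>\<^bsub>M\<^esub> g))"
    unfolding 3(5) 4(5)
    using KM.loc_mult_frac[OF primeideal.complement_submonoid[OF P] _ _ fg,
        of "scaled_monomial K M c a" "scaled_monomial K M c' b"] 3(1) 4(1) M
    by (simp add: mult_scaled_monomial mult_monomial)
  moreover have "loc_mult M ?N Y Y' = loc_frac M ?N (a \<otimes>\<^bsub>M\<^esub> b) (f \<otimes>\<^bsub>M\<^esub> g)"
    unfolding 3(6) 4(6) by (rule M.loc_mult_frac[OF subM M(1,2) 3(4) 4(4)])
  moreover have "a \<otimes>\<^bsub>M\<^esub> b \<in> ?N" "f \<otimes>\<^bsub>M\<^esub> g \<in> ?N"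
    using submonoid.m_closed[OF subM] 3 4 by blast+
  moreover have "c \<otimes>\<^bsub>K\<^esub> c' \<in> carrier K" "c \<otimes>\<^bsub>K\<^esub> c' \<noteq> \<zero>\<^bsub>K\<^esub>"
    using 3(1,2) 4(1,2) K_integral by auto
  ultimately show ?thesis unfolding monomial_fraction_def by blast
qed

section \<open>Decomposing unit sections: uniqueness, compatibility and existence\<close>

lemma decomposes_unique:
  assumes U: "openin (combinatorial_topology K M) U"
    and x: "decomposes K M U s x" and y: "decomposes K M U s y"
  shows "x = y"
proof (rule prod_eqI)
  have eq: "fst x P = fst y P \<and> snd x (monomial_radical K M P) = snd y (monomial_radical K M P)"
    if P: "P \<in> U" for P
  proof -
    have "monomial_fraction K M P (s P) (fst x P) (snd x (monomial_radical K M P))"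
      "monomial_fraction K M P (s P) (fst y P) (snd y (monomial_radical K M P))"
      using x y P unfolding decomposes_def by blast+
    from monomial_fraction_eq_iff[OF combinatorial_open_prime[OF U P] this] show ?thesis by simp
  qed
  show "fst x = fst y"
    by (rule extensionalityI[of _ U]) (use x y eq in \<open>auto simp: decomposes_def\<close>)
  show "snd x = snd y"
  proof (rule extensionalityI[of _ "spec_preimage K M U"])
    \<comment> \<open>The value at \<open>p\<close> is read off at the point \<open>K[p]\<close> of
      \<open>U\<close>.\<close>
    fix p assume "p \<in> spec_preimage K M U"
    from spec_preimageD[OF this] show "snd x p = snd y p" using eq[of "combinatorial_ideal K M p"] by simp
  qed (use x y in \<open>auto simp: decomposes_def\<close>)
qed

lemma decomposes_inj:
  assumes U: "openin (combinatorial_topology K M) U"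
    and s: "decomposes K M U s x" and t: "decomposes K M U t x"
    and ext: "s \<in> extensional U" "t \<in> extensional U"
  shows "s = t"
proof (rule extensionalityI[OF ext])
  fix P assume P: "P \<in> U"
  have "monomial_fraction K M P (s P) (fst x P) (snd x (monomial_radical K M P))"
    "monomial_fraction K M P (t P) (fst x P) (snd x (monomial_radical K M P))"
    using s t P unfolding decomposes_def by blast+
  from monomial_fraction_eq_iff[OF combinatorial_open_prime[OF U P] this] show "s P = t P" by simp
qed

lemma decomposes_mult:
  assumes U: "openin (combinatorial_topology K M) U"
    and s: "decomposes K M U s (l, v)" and t: "decomposes K M U t (m, w)"
  shows "decomposes K M U (\<lambda>P\<in>U. loc_mult KM (carrier KM - P) (s P) (t P))
    (\<lambda>P\<in>U. l P \<otimes>\<^bsub>K\<^esub> m P, \<lambda>p\<in>spec_preimage K M U. loc_mult M (carrier M - p) (v p) (w p))"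
  unfolding decomposes_def
proof (intro conjI ballI)
  fix P assume P: "P \<in> U"
  have "monomial_fraction K M P (s P) (l P) (v (monomial_radical K M P))"
    "monomial_fraction K M P (t P) (m P) (w (monomial_radical K M P))"
    using s t P unfolding decomposes_def by auto
  from monomial_fraction_mult[OF combinatorial_open_prime[OF U P] this]
  show "monomial_fraction K M P ((\<lambda>P\<in>U. loc_mult KM (carrier KM - P) (s P) (t P)) P)
      (fst (\<lambda>P\<in>U. l P \<otimes>\<^bsub>K\<^esub> m P, \<lambda>p\<in>spec_preimage K M U. loc_mult M (carrier M - p) (v p) (w p)) P)
      (snd (\<lambda>P\<in>U. l P \<otimes>\<^bsub>K\<^esub> m P, \<lambda>p\<in>spec_preimage K M U. loc_mult M (carrier M - p) (v p) (w p))
        (monomial_radical K M P))"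
    using P radical_mem_spec_preimage[OF U P] by simp
qed auto

lemma decomposes_restrict:
  assumes V: "openin (combinatorial_topology K M) V" and VU: "V \<subseteq> U"
    and s: "decomposes K M U s (l, v)"
  shows "decomposes K M V (restrict s V) (restrict l V, restrict v (spec_preimage K M V))"
  using s VU radical_mem_spec_preimage[OF V] unfolding decomposes_def by auto

lemma monomial_fraction_the:
  assumes P: "primeideal P KM" and 1: "monomial_fraction K M P X c Y"
  shows "(THE c. \<exists>Y. monomial_fraction K M P X c Y) = c" "(THE Y. \<exists>c. monomial_fraction K M P X c Y) = Y"
    "(THE X. monomial_fraction K M P X c Y) = X"
  using 1 monomial_fraction_eq_iff[OF P _ 1] by (auto intro!: the_equality)

text \<open>Scalar and fraction are defined pointwise from the germs, so they agree on overlaps by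
  construction. The monomial form over \<open>D(T^h)\<close> then shows that the scalar is constant
  there and that one fraction serves for all of \<open>D(h)\<close>.\<close>

lemma unit_section_decomposes:
  assumes U: "openin (combinatorial_topology K M) U"
    and s: "s \<in> unit_sections KM (ring_Spec KM) U"
  obtains x where "decomposes K M U s x"
    "fst x \<in> U \<rightarrow>\<^sub>E carrier K - {\<zero>\<^bsub>K\<^esub>}"
    "\<forall>P\<in>U. \<exists>V. openin (ring_Spec KM) V \<and> P \<in> V \<and> V \<subseteq> U \<and> (\<forall>Q\<in>V. fst x Q = fst x P)"
    "snd x \<in> unit_sections M (binoid_Spec M) (spec_preimage K M U)"
proof -
  let ?W = "spec_preimage K M U" and ?i = "combinatorial_ideal K M"
  define l where "l = (\<lambda>P\<in>U. THE c. \<exists>Y. monomial_fraction K M P (s P) c Y)"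
  define v where "v = (\<lambda>p\<in>?W. THE Y. \<exists>c. monomial_fraction K M (?i p) (s (?i p)) c Y)"
  have local_form: "\<exists>h\<in>carrier M. \<exists>c a f. h \<notin> monomial_radical K M P \<and> ring_open KM {monomial K M h} \<subseteq> U \<and>
      c \<in> carrier K - {\<zero>\<^bsub>K\<^esub>} \<and> a \<in> carrier M \<and> f \<in> carrier M \<and>
      (\<forall>q. binoid_prime M q \<longrightarrow> h \<notin> q \<longrightarrow> a \<notin> q \<and> f \<notin> q \<and> q \<in> ?W \<and> v q = loc_frac M (carrier M - q) a f) \<and>
      (\<forall>Q\<in>ring_open KM {monomial K M h}. l Q = c \<and>
        monomial_fraction K M Q (s Q) c (loc_frac M (carrier M - monomial_radical K M Q) a f))"
    if P: "P \<in> U" for P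
  proof -
    obtain h where h: "h \<in> carrier M" "h \<notin> monomial_radical K M P" "ring_open KM {monomial K M h} \<subseteq> U"
      using combinatorial_open_basic[OF U P] .
    have prime: "primeideal Q KM" if "Q \<in> U" for Q by (rule combinatorial_open_prime[OF U that])
    obtain c a f where c: "c \<in> carrier K" "c \<noteq> \<zero>\<^bsub>K\<^esub>" and af: "a \<in> carrier M" "f \<in> carrier M"
      and np: "\<And>q. binoid_prime M q \<Longrightarrow> h \<notin> q \<Longrightarrow> a \<notin> q \<and> f \<notin> q"
      and sQ: "\<And>Q. Q \<in> ring_open KM {monomial K M h} \<Longrightarrow>
        s Q = loc_frac KM (carrier KM - Q) (scaled_monomial K M c a) (monomial K M f)"
      by (rule unit_section_monomial_form[OF s h(1,3)]) (erule prime, (rule that; simp))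
    have frac: "monomial_fraction K M Q (s Q) c (loc_frac M (carrier M - monomial_radical K M Q) a f)"
      if Q: "Q \<in> ring_open KM {monomial K M h}" for Q
    proof -
      have "primeideal Q KM" "h \<notin> monomial_radical K M Q" using Q ring_open_monomial_iff[OF h(1)] by blast+
      then have "a \<notin> monomial_radical K M Q" "f \<notin> monomial_radical K M Q"
        using np monomial_radical_prime by blast+
      then show ?thesis using c af sQ[OF Q] unfolding monomial_fraction_def by blast
    qed
    have lQ: "l Q = c" if Q: "Q \<in> ring_open KM {monomial K M h}" for Q
      using monomial_fraction_the(1)[OF prime frac[OF Q]] Q h(3) by (auto simp: l_def)
    \<comment> \<open>\<open>D(T^h)\<close> lies in \<open>U\<close> and contains
      \<open>K[q]\<close> for every prime \<open>q\<close> missing \<open>h\<close>; hence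
      \<open>D(h)\<close> lies in \<open>?W\<close>.\<close>
    have vq: "q \<in> ?W \<and> v q = loc_frac M (carrier M - q) a f" if q: "binoid_prime M q" "h \<notin> q" for q
    proof -
      have r: "monomial_radical K M (?i q) = q" by (rule monomial_radical_combinatorial_ideal[OF q(1)])
      then have Q: "?i q \<in> ring_open KM {monomial K M h}"
        using q combinatorial_ideal_prime ring_open_monomial_iff[OF h(1)] by simp
      then have qW: "q \<in> ?W" using q h(3) by (auto simp: spec_preimage_def)
      then show ?thesis
        using monomial_fraction_the(2)[OF combinatorial_ideal_prime[OF q(1)] frac[OF Q]]
        by (simp add: v_def r)
    qed
    show ?thesis
      by (rule bexI[OF _ h(1)], rule exI[of _ c], rule exI[of _ a], rule exI[of _ f])
        (use h c af np vq lQ frac in simp)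
  qed
  show thesis
  proof (rule that[of "(l, v)"])
    show "decomposes K M U s (l, v)"
      unfolding decomposes_def
    proof (intro conjI ballI)
      fix P assume P: "P \<in> U"
      obtain h c a f where h: "h \<in> carrier M" "h \<notin> monomial_radical K M P"
        and v: "\<forall>q. binoid_prime M q \<longrightarrow> h \<notin> q \<longrightarrow> a \<notin> q \<and> f \<notin> q \<and> q \<in> ?W \<and> v q = loc_frac M (carrier M - q) a f"
        and l: "\<forall>Q\<in>ring_open KM {monomial K M h}. l Q = c \<and>
          monomial_fraction K M Q (s Q) c (loc_frac M (carrier M - monomial_radical K M Q) a f)"
        using local_form[OF P] by metis
      have "P \<in> ring_open KM {monomial K M h}"
        using h ring_open_monomial_iff combinatorial_open_prime[OF U P] by simp
      then show "monomial_fraction K M P (s P) (fst (l, v) P) (snd (l, v) (monomial_radical K M P))"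
        using l v monomial_radical_prime[OF combinatorial_open_prime[OF U P]] h(2) by simp
    qed (simp_all add: l_def v_def)
    show "fst (l, v) \<in> U \<rightarrow>\<^sub>E carrier K - {\<zero>\<^bsub>K\<^esub>}"
    proof (rule PiE_I)
      fix P assume P: "P \<in> U"
      then obtain h c where "h \<in> carrier M" "h \<notin> monomial_radical K M P" "c \<in> carrier K - {\<zero>\<^bsub>K\<^esub>}"
        "\<forall>Q\<in>ring_open KM {monomial K M h}. l Q = c"
        using local_form[OF P] by metis
      then show "fst (l, v) P \<in> carrier K - {\<zero>\<^bsub>K\<^esub>}"
        using ring_open_monomial_iff combinatorial_open_prime[OF U P] by simp
    qed (simp add: l_def)
    show "\<forall>P\<in>U. \<exists>V. openin (ring_Spec KM) V \<and> P \<in> V \<and> V \<subseteq> U \<and> (\<forall>Q\<in>V. fst (l, v) Q = fst (l, v) P)"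
    proof
      fix P assume P: "P \<in> U"
      then obtain h c where h: "h \<in> carrier M" "h \<notin> monomial_radical K M P"
        "ring_open KM {monomial K M h} \<subseteq> U" and l: "\<forall>Q\<in>ring_open KM {monomial K M h}. l Q = c"
        using local_form[OF P] by metis
      have "P \<in> ring_open KM {monomial K M h}"
        using h ring_open_monomial_iff combinatorial_open_prime[OF U P] by simp
      then show "\<exists>V. openin (ring_Spec KM) V \<and> P \<in> V \<and> V \<subseteq> U \<and> (\<forall>Q\<in>V. fst (l, v) Q = fst (l, v) P)"
        using l h(3) openin_ring_open[OF monomial_closed]
        by (intro exI[of _ "ring_open KM {monomial K M h}"]) simp
    qed
    show "snd (l, v) \<in> unit_sections M (binoid_Spec M) ?W"
      unfolding unit_sections_def
    proof (intro CollectI conjI ballI)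
      fix p assume p: "p \<in> ?W"
      note i = spec_preimageD[OF p]
      obtain h a f where h: "h \<in> carrier M" "h \<notin> p" and af: "a \<in> carrier M" "f \<in> carrier M"
        and v: "\<forall>q. binoid_prime M q \<longrightarrow> h \<notin> q \<longrightarrow> a \<notin> q \<and> f \<notin> q \<and> q \<in> ?W \<and> v q = loc_frac M (carrier M - q) a f"
        using local_form[OF i(2)] unfolding i(3) by metis
      show "\<exists>V. openin (binoid_Spec M) V \<and> p \<in> V \<and> V \<subseteq> ?W \<and> (\<exists>a\<in>carrier M. \<exists>f\<in>carrier M. \<forall>q\<in>V.
          a \<notin> q \<and> f \<notin> q \<and> snd (l, v) q = loc_frac M (carrier M - q) a f)"
        using M.openin_basic_open[OF h(1)] h i(1) v
        by (intro exI[of _ "binoid_basic_open M h"] conjI bexI[OF _ af(1)] bexI[OF _ af(2)])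
          (auto simp: binoid_basic_open_def)
    qed (simp add: v_def)
  qed
qed

text \<open>Surjectivity: the germs \<open>l P T^a / T^f\<close> are determined by the pair, and it
  remains to see that they locally come from one fraction of \<open>K[M]\<close>.\<close>

lemma exists_section_decomposes:
  assumes U: "openin (combinatorial_topology K M) U"
    and l: "l \<in> U \<rightarrow>\<^sub>E carrier K - {\<zero>\<^bsub>K\<^esub>}"
    and l_const: "\<forall>P\<in>U. \<exists>V. openin (ring_Spec KM) V \<and> P \<in> V \<and> V \<subseteq> U \<and> (\<forall>Q\<in>V. l Q = l P)"
    and v: "v \<in> unit_sections M (binoid_Spec M) (spec_preimage K M U)"
  obtains s where "s \<in> unit_sections KM (ring_Spec KM) U" "decomposes K M U s (l, v)"
proof -
  let ?W = "spec_preimage K M U" and ?r = "monomial_radical K M"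
  define s where "s = (\<lambda>P\<in>U. THE X. monomial_fraction K M P X (l P) (v (?r P)))"
  have prime: "primeideal P KM" if "P \<in> U" for P by (rule combinatorial_open_prime[OF U that])
  have lK: "l P \<in> carrier K" "l P \<noteq> \<zero>\<^bsub>K\<^esub>" if "P \<in> U" for P using l that by auto
  have s_eq: "s P = loc_frac KM (carrier KM - P) (scaled_monomial K M (l P) a) (monomial K M f) \<and>
      monomial_fraction K M P (s P) (l P) (v (?r P))"
    if P: "P \<in> U" and af: "a \<in> carrier M" "f \<in> carrier M" "a \<notin> ?r P" "f \<notin> ?r P"
      and v: "v (?r P) = loc_frac M (carrier M - ?r P) a f" for P a f
  proof -
    let ?X = "loc_frac KM (carrier KM - P) (scaled_monomial K M (l P) a) (monomial K M f)"
    have "monomial_fraction K M P ?X (l P) (v (?r P))"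
      unfolding monomial_fraction_def v using af lK[OF P] by blast
    moreover from monomial_fraction_the(3)[OF prime[OF P] this] have "s P = ?X" using P by (simp add: s_def)
    ultimately show ?thesis by simp
  qed
  have local_v: "\<exists>V. openin (binoid_Spec M) V \<and> ?r P \<in> V \<and> V \<subseteq> ?W \<and> (\<exists>a\<in>carrier M. \<exists>f\<in>carrier M.
      \<forall>q\<in>V. a \<notin> q \<and> f \<notin> q \<and> v q = loc_frac M (carrier M - q) a f)" if P: "P \<in> U" for P
    using v radical_mem_spec_preimage[OF U P] unfolding unit_sections_def by simp
  have "decomposes K M U s (l, v)"
    unfolding decomposes_def
  proof (intro conjI ballI)
    fix P assume P: "P \<in> U"
    from local_v[OF P] obtain a f where "a \<in> carrier M" "f \<in> carrier M" "a \<notin> ?r P" "f \<notin> ?r P"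
      "v (?r P) = loc_frac M (carrier M - ?r P) a f" by metis
    from conjunct2[OF s_eq[OF P this]]
    show "monomial_fraction K M P (s P) (fst (l, v) P) (snd (l, v) (?r P))" unfolding fst_conv snd_conv .
  next
    show "fst (l, v) \<in> extensional U" using l by (simp add: PiE_def)
    show "snd (l, v) \<in> extensional ?W" using v by (simp add: unit_sections_def)
  qed
  moreover have "s \<in> unit_sections KM (ring_Spec KM) U"
    unfolding unit_sections_def
  proof (intro CollectI conjI ballI)
    show "s \<in> extensional U" by (simp add: s_def)
    fix P assume P: "P \<in> U"
    obtain V where V: "openin (ring_Spec KM) V" "P \<in> V" "V \<subseteq> U" "\<forall>Q\<in>V. l Q = l P"
      using l_const P by blast
    from local_v[OF P] obtain V' a f where V': "openin (binoid_Spec M) V'" "?r P \<in> V'"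
      and af: "a \<in> carrier M" "f \<in> carrier M"
      and v: "\<forall>q\<in>V'. a \<notin> q \<and> f \<notin> q \<and> v q = loc_frac M (carrier M - q) a f" by metis
    \<comment> \<open>The scalar is constant on a Zariski neighbourhood, while \<open>v\<close> is
      one fraction on an open set of \<open>Spec M\<close>. The latter is pulled back along the
      retraction and intersected with the former; the result is Zariski open but need not be
      combinatorial.\<close>
    let ?V = "V \<inter> {Q. primeideal Q KM \<and> ?r Q \<in> V'}"
    let ?x = "scaled_monomial K M (l P) a" and ?y = "monomial K M f"
    have frac: "?x \<notin> Q \<and> ?y \<notin> Q \<and> s Q = loc_frac KM (carrier KM - Q) ?x ?y" if Q: "Q \<in> ?V" for Q
    proof -
      have QU: "Q \<in> U" and Qp: "primeideal Q KM" and lQ: "l Q = l P" and rQ: "?r Q \<in> V'"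
        using Q V(3,4) by blast+
      have nr: "a \<notin> ?r Q" "f \<notin> ?r Q" and vQ: "v (?r Q) = loc_frac M (carrier M - ?r Q) a f"
        using bspec[OF v rQ] by simp_all
      have "s Q = loc_frac KM (carrier KM - Q) ?x ?y" using s_eq[OF QU af nr vQ] lQ by simp
      moreover have "?x \<notin> Q" by (rule scaled_monomial_notin[OF Qp af(1) nr(1) lK[OF P]])
      moreover have "?y \<notin> Q" using nr(2) af(2) by (simp add: monomial_radical_def)
      ultimately show ?thesis by blast
    qed
    have V_open: "openin (ring_Spec KM) ?V" by (rule openin_Int[OF V(1) openin_radical_preimage[OF V'(1)]])
    have PV: "P \<in> ?V" "?V \<subseteq> U" using V V'(2) prime[OF P] by auto
    have x: "?x \<in> carrier KM" using lK[OF P] by simp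
    have "\<exists>x\<in>carrier KM. \<exists>y\<in>carrier KM. \<forall>Q\<in>?V.
        x \<notin> Q \<and> y \<notin> Q \<and> s Q = loc_frac KM (carrier KM - Q) x y"
    proof (rule bexI[OF _ x], rule bexI[OF _ monomial_closed])
      show "\<forall>Q\<in>?V. ?x \<notin> Q \<and> ?y \<notin> Q \<and> s Q = loc_frac KM (carrier KM - Q) ?x ?y"
        by (rule ballI) (rule frac)
    qed
    with V_open PV show "\<exists>V. openin (ring_Spec KM) V \<and> P \<in> V \<and> V \<subseteq> U \<and> (\<exists>x\<in>carrier KM. \<exists>y\<in>carrier KM. \<forall>Q\<in>V.
        x \<notin> Q \<and> y \<notin> Q \<and> s Q = loc_frac KM (carrier KM - Q) x y)"
      by (intro exI[of _ ?V] conjI)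
  qed
  ultimately show thesis using that by blast
qed

lemma ring_unit_sections:
  assumes U: "openin (combinatorial_topology K M) U"
  shows "Units (sections (ring_structure_sheaf KM) U) = unit_sections KM (ring_Spec KM) U"
proof (rule KM.Units_fraction_sections)
  note prime = combinatorial_open_prime[OF U]
  show "submonoid (carrier KM - P) KM" if "P \<in> U" for P
    by (rule primeideal.complement_submonoid[OF prime[OF that]])
  show "x \<otimes>\<^bsub>KM\<^esub> y \<in> P" if "P \<in> U" "x \<in> P" "y \<in> carrier KM" for P x y
    by (rule ideal.I_r_closed[OF primeideal.axioms(1)[OF prime[OF that(1)]] that(2,3)])
qed (simp_all add: ring_structure_sheaf_def ring_localization_def)

lemma binoid_unit_sections:
  assumes W: "\<And>p. p \<in> W \<Longrightarrow> binoid_prime M p"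
  shows "Units (sections (binoid_structure_sheaf M) W) = unit_sections M (binoid_Spec M) W"
proof (rule M.Units_fraction_sections)
  show "submonoid (carrier M - p) M" if "p \<in> W" for p by (rule M.prime_submonoid[OF W[OF that]])
  show "a \<otimes>\<^bsub>M\<^esub> b \<in> p" if "p \<in> W" "a \<in> p" "b \<in> carrier M" for p a b
    using W[OF that(1)] that by (simp add: binoid_prime_def binoid_ideal_def)
qed (simp_all add: binoid_structure_sheaf_def binoid_localization_def)

lemma Units_K: "Units K = carrier K - {\<zero>\<^bsub>K\<^esub>}"
  by (rule field.field_Units[OF field_K])

end

theorem proposition3p34:
  fixes K :: "('k, 'c) ring_scheme" and M :: "('m, 'b) binoid_scheme"
  assumes "field K"
    and "binoid M"
    and "binoid_finitely_generated M"
    and "binoid_reduced M"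
    and "binoid_torsion_free M"
    and "binoid_cancellative M"
  shows "sheaf_isomorphic
    (comb K M (units_sheaf (ring_structure_sheaf (binoid_algebra K M))))
    (sheaf_direct_sum
      (comb K M (constant_sheaf (ring_Spec (binoid_algebra K M)) (units_of K)))
      (comb K M (pushforward (ring_Spec (binoid_algebra K M)) (combinatorial_ideal K M)
        (units_sheaf (binoid_structure_sheaf M)))))"
proof -
  let ?F = "comb K M (units_sheaf (ring_structure_sheaf (binoid_algebra K M)))"
    and ?C = "comb K M (constant_sheaf (ring_Spec (binoid_algebra K M)) (units_of K))"
    and ?B = "comb K M (pushforward (ring_Spec (binoid_algebra K M)) (combinatorial_ideal K M)
      (units_sheaf (binoid_structure_sheaf M)))"
  interpret cancellative_binoid_algebra K M
    using assms domain.axioms(1)[OF field.axioms(1)[OF assms(1)]]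
    by (intro cancellative_binoid_algebra.intro binoid_over_cring.intro cancellative_binoid_algebra_axioms.intro)
  let ?W = "spec_preimage K M"
  define \<phi> where "\<phi> U s = (THE x. decomposes K M U s x)" for U s
  have pre: "{p \<in> topspace (binoid_Spec M). combinatorial_ideal K M p \<in> U} = ?W U" for U
    by (auto simp: M.topspace_binoid_Spec spec_preimage_def)
  have base: "base_space ?F = combinatorial_topology K M" "base_space (sheaf_direct_sum ?C ?B) = combinatorial_topology K M"
    by (simp_all add: comb_def sheaf_direct_sum_def)
  have F: "carrier (sections ?F U) = unit_sections KM (ring_Spec KM) U"
    "s \<otimes>\<^bsub>sections ?F U\<^esub> t = (\<lambda>P\<in>U. loc_mult KM (carrier KM - P) (s P) (t P))"
    if "openin (combinatorial_topology K M) U" for U s t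
    using ring_unit_sections[OF that]
    by (simp_all add: comb_def units_sheaf_def units_of_def)
      (simp add: ring_structure_sheaf_def ring_localization_def)
  have C: "carrier (sections ?C U) = {l \<in> U \<rightarrow>\<^sub>E carrier K - {\<zero>\<^bsub>K\<^esub>}.
      \<forall>P\<in>U. \<exists>V. openin (ring_Spec KM) V \<and> P \<in> V \<and> V \<subseteq> U \<and> (\<forall>Q\<in>V. l Q = l P)}"
    "l \<otimes>\<^bsub>sections ?C U\<^esub> m = (\<lambda>P\<in>U. l P \<otimes>\<^bsub>K\<^esub> m P)" for U l m
    by (simp_all add: comb_def constant_sheaf_def units_of_def Units_K)
  have B: "carrier (sections ?B U) = unit_sections M (binoid_Spec M) (?W U)"
    "v \<otimes>\<^bsub>sections ?B U\<^esub> w = (\<lambda>p\<in>?W U. loc_mult M (carrier M - p) (v p) (w p))" for U v w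
  proof -
    have "base_space (binoid_structure_sheaf M) = binoid_Spec M"
      by (simp add: binoid_structure_sheaf_def)
    then have *: "sections ?B U = units_of (sections (binoid_structure_sheaf M) (?W U))"
      by (simp add: comb_def pushforward_def units_sheaf_def pre Let_def)
    show "carrier (sections ?B U) = unit_sections M (binoid_Spec M) (?W U)"
      unfolding * units_of_def using binoid_unit_sections[of "?W U"] by (simp add: spec_preimage_def)
    show "v \<otimes>\<^bsub>sections ?B U\<^esub> w = (\<lambda>p\<in>?W U. loc_mult M (carrier M - p) (v p) (w p))"
      unfolding * units_of_def by (simp add: binoid_structure_sheaf_def binoid_localization_def)
  qed
  have S: "sections (sheaf_direct_sum ?C ?B) U = sections ?C U \<times>\<times> sections ?B U" for U
    by (simp add: sheaf_direct_sum_def)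
  have \<phi>: "\<phi> U s = x" if "openin (combinatorial_topology K M) U" "decomposes K M U s x" for U s x
    unfolding \<phi>_def by (rule the_equality) (use that decomposes_unique in blast)+
  have dec: "decomposes K M U s (\<phi> U s) \<and> \<phi> U s \<in> carrier (sections ?C U) \<times> carrier (sections ?B U)"
    if U: "openin (combinatorial_topology K M) U" and s: "s \<in> carrier (sections ?F U)" for U s
  proof -
    obtain x where x: "decomposes K M U s x"
      "fst x \<in> U \<rightarrow>\<^sub>E carrier K - {\<zero>\<^bsub>K\<^esub>}"
      "\<forall>P\<in>U. \<exists>V. openin (ring_Spec KM) V \<and> P \<in> V \<and> V \<subseteq> U \<and> (\<forall>Q\<in>V. fst x Q = fst x P)"
      "snd x \<in> unit_sections M (binoid_Spec M) (?W U)"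
      using unit_section_decomposes[OF U s[unfolded F(1)[OF U]]] .
    show ?thesis
      unfolding \<phi>[OF U x(1)] mem_Times_iff C(1) B(1) using x by blast
  qed
  show ?thesis
    unfolding sheaf_isomorphic_def base
  proof (intro conjI refl exI[of _ \<phi>] allI impI ballI)
    fix U assume U: "openin (combinatorial_topology K M) U"
    show "\<phi> U \<in> iso (sections ?F U) (sections (sheaf_direct_sum ?C ?B) U)"
      unfolding S
    proof (rule isoI)
      show "\<phi> U \<in> hom (sections ?F U) (sections ?C U \<times>\<times> sections ?B U)"
      proof (rule homI)
        fix s assume s: "s \<in> carrier (sections ?F U)"
        show "\<phi> U s \<in> carrier (sections ?C U \<times>\<times> sections ?B U)" using dec[OF U s] by simp
        fix t assume t: "t \<in> carrier (sections ?F U)"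
        obtain l v where lv: "\<phi> U s = (l, v)" by fastforce
        obtain m w where mw: "\<phi> U t = (m, w)" by fastforce
        have "decomposes K M U s (l, v)" "decomposes K M U t (m, w)"
          using dec[OF U s] dec[OF U t] lv mw by simp_all
        \<comment> \<open>The product of two decompositions decomposes the product, so uniqueness
          alone makes the map a homomorphism.\<close>
        from \<phi>[OF U decomposes_mult[OF U this]]
        show "\<phi> U (s \<otimes>\<^bsub>sections ?F U\<^esub> t) = \<phi> U s \<otimes>\<^bsub>sections ?C U \<times>\<times> sections ?B U\<^esub> \<phi> U t"
          unfolding F(2)[OF U] lv mw mult_DirProd C(2) B(2) .
      qed
      show "bij_betw (\<phi> U) (carrier (sections ?F U)) (carrier (sections ?C U \<times>\<times> sections ?B U))"
      proof (rule bij_betw_imageI)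
        show "inj_on (\<phi> U) (carrier (sections ?F U))"
        proof (rule inj_onI)
          fix s t assume s: "s \<in> carrier (sections ?F U)" and t: "t \<in> carrier (sections ?F U)"
            and eq: "\<phi> U s = \<phi> U t"
          have "s \<in> extensional U" "t \<in> extensional U"
            using s t unfolding F(1)[OF U] by (simp_all add: unit_sections_def)
          then show "s = t" using decomposes_inj[OF U, of s "\<phi> U s" t] dec[OF U s] dec[OF U t] eq by simp
        qed
        show "\<phi> U ` carrier (sections ?F U) = carrier (sections ?C U \<times>\<times> sections ?B U)"
        proof (intro equalityI subsetI)
          fix x assume "x \<in> \<phi> U ` carrier (sections ?F U)"
          then show "x \<in> carrier (sections ?C U \<times>\<times> sections ?B U)" using dec[OF U] by auto
        next
          fix x assume "x \<in> carrier (sections ?C U \<times>\<times> sections ?B U)"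
          then obtain l v where x: "x = (l, v)" and l: "l \<in> carrier (sections ?C U)"
            and v: "v \<in> carrier (sections ?B U)" by auto
          obtain s where "s \<in> unit_sections KM (ring_Spec KM) U" "decomposes K M U s (l, v)"
            using l v exists_section_decomposes[OF U] unfolding C(1) B(1) by blast
          then show "x \<in> \<phi> U ` carrier (sections ?F U)"
            unfolding F(1)[OF U] x using \<phi>[OF U] by (intro rev_image_eqI) auto
        qed
      qed
    qed
  next
    fix U V s assume UV: "openin (combinatorial_topology K M) U \<and> openin (combinatorial_topology K M) V \<and> V \<subseteq> U"
      and s: "s \<in> carrier (sections ?F U)"
    obtain l v where lv: "\<phi> U s = (l, v)" by fastforce
    have rF: "restr ?F U V s = restrict s V"
      by (simp add: comb_def units_sheaf_def ring_structure_sheaf_def)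
    have rG: "restr (sheaf_direct_sum ?C ?B) U V (l, v) = (restrict l V, restrict v (?W V))"
      using pre by (simp add: comb_def sheaf_direct_sum_def constant_sheaf_def pushforward_def units_sheaf_def
          binoid_structure_sheaf_def Let_def)
    have "decomposes K M U s (l, v)" using dec[OF _ s] UV lv by simp
    \<comment> \<open>Naturality is again uniqueness: restricting a decomposition decomposes the
      restricted section.\<close>
    then have "\<phi> V (restrict s V) = (restrict l V, restrict v (?W V))"
      using \<phi> decomposes_restrict UV by blast
    then show "\<phi> V (restr ?F U V s) = restr (sheaf_direct_sum ?C ?B) U V (\<phi> U s)"
      unfolding lv rF rG .
  qed
qed

end
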